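(* For each even integer $k\ge 12$, let $(a_j^{(k)})_{1\le j\le m(k)}$ be real numbers such that $$(3+\delta_{12})\sum_{j=1}^{m(k)-1}|a_j^{(k)}|\,\epsilon^j+(3+\delta_s)\,|a_{m(k)}^{(k)}|\,\epsilon^{m(k)}\le 20\left(\frac12\right)^{k/2},$$ where $k=12\,m(k)+s$ and $\epsilon:=\sup_{z\in A}|\Delta(z)|$. Let $(f_k)_k$ be the family of normalised modular forms for $\mathbf{SL}(2,\mathbb{Z})$ defined by $$f_k:=E_k+\sum_{j=1}^{m(k)}a_j^{(k)}E_{k-12j}\,\Delta^j .$$ Then the zeros of $f_k$ in the fundamental domain $\mathbb{F}$ lie on the arc $A$. Further, the zeros of $f_k$ and those of $f_{k+12}$ interlace in $A^\circ$ for each even $k\ge 12$.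
   Context: Every even integer $k\ge 4$ is written uniquely as $k=12\,m(k)+s$ with $m(k)\ge 0$ an integer and $s\in\{0,4,6,8,10,14\}$; this defines $m(k)$ and $s$ (note $m(k+12)=m(k)+1$). $\mathbb{H}$ is the complex upper half plane. The standard fundamental domain for $\mathbf{SL}(2,\mathbb{Z})$ acting on $\mathbb{H}$ is $$\mathbb{F}:=\{z\in\mathbb{H}: |z|\ge 1,\ -\tfrac12\le \Re(z)\le 0\}\cup\{z\in\mathbb{H}: |z|>1,\ 0<\Re(z)<\tfrac12\}.$$ The arcs are $$A:=\{e^{i\theta}: \tfrac{\pi}{2}\le\theta\le\tfrac{2\pi}{3}\},\qquad A^\circ:=\{e^{i\theta}: \tfrac{\pi}{2}<\theta<\tfrac{2\pi}{3}\}.$$ For even $k\ge 4$ the Eisenstein series of weight $k$ is $E_k(z):=\frac12\sum_{c,d\in\mathbb{Z},\,(c,d)=1}\frac{1}{(cz+d)^k}$, and $E_0:=1$. The cusp form $\Delta$ is $\Delta:=\frac{E_4^3-E_6^2}{1728}$. The constants $\delta_t$ are: $\delta_0=-2$, $\delta_4=1.009$, $\delta_6=0.304$, $\delta_8=0.122$, $\delta_{10}=0.051$, and $\delta_t=0.022$ for $t\ge 12$. Interlacing: let $\alpha<\beta$ and let $f,g$ be complex valued functions with simple zeros in $(\alpha,\beta)$. Let $\alpha<t_1<\cdots<t_m<\beta$ and $\alpha<t_1^*<\cdots<t_{m+1}^*<\beta$ be the zeros of $f$ and $g$ in $(\alpha,\beta)$, respectively. The zeros of $f$ and $g$ interlace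 in $(\alpha,\beta)$ if $t_j^*<t_j<t_{j+1}^*$ for $1\le j\le m$. The zeros of $f_k$ and $f_{k+12}$ are said to interlace in $A^\circ$ if the zeros of $G_k(\theta):=e^{ik\theta/2}f_k(e^{i\theta})$ and $G_{k+12}(\theta):=e^{i(k+12)\theta/2}f_{k+12}(e^{i\theta})$ interlace in $(\pi/2,2\pi/3)$ (with $G_k$ in the role of $f$, having $m=m(k)$ zeros there, and $G_{k+12}$ in the role of $g$, having $m(k)+1$ zeros there). Convention: if $m(k)=0$ (i.e. $k=14$) there are no coefficients $a_j^{(k)}$, and the left-hand side of the hypothesis is read as $0$. *)

theory Defs
  imports "HOL-Analysis.Analysis"
begin

text \<open>For even \<open>k \<ge> 4\<close> the decomposition \<open>k = 12 * wt_m k + wt_s k\<close> exists and is unique; see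
  \<open>wt_decomp_unique\<close> below.\<close>

definition wt_residues :: "nat set" where
  "wt_residues = {0, 4, 6, 8, 10, 14}"

definition wt_m :: "nat \<Rightarrow> nat" where
  "wt_m k = (THE m. \<exists>s\<in>wt_residues. k = 12 * m + s)"

definition wt_s :: "nat \<Rightarrow> nat" where
  "wt_s k = (THE s. s \<in> wt_residues \<and> (\<exists>m. k = 12 * m + s))"

lemma wt_decomp_unique:
  assumes "s \<in> wt_residues" "k = 12 * m + s"
  shows "wt_m k = m" "wt_s k = s"
proof -
  have *: "m' = m \<and> s' = s" if "s' \<in> wt_residues" "k = 12 * m' + s'" for m' s'
    using assms that unfolding wt_residues_def by (elim insertE emptyE) presburger+
  show "wt_m k = m"
    unfolding wt_m_def by (rule the_equality) (use assms * in blast)+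
  show "wt_s k = s"
    unfolding wt_s_def by (rule the_equality) (use assms * in blast)+
qed

lemma wt_decomp_exists:
  assumes "even k" "k \<ge> 4"
  obtains m s where "s \<in> wt_residues" "k = 12 * m + s"
proof (cases "k mod 12 = 2")
  case True
  then have "k = 12 * (k div 12 - 1) + 14"
    using assms by presburger
  then show ?thesis
    by (rule that[rotated]) (simp add: wt_residues_def)
next
  case False
  have "k mod 12 \<in> wt_residues"
    using False assms unfolding wt_residues_def insert_iff empty_iff by presburger
  then show ?thesis
    by (rule that[where m = "k div 12"]) simp
qed

lemma wt_decomp:
  assumes "even k" "k \<ge> 4"
  shows "wt_s k \<in> wt_residues" "k = 12 * wt_m k + wt_s k"
  using wt_decomp_exists[OF assms] wt_decomp_unique by metis+

definition upper_half_plane :: "complex set" where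
  "upper_half_plane = {z. Im z > 0}"

definition fund_domain :: "complex set" where
  "fund_domain =
     {z \<in> upper_half_plane. cmod z \<ge> 1 \<and> - 1 / 2 \<le> Re z \<and> Re z \<le> 0} \<union>
     {z \<in> upper_half_plane. cmod z > 1 \<and> 0 < Re z \<and> Re z < 1 / 2}"

definition unit_arc :: "complex set" where
  "unit_arc = cis ` {pi / 2..2 * pi / 3}"

text \<open>The unordered sum converges absolutely exactly for \<open>k \<ge> 3\<close>; only even \<open>k \<ge> 4\<close> and \<open>k = 0\<close>
  are used.\<close>

definition eisenstein :: "nat \<Rightarrow> complex \<Rightarrow> complex" where
  "eisenstein k z =
     (if k = 0 then 1
      else 1 / 2 * (\<Sum>\<^sub>\<infinity>(c, d)\<in>{(c :: int, d :: int). coprime c d}.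
                      1 / (of_int c * z + of_int d) ^ k))"

definition cusp_delta :: "complex \<Rightarrow> complex" where
  "cusp_delta z = (eisenstein 4 z ^ 3 - eisenstein 6 z ^ 2) / 1728"

definition eps :: real where
  "eps = (SUP z\<in>unit_arc. cmod (cusp_delta z))"

text \<open>Only the values at \<open>t \<in> {0, 4, 6, 8, 10}\<close> and \<open>t \<ge> 12\<close> are meaningful.\<close>

definition delta_const :: "nat \<Rightarrow> real" where
  "delta_const t =
     (if t = 0 then - 2
      else if t = 4 then 1.009
      else if t = 6 then 0.304
      else if t = 8 then 0.122
      else if t = 10 then 0.051
      else 0.022)"

text \<open>The conditional implements the reading of an empty family of coefficients: without it the
  term for \<open>j = wt_m k\<close> would refer to a coefficient with index \<open>0\<close>.\<close>

definition coeff_size :: "(nat \<Rightarrow> real) \<Rightarrow> nat \<Rightarrow> real" where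
  "coeff_size a k =
     (if wt_m k = 0 then 0
      else (3 + delta_const 12) * (\<Sum>j = 1..wt_m k - 1. \<bar>a j\<bar> * eps ^ j)
           + (3 + delta_const (wt_s k)) * \<bar>a (wt_m k)\<bar> * eps ^ wt_m k)"

text \<open>The subtraction does not truncate, since \<open>12 * j \<le> 12 * wt_m k \<le> k\<close>.\<close>

definition mod_form :: "(nat \<Rightarrow> real) \<Rightarrow> nat \<Rightarrow> complex \<Rightarrow> complex" where
  "mod_form a k z =
     eisenstein k z
     + (\<Sum>j = 1..wt_m k. of_real (a j) * eisenstein (k - 12 * j) z * cusp_delta z ^ j)"

definition simple_zeros_on :: "(real \<Rightarrow> complex) \<Rightarrow> real set \<Rightarrow> bool" where
  "simple_zeros_on f S \<longleftrightarrow>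
     (\<forall>x\<in>S. f x = 0 \<longrightarrow> (\<exists>D. (f has_vector_derivative D) (at x) \<and> D \<noteq> 0))"

text \<open>The two set equations say that \<open>t 1 < \<dots> < t m\<close> and \<open>u 1 < \<dots> < u (m + 1)\<close> enumerate all
  zeros of \<open>f\<close> and of \<open>g\<close> in the open interval. The case \<open>m = 0\<close> is allowed.\<close>

definition zeros_interlace ::
    "nat \<Rightarrow> (real \<Rightarrow> complex) \<Rightarrow> (real \<Rightarrow> complex) \<Rightarrow> real \<Rightarrow> real \<Rightarrow> bool" where
  "zeros_interlace m f g \<alpha> \<beta> \<longleftrightarrow>
     simple_zeros_on f {\<alpha><..<\<beta>} \<and> simple_zeros_on g {\<alpha><..<\<beta>} \<and>
     (\<exists>t u :: nat \<Rightarrow> real.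
        strict_mono_on {1..m} t \<and> t ` {1..m} = {x \<in> {\<alpha><..<\<beta>}. f x = 0} \<and>
        strict_mono_on {1..m + 1} u \<and> u ` {1..m + 1} = {x \<in> {\<alpha><..<\<beta>}. g x = 0} \<and>
        (\<forall>j\<in>{1..m}. u j < t j \<and> t j < u (j + 1)))"

definition arc_fun :: "nat \<Rightarrow> (complex \<Rightarrow> complex) \<Rightarrow> real \<Rightarrow> complex" where
  "arc_fun k f \<theta> = cis (real k * \<theta> / 2) * f (cis \<theta>)"

definition interlace_on_arc :: "nat \<Rightarrow> (complex \<Rightarrow> complex) \<Rightarrow> (complex \<Rightarrow> complex) \<Rightarrow> bool" where
  "interlace_on_arc k f g \<longleftrightarrow>
     zeros_interlace (wt_m k) (arc_fun k f) (arc_fun (k + 12) g) (pi / 2) (2 * pi / 3)"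

end

theory Submission
  imports Defs "HOL-Complex_Analysis.Complex_Analysis"
begin

text \<open>
  Let \<open>G\<^sub>k \<theta> = exp (\<i> * k * \<theta> / 2) * f\<^sub>k (exp (\<i> * \<theta>))\<close>. On the arc this function is real, and the bound on
  the coefficients keeps it within \<open>22 * (1 / 2) ^ (k / 2)\<close> of
  \<open>2 * cos (k * \<theta> / 2) + 1 / (2 + 2 * cos \<theta>) ^ (k / 2)\<close>, the contribution of the three dominant pairs
  \<open>(c, d)\<close>, up to sign, to \<open>E\<^sub>k\<close> (\<open>eisenstein_on_arc\<close>, \<open>mod_form_perturbation\<close>). The second term is at most 1, so at
  the angles \<open>2 * pi * n / k\<close> the sign of \<open>G\<^sub>k\<close> is \<open>(- 1) ^ n\<close>. There are \<open>m(k) + 1\<close> such angles in the closed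
  arc, hence at least \<open>m(k)\<close> zeros on the open arc.

  There are no further zeros because a modular form of weight \<open>12 * m + s\<close> is a monomial in \<open>E\<^sub>4\<close> and \<open>E\<^sub>6\<close>
  of weight \<open>s\<close>, times \<open>\<Delta> ^ m\<close>, times a polynomial of degree at most \<open>m\<close> in \<open>j\<close> (\<open>modular_structure\<close>). The zeros
  found on the arc use up all roots of this polynomial (\<open>zeros_from_sign_changes\<close>). The valence formula
  is avoided. The maximum principle, applied to the invariant modulus \<open>\<bar>f\<bar> * y powr (k / 2)\<close>, bounds the
  order of vanishing at the cusp (\<open>order_at_cusp_bound\<close>), and a sharper comparison of the same kind shows
  that \<open>\<Delta>\<close> has no zeros (\<open>delta_nonzero\<close>). That \<open>E\<^sub>4\<close>, \<open>E\<^sub>6\<close> and the differences of \<open>j\<close>-values do not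
  vanish where they should not is seen by letting the weight grow: at a point of the fundamental domain
  outside the closed unit disc \<open>E\<^sub>k\<close> tends to 1, and on the arc it oscillates like \<open>2 * cos (k * \<theta> / 2)\<close>
  (\<open>base_forms_nonzero_arc\<close>, \<open>j_separates\<close>).

  For the interlacing, let \<open>t\<close> be a zero of \<open>G\<^sub>k\<close> between \<open>2 * pi * n / k\<close> and \<open>2 * pi * (n + 1) / k\<close>. Then
  \<open>G\<close> of weight \<open>k + 12\<close> has the sign \<open>(- 1) ^ n\<close> at \<open>t\<close> (\<open>interlacing_sign\<close>). It therefore changes sign between
  consecutive zeros of \<open>G\<^sub>k\<close> and also before the first and after the last one. This accounts for
  \<open>m(k) + 1\<close> zeros, which is all it has.
\<close>

section \<open>Sums over integer pairs\<close>

definition supnorm :: "int \<times> int \<Rightarrow> nat" where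
  "supnorm p = nat (max \<bar>fst p\<bar> \<bar>snd p\<bar>)"

lemma box_eq: "{p. supnorm p \<le> N} = {- int N..int N} \<times> {- int N..int N}"
  by (auto simp: supnorm_def)

lemma finite_box: "finite {p. supnorm p \<le> N}"
  unfolding box_eq by simp

lemma card_layer: "card {p. supnorm p = Suc N} = 8 * Suc N"
proof -
  have eq: "{p. supnorm p = Suc N} = {p. supnorm p \<le> Suc N} - {p. supnorm p \<le> N}"
    by auto
  have "card {p. supnorm p = Suc N} = card {p. supnorm p \<le> Suc N} - card {p. supnorm p \<le> N}"
    unfolding eq by (rule card_Diff_subset[OF finite_box]) auto
  also have "\<dots> = (2 * N + 3) * (2 * N + 3) - (2 * N + 1) * (2 * N + 1)"
    unfolding box_eq by (simp add: card_cartesian_product nat_add_distrib nat_mult_distrib algebra_simps)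
  also have "\<dots> = 8 * Suc N" by (simp add: algebra_simps)
  finally show ?thesis .
qed

lemma sum_box:
  fixes w :: "nat \<Rightarrow> real"
  assumes "m \<le> N"
  shows "(\<Sum>p | m < supnorm p \<and> supnorm p \<le> N. w (supnorm p)) = (\<Sum>M\<in>{m<..N}. 8 * real M * w M)"
  using assms
proof (induction N rule: dec_induct)
  case base
  have "{p. m < supnorm p \<and> supnorm p \<le> m} = {}" by auto
  then show ?case by (simp only: sum.empty) simp
next
  case (step N)
  have eq: "{p. m < supnorm p \<and> supnorm p \<le> Suc N} =
      {p. m < supnorm p \<and> supnorm p \<le> N} \<union> {p. supnorm p = Suc N}" using step by auto
  have fin: "finite {p. m < supnorm p \<and> supnorm p \<le> N}" "finite {p. supnorm p = Suc N}"
    by (rule finite_subset[OF _ finite_box[of "Suc N"]]; auto)+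
  have "{m<..Suc N} = insert (Suc N) {m<..N}" using step by auto
  then show ?case
    unfolding eq using step.IH fin card_layer[of N]
    by (subst sum.union_disjoint) (auto simp: algebra_simps)
qed

text \<open>There are \<open>8 * M\<close> integer pairs of supremum norm \<open>M\<close>, so a sum over pairs is controlled by a
  single series.\<close>

lemma lattice_sum_bound:
  fixes w :: "nat \<Rightarrow> real"
  assumes nonneg: "\<And>M. w M \<ge> 0"
    and bound: "\<And>N. (\<Sum>M\<in>{m<..N}. 8 * real M * w M) \<le> B"
  shows "(\<lambda>p. w (supnorm p)) summable_on {p. m < supnorm p}"
    and "(\<Sum>\<^sub>\<infinity>p | m < supnorm p. w (supnorm p)) \<le> B"
proof -
  have fin: "sum (\<lambda>p. w (supnorm p)) F \<le> B" if F: "finite F" "F \<subseteq> {p. m < supnorm p}" for F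
  proof -
    define N where "N = Max (insert m (supnorm ` F))"
    have le: "m \<le> N" "supnorm p \<le> N" if "p \<in> F" for p
      using F that by (auto simp: N_def)
    have mN: "m \<le> N" using F by (auto simp: N_def)
    have "sum (\<lambda>p. w (supnorm p)) F \<le> (\<Sum>p | m < supnorm p \<and> supnorm p \<le> N. w (supnorm p))"
      by (rule sum_mono2) (use F le nonneg in \<open>auto intro: finite_subset[OF _ finite_box[of N]]\<close>)
    also have "\<dots> \<le> B" using sum_box[OF mN] bound by simp
    finally show ?thesis .
  qed
  then show sm: "(\<lambda>p. w (supnorm p)) summable_on {p. m < supnorm p}"
    by (intro nonneg_bdd_above_summable_on) (auto simp: nonneg bdd_above_def)
  show "(\<Sum>\<^sub>\<infinity>p | m < supnorm p. w (supnorm p)) \<le> B"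
    by (rule infsum_le_finite_sums[OF sm]) (use fin in auto)
qed

text \<open>The exponent stays below the smallest weight 4. The power that is left over makes \<open>E\<^sub>k\<close> tend to 1 at
  the cusp for all weights, including 4.\<close>

lemma lattice_cube_summable:
  "(\<lambda>p. 1 / real (supnorm p) ^ 3) summable_on {p. 0 < supnorm p}"
proof (rule lattice_sum_bound(1)[where w = "\<lambda>M. 1 / real M ^ 3" and B = 16])
  fix N :: nat
  have termwise: "8 * x * (1 / x ^ 3) = 8 / x ^ 2" if "x > 0" for x :: real
    using that by (simp add: power2_eq_square power3_eq_cube)
  have "(\<Sum>M\<in>{0<..Suc N}. 8 * real M * (1 / real M ^ 3)) \<le> 16 - 8 / (real N + 1)" for N
  proof (induction N)
    case (Suc N)
    have eq: "{0<..Suc (Suc N)} = insert (Suc (Suc N)) {0<..Suc N}" by auto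
    have "8 * real (Suc (Suc N)) * (1 / real (Suc (Suc N)) ^ 3) = 8 / (real N + 2) ^ 2"
      using termwise[of "real (Suc (Suc N))"] by (simp add: add_ac)
    also have "\<dots> \<le> 8 / ((real N + 1) * (real N + 2))"
      by (rule divide_left_mono) (auto simp: power2_eq_square)
    also have "\<dots> = 8 / (real N + 1) - 8 / (real N + 2)"
      by (simp add: divide_simps)
    finally show ?case using Suc unfolding eq by (simp add: add_ac)
  next
    case 0
    have "{0<..Suc 0} = {1}" by auto
    then show ?case by simp
  qed
  note * = this
  show "(\<Sum>M\<in>{0<..N}. 8 * real M * (1 / real M ^ 3)) \<le> 16"
  proof (cases N)
    case (Suc n)
    show ?thesis unfolding Suc by (rule order_trans[OF *[of n]]) simp
  qed simp
qed simp

text \<open>The numerical value enters the error term of the Eisenstein series on the arc. The inverse cubes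
  are compared with the telescoping terms \<open>1 / ((M - 1) * M * (M + 1))\<close>.\<close>

lemma lattice_fourth_tail:
  "(\<lambda>p. 1 / real (supnorm p) ^ 4) summable_on {p. 2 < supnorm p}"
  "(\<Sum>\<^sub>\<infinity>p | 2 < supnorm p. 1 / real (supnorm p) ^ 4) \<le> 2 / 3"
proof -
  have "(\<Sum>M\<in>{2<..N}. 8 * real M * (1 / real M ^ 4)) \<le> 2 / 3" for N :: nat
  proof (cases "N < 2")
    case False
    then have "2 \<le> N" by simp
    then have "(\<Sum>M\<in>{2<..N}. 8 * real M * (1 / real M ^ 4)) \<le> 2 / 3 - 4 / (real N * (real N + 1))"
    proof (induction N rule: dec_induct)
      case (step N)
      have eq: "{2<..Suc N} = insert (Suc N) {2<..N}" using step by auto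
      have N: "real N \<ge> 2" using step by simp
      have "8 * x * (1 / x ^ 4) = 8 / x ^ 3" if "x > 0" for x :: real
        using that by (simp add: power4_eq_xxxx power3_eq_cube)
      from this[of "real (Suc N)"]
      have "8 * real (Suc N) * (1 / real (Suc N) ^ 4) = 8 / (real N + 1) ^ 3"
        by (simp add: add_ac)
      also have "\<dots> \<le> 8 / (real N * (real N + 1) * (real N + 2))"
      proof (rule divide_left_mono)
        show "real N * (real N + 1) * (real N + 2) \<le> (real N + 1) ^ 3"
          by (simp add: power3_eq_cube algebra_simps)
      qed (use N in auto)
      also have "\<dots> = 4 / (real N * (real N + 1)) - 4 / ((real N + 1) * (real N + 2))"
        using N by (simp add: divide_simps)
      also have "(real N + 1) * (real N + 2) = real (Suc N) * (real (Suc N) + 1)" by (simp add: add_ac)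
      finally have layer: "8 * real (Suc N) * (1 / real (Suc N) ^ 4)
        \<le> 4 / (real N * (real N + 1)) - 4 / (real (Suc N) * (real (Suc N) + 1))" .
      have "(\<Sum>M\<in>{2<..Suc N}. 8 * real M * (1 / real M ^ 4)) =
          8 * real (Suc N) * (1 / real (Suc N) ^ 4) + (\<Sum>M\<in>{2<..N}. 8 * real M * (1 / real M ^ 4))"
        unfolding eq by (rule sum.insert) auto
      also have "\<dots> \<le> (4 / (real N * (real N + 1)) - 4 / (real (Suc N) * (real (Suc N) + 1))) +
          (2 / 3 - 4 / (real N * (real N + 1)))"
        by (rule add_mono[OF layer step.IH])
      also have "\<dots> = 2 / 3 - 4 / (real (Suc N) * (real (Suc N) + 1))" by simp
      finally show ?case .
    qed simp
    also have "\<dots> \<le> 2 / 3" by simp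
    finally show ?thesis .
  qed simp
  note * = lattice_sum_bound[where w = "\<lambda>M. 1 / real M ^ 4" and m = 2 and B = "2/3", OF _ this]
  show "(\<lambda>p. 1 / real (supnorm p) ^ 4) summable_on {p. 2 < supnorm p}"
    "(\<Sum>\<^sub>\<infinity>p | 2 < supnorm p. 1 / real (supnorm p) ^ 4) \<le> 2 / 3"
    by (rule *; simp)+
qed

section \<open>Eisenstein series on the upper half plane\<close>

abbreviation lin :: "complex \<Rightarrow> int \<times> int \<Rightarrow> complex" where
  "lin z p \<equiv> of_int (fst p) * z + of_int (snd p)"

abbreviation prim :: "(int \<times> int) set" where
  "prim \<equiv> {(c, d). coprime c d}"

lemma supnorm_prim: "p \<in> prim \<Longrightarrow> supnorm p > 0"
proof (rule ccontr)
  assume p: "p \<in> prim" and "\<not> supnorm p > 0"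
  then have "fst p = 0" "snd p = 0" by (auto simp: supnorm_def)
  then have "p = (0, 0)" by (simp add: prod_eq_iff)
  then show False using p by simp
qed

lemma supnorm_alt: "real (supnorm p) = max \<bar>real_of_int (fst p)\<bar> \<bar>real_of_int (snd p)\<bar>"
  by (auto simp: supnorm_def max_def)

lemma eisenstein_eq:
  assumes "k > 0"
  shows "eisenstein k z = 1 / 2 * (\<Sum>\<^sub>\<infinity>p\<in>prim. 1 / lin z p ^ k)"
  using assms by (simp add: eisenstein_def case_prod_unfold)

text \<open>The constant depends on \<open>z\<close> only through bounds for \<open>Im z\<close> and \<open>cmod z\<close>, so Eisenstein series
  converge locally uniformly.\<close>

lemma lin_lower_bound:
  assumes "b > 0" "Im z \<ge> b" "cmod z \<le> B"
  shows "real (supnorm p) * b \<le> (1 + B + b) * cmod (lin z p)"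
proof -
  define c d where "c = real_of_int (fst p)" and "d = real_of_int (snd p)"
  have B: "B \<ge> 0" using assms(3) norm_ge_zero order_trans by blast
  have lin: "lin z p = of_real c * z + of_real d" by (simp add: c_def d_def)
  have "\<bar>c\<bar> * b \<le> \<bar>c\<bar> * \<bar>Im z\<bar>" using assms by (intro mult_left_mono) auto
  also have "\<dots> = \<bar>Im (lin z p)\<bar>" by (simp add: lin abs_mult)
  also have "\<dots> \<le> cmod (lin z p)" by (rule abs_Im_le_cmod)
  finally have c: "\<bar>c\<bar> * b \<le> cmod (lin z p)" .
  have "\<bar>d\<bar> = cmod (lin z p - of_real c * z)" by (simp add: lin)
  also have "\<dots> \<le> cmod (lin z p) + cmod (of_real c * z)" by (rule norm_triangle_ineq4)
  also have "\<dots> \<le> cmod (lin z p) + \<bar>c\<bar> * B"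
    using assms(3) by (simp add: norm_mult mult_left_mono)
  finally have "\<bar>d\<bar> * b \<le> (cmod (lin z p) + \<bar>c\<bar> * B) * b"
    using assms(1) by (intro mult_right_mono) auto
  also have "\<dots> = cmod (lin z p) * b + \<bar>c\<bar> * b * B" by (simp add: algebra_simps)
  also have "\<dots> \<le> cmod (lin z p) * b + cmod (lin z p) * B"
    using c B by (intro add_left_mono mult_right_mono)
  finally have d: "\<bar>d\<bar> * b \<le> (b + B) * cmod (lin z p)" by (simp add: algebra_simps)
  have "\<bar>c\<bar> * b \<le> (1 + B + b) * cmod (lin z p)"
    using c mult_right_mono[of 1 "1 + B + b" "cmod (lin z p)"] B assms(1) by auto
  moreover have "\<bar>d\<bar> * b \<le> (1 + B + b) * cmod (lin z p)"
    using d mult_right_mono[of "b + B" "1 + B + b" "cmod (lin z p)"] by auto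
  ultimately show ?thesis by (simp add: supnorm_alt max_def c_def d_def)
qed

lemma inverse_power_bound:
  fixes x s C :: real and k :: nat
  assumes "s \<ge> 1" "C > 0" "s \<le> C * x" "k \<ge> 3"
  shows "1 / x ^ k \<le> C ^ k * (1 / s ^ 3)"
proof -
  have x: "x > 0" using assms by (smt (verit) zero_less_mult_pos)
  have "s ^ 3 \<le> s ^ k" using assms by (intro power_increasing) auto
  also have "\<dots> \<le> (C * x) ^ k" using assms by (intro power_mono) auto
  finally have "s ^ 3 \<le> C ^ k * x ^ k" by (simp add: power_mult_distrib)
  then show ?thesis using x assms by (simp add: field_simps)
qed

lemma eisenstein_term_bound:
  assumes "b > 0" "Im z \<ge> b" "cmod z \<le> B" "k \<ge> 3" "p \<in> prim"
  shows "cmod (1 / lin z p ^ k) \<le> ((1 + B + b) / b) ^ k * (1 / real (supnorm p) ^ 3)"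
proof -
  have B: "B \<ge> 0" using assms(3) norm_ge_zero order_trans by blast
  have "1 / cmod (lin z p) ^ k \<le> ((1 + B + b) / b) ^ k * (1 / real (supnorm p) ^ 3)"
  proof (rule inverse_power_bound)
    show "1 \<le> real (supnorm p)" using supnorm_prim[OF assms(5)] by simp
    show "0 < (1 + B + b) / b" using assms(1) B by simp
    show "real (supnorm p) \<le> (1 + B + b) / b * cmod (lin z p)"
      using lin_lower_bound[OF assms(1-3), of p] assms(1)
      by (simp only: times_divide_eq_left pos_le_divide_eq)
  qed (rule assms)
  then show ?thesis by (simp add: norm_divide norm_power)
qed

lemma summable_prim: "(\<lambda>p. C * (1 / real (supnorm p) ^ 3)) summable_on prim"
proof (rule summable_on_cmult_right)
  have "prim \<subseteq> {p. 0 < supnorm p}" using supnorm_prim by (intro subsetI) simp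
  then show "(\<lambda>p. 1 / real (supnorm p) ^ 3) summable_on prim"
    by (rule summable_on_subset_banach[OF lattice_cube_summable])
qed

lemma eisenstein_abs_summable:
  assumes "Im z > 0" "k \<ge> 3"
  shows "(\<lambda>p. cmod (1 / lin z p ^ k)) summable_on prim"
proof (rule Infinite_Sum.abs_summable_on_comparison_test')
  show "(\<lambda>p. ((1 + cmod z + Im z) / Im z) ^ k * (1 / real (supnorm p) ^ 3)) summable_on prim"
    by (rule summable_prim)
  show "cmod (1 / lin z p ^ k) \<le> ((1 + cmod z + Im z) / Im z) ^ k * (1 / real (supnorm p) ^ 3)"
    if "p \<in> prim" for p
    by (rule eisenstein_term_bound[OF assms(1) order_refl order_refl assms(2) that])
qed

lemma eisenstein_summable:
  assumes "Im z > 0" "k \<ge> 3"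
  shows "(\<lambda>p. 1 / lin z p ^ k) summable_on prim"
  by (rule abs_summable_summable) (rule eisenstein_abs_summable[OF assms])

lemma lin_nonzero:
  assumes "Im z > 0" "p \<in> prim"
  shows "lin z p \<noteq> 0"
  using lin_lower_bound[OF assms(1) order_refl order_refl, of p] supnorm_prim[OF assms(2)] assms(1)
  by (auto simp: mult_le_0_iff)

lemma eisenstein_holomorphic:
  assumes "k \<ge> 3"
  shows "eisenstein k holomorphic_on {z. Im z > 0}"
proof -
  have loc: "\<exists>r>0. eisenstein k holomorphic_on ball z r" if z: "Im z > 0" for z
  proof -
    define r b B where "r = Im z / 2" and "b = Im z / 2" and "B = cmod z + r"
    have pos: "r > 0" "b > 0" using z by (auto simp: r_def b_def)
    have w: "Im w \<ge> b" "cmod w \<le> B" if "w \<in> cball z r" for w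
    proof -
      have "cmod (z - w) \<le> r" using that by (simp add: dist_norm)
      then show "Im w \<ge> b" using abs_Im_le_cmod[of "z - w"] by (simp add: r_def b_def)
      have "cmod w \<le> cmod z + cmod (w - z)" by (rule norm_triangle_sub)
      then show "cmod w \<le> B" using \<open>cmod (z - w) \<le> r\<close> by (simp add: B_def norm_minus_commute)
    qed
    define S where "S = (\<lambda>z. \<Sum>\<^sub>\<infinity>p\<in>prim. 1 / lin z p ^ k)"
    have ulim: "uniform_limit (cball z r) (\<lambda>X w. \<Sum>p\<in>X. 1 / lin w p ^ k) S (finite_subsets_at_top prim)"
      unfolding S_def
    proof (rule Weierstrass_m_test_general)
      show "cmod (1 / lin w p ^ k) \<le> ((1 + B + b) / b) ^ k * (1 / real (supnorm p) ^ 3)"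
        if "p \<in> prim" "w \<in> cball z r" for p w
        by (rule eisenstein_term_bound[OF pos(2) w[OF that(2)] assms that(1)])
    qed (rule summable_prim)
    have ne: "lin w p \<noteq> 0" if "w \<in> cball z r" "p \<in> prim" for w p
      using lin_nonzero w(1)[OF that(1)] pos that(2) by force
    have hol: "(\<lambda>w. \<Sum>p\<in>X. 1 / lin w p ^ k) holomorphic_on cball z r" if "X \<subseteq> prim" for X
      by (intro holomorphic_intros) (use that ne in auto)
    have ev: "\<forall>\<^sub>F X in finite_subsets_at_top prim. continuous_on (cball z r) (\<lambda>w. \<Sum>p\<in>X. 1 / lin w p ^ k)
         \<and> (\<lambda>w. \<Sum>p\<in>X. 1 / lin w p ^ k) holomorphic_on ball z r"
      by (rule eventually_finite_subsets_at_top_weakI)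
         (use hol holomorphic_on_imp_continuous_on holomorphic_on_subset[OF _ ball_subset_cball] in blast)
    have "S holomorphic_on ball z r"
      by (rule holomorphic_uniform_limit[OF ev ulim]) auto
    then have "(\<lambda>w. 1 / 2 * S w) holomorphic_on ball z r" by (intro holomorphic_intros)
    moreover have "eisenstein k = (\<lambda>w. 1 / 2 * S w)"
      using assms by (auto simp: fun_eq_iff eisenstein_eq S_def)
    ultimately show ?thesis using pos by auto
  qed
  show ?thesis
  proof (rule holomorphic_on_subset)
    show "eisenstein k holomorphic_on (\<Union>z\<in>{z. Im z > 0}. ball z (SOME r. r > 0 \<and> eisenstein k holomorphic_on ball z r))"
      by (rule holomorphic_on_UN_open) (use someI_ex[OF loc] in auto)
    show "{z. Im z > 0} \<subseteq> (\<Union>z\<in>{z. Im z > 0}. ball z (SOME r. r > 0 \<and> eisenstein k holomorphic_on ball z r))"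
      using someI_ex[OF loc] by force
  qed
qed

lemma bij_prim_shift: "bij_betw (\<lambda>p. (fst p, fst p + snd p)) prim prim"
proof (rule bij_betw_byWitness[where f' = "\<lambda>p. (fst p, snd p - fst p)"])
  have add: "coprime c (c + d) \<longleftrightarrow> coprime c d" for c d :: int
    by (simp add: coprime_iff_gcd_eq_1)
  have diff: "coprime c (d - c) \<longleftrightarrow> coprime c d" for c d :: int
    using add[of c "d - c"] by simp
  show "(\<lambda>p. (fst p, fst p + snd p)) ` prim \<subseteq> prim" by (auto simp: add)
  show "(\<lambda>p. (fst p, snd p - fst p)) ` prim \<subseteq> prim" by (auto simp: diff)
qed auto

lemma bij_prim_rot: "bij_betw (\<lambda>p. (snd p, - fst p)) prim prim"
  by (rule bij_betw_byWitness[where f' = "\<lambda>p. (- snd p, fst p)"])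
     (auto simp: coprime_commute)

lemma bij_prim_swap: "bij_betw (\<lambda>p. (snd p, fst p)) prim prim"
  by (rule bij_betw_byWitness[where f' = "\<lambda>p. (snd p, fst p)"])
     (auto simp: coprime_commute)

lemma eisenstein_shift:
  shows "eisenstein k (z + 1) = eisenstein k z"
proof (cases "k = 0")
  case False
  have "(\<Sum>\<^sub>\<infinity>p\<in>prim. 1 / lin (z + 1) p ^ k) = (\<Sum>\<^sub>\<infinity>p\<in>prim. 1 / lin z (fst p, fst p + snd p) ^ k)"
    by (simp add: algebra_simps)
  also have "\<dots> = (\<Sum>\<^sub>\<infinity>p\<in>prim. 1 / lin z p ^ k)"
    by (rule infsum_reindex_bij_betw[OF bij_prim_shift])
  finally show ?thesis using False by (simp add: eisenstein_eq)
qed (simp add: eisenstein_def)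

lemma eisenstein_invert:
  assumes "Im z > 0"
  shows "eisenstein k (- 1 / z) = z ^ k * eisenstein k z"
proof (cases "k = 0")
  case False
  have z: "z \<noteq> 0" using assms by auto
  have "lin (- 1 / z) p = lin z (snd p, - fst p) / z" for p
    using z by (simp add: field_simps)
  then have "(\<Sum>\<^sub>\<infinity>p\<in>prim. 1 / lin (- 1 / z) p ^ k) =
      (\<Sum>\<^sub>\<infinity>p\<in>prim. z ^ k * (1 / lin z (snd p, - fst p) ^ k))"
    by (simp only: power_divide) simp
  also have "\<dots> = z ^ k * (\<Sum>\<^sub>\<infinity>p\<in>prim. 1 / lin z (snd p, - fst p) ^ k)"
    by (rule infsum_cmult_right')
  also have "(\<Sum>\<^sub>\<infinity>p\<in>prim. 1 / lin z (snd p, - fst p) ^ k) = (\<Sum>\<^sub>\<infinity>p\<in>prim. 1 / lin z p ^ k)"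
    by (rule infsum_reindex_bij_betw[OF bij_prim_rot])
  finally show ?thesis using False by (simp add: eisenstein_eq)
qed (simp add: eisenstein_def)

lemma eisenstein_shift_int: "eisenstein k (z + of_int n) = eisenstein k z"
proof (induction n rule: int_induct[where k = 0])
  case (step1 i)
  then show ?case using eisenstein_shift[of k "z + of_int i"] by (simp add: add_ac)
next
  case (step2 i)
  then show ?case using eisenstein_shift[of k "z + of_int (i - 1)"] by simp
qed simp

lemma cmod_lin_squared:
  "(cmod (lin z p))\<^sup>2 = (real_of_int (fst p))\<^sup>2 * (cmod z)\<^sup>2
     + 2 * real_of_int (fst p) * real_of_int (snd p) * Re z + (real_of_int (snd p))\<^sup>2"
  by (simp only: cmod_power2) (simp add: power2_eq_square algebra_simps)

lemma quadratic_form_lower: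
  fixes c d x :: real
  assumes "\<bar>x\<bar> \<le> 1 / 2"
  shows "c\<^sup>2 - \<bar>c * d\<bar> + d\<^sup>2 \<le> c\<^sup>2 + 2 * c * d * x + d\<^sup>2"
    and "3 / 4 * (max \<bar>c\<bar> \<bar>d\<bar>)\<^sup>2 \<le> c\<^sup>2 - \<bar>c * d\<bar> + d\<^sup>2"
proof -
  have "\<bar>2 * (c * d) * x\<bar> \<le> 2 * \<bar>c * d\<bar> * (1 / 2)"
    unfolding abs_mult using assms by (intro mult_mono) auto
  then show "c\<^sup>2 - \<bar>c * d\<bar> + d\<^sup>2 \<le> c\<^sup>2 + 2 * c * d * x + d\<^sup>2" by (simp add: mult.assoc)
  have "0 \<le> (\<bar>c\<bar> - \<bar>d\<bar> / 2)\<^sup>2" "0 \<le> (\<bar>d\<bar> - \<bar>c\<bar> / 2)\<^sup>2" by auto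
  then show "3 / 4 * (max \<bar>c\<bar> \<bar>d\<bar>)\<^sup>2 \<le> c\<^sup>2 - \<bar>c * d\<bar> + d\<^sup>2"
    by (auto simp: max_def power2_eq_square algebra_simps abs_mult)
qed

text \<open>With \<open>p = (c, d)\<close>, the square of the modulus is \<open>c\<^sup>2 * ((cmod z)\<^sup>2 - 1)\<close> plus a quadratic form that
  dominates \<open>c\<^sup>2 - \<bar>c * d\<bar> + d\<^sup>2\<close>, a positive integer unless \<open>c = d = 0\<close>. The second bound singles out
  the pairs \<open>(0, 1)\<close> and \<open>(0, - 1)\<close> when the weight is large.\<close>

lemma lin_lower_fund:
  assumes "\<bar>Re z\<bar> \<le> 1 / 2" "cmod z \<ge> 1"
  shows "3 / 4 * (real (supnorm p))\<^sup>2 \<le> (cmod (lin z p))\<^sup>2"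
    and "fst p \<noteq> 0 \<Longrightarrow> cmod z \<le> cmod (lin z p)"
proof -
  define c d where "c = real_of_int (fst p)" and "d = real_of_int (snd p)"
  have z2: "(cmod z)\<^sup>2 \<ge> 1" using assms(2) by simp
  have eq: "(cmod (lin z p))\<^sup>2 = c\<^sup>2 * ((cmod z)\<^sup>2 - 1) + (c\<^sup>2 + 2 * c * d * Re z + d\<^sup>2)"
    by (simp only: cmod_lin_squared c_def d_def) (simp add: algebra_simps)
  note q = quadratic_form_lower[OF assms(1), of c d] quadratic_form_lower(2)[OF assms(1), of c d]
  have "0 \<le> c\<^sup>2 * ((cmod z)\<^sup>2 - 1)" using z2 by simp
  then show "3 / 4 * (real (supnorm p))\<^sup>2 \<le> (cmod (lin z p))\<^sup>2"
    using q unfolding eq by (simp add: supnorm_alt c_def d_def)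
  assume c0: "fst p \<noteq> 0"
  have "(fst p)\<^sup>2 - \<bar>fst p * snd p\<bar> + (snd p)\<^sup>2 > 0"
  proof -
    have "3 / 4 * (max \<bar>c\<bar> \<bar>d\<bar>)\<^sup>2 > 0" using c0 by (simp add: c_def)
    then have "c\<^sup>2 - \<bar>c * d\<bar> + d\<^sup>2 > 0" using q by linarith
    then have "real_of_int ((fst p)\<^sup>2 - \<bar>fst p * snd p\<bar> + (snd p)\<^sup>2) > 0"
      by (simp add: c_def d_def)
    then show ?thesis by linarith
  qed
  then have "real_of_int ((fst p)\<^sup>2 - \<bar>fst p * snd p\<bar> + (snd p)\<^sup>2) \<ge> 1" by linarith
  then have "c\<^sup>2 - \<bar>c * d\<bar> + d\<^sup>2 \<ge> 1" by (simp add: c_def d_def)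
  moreover have "1 * ((cmod z)\<^sup>2 - 1) \<le> c\<^sup>2 * ((cmod z)\<^sup>2 - 1)"
  proof (rule mult_right_mono)
    have "(1::real) \<le> \<bar>c\<bar>" using c0 unfolding c_def by linarith
    then show "1 \<le> c\<^sup>2" using power_mono[of 1 "\<bar>c\<bar>" 2] by simp
  qed (use z2 in simp)
  ultimately have "1 * ((cmod z)\<^sup>2 - 1) + 1 \<le> (cmod (lin z p))\<^sup>2"
    unfolding eq using q(1) by (intro add_mono) linarith+
  then have "(cmod z)\<^sup>2 \<le> (cmod (lin z p))\<^sup>2" by simp
  then show "cmod z \<le> cmod (lin z p)" by (simp add: power2_le_iff_abs_le)
qed

lemma prim_fst_zero: "prim = {(0, 1), (0, - 1)} \<union> {p \<in> prim. fst p \<noteq> 0}"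
proof -
  have unit: "d = 1 \<or> d = - 1" if "coprime (0 :: int) d" for d
    using that by simp arith
  then show ?thesis by (auto simp del: coprime_0_left_iff dest!: unit)
qed

definition lattice_const :: real where
  "lattice_const = 4 * (\<Sum>\<^sub>\<infinity>p\<in>prim. 1 / real (supnorm p) ^ 3)"

lemma lattice_const_nonneg: "lattice_const \<ge> 0"
  unfolding lattice_const_def by (intro mult_nonneg_nonneg infsum_nonneg) auto

text \<open>The pairs with \<open>c = 0\<close> contribute 1. In all other terms three of the \<open>k\<close> powers secure convergence
  and each remaining factor has modulus at least \<open>cmod z\<close>. The bound is used with \<open>k\<close> fixed and \<open>Im z\<close> large, and
  with \<open>z\<close> fixed and \<open>k\<close> large.\<close>

lemma eisenstein_near_one:
  assumes "\<bar>Re z\<bar> \<le> 1 / 2" "cmod z \<ge> 1" "Im z > 0" "even k" "k \<ge> 4"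
  shows "cmod (eisenstein k z - 1) \<le> lattice_const / cmod z ^ (k - 3)"
proof -
  let ?f = "\<lambda>p. 1 / lin z p ^ k" and ?Q = "{p \<in> prim. fst p \<noteq> 0}"
  have k3: "k \<ge> 3" using assms by simp
  have sub: "?Q \<subseteq> prim" by auto
  have sm: "?f summable_on ?Q"
    by (rule summable_on_subset_banach[OF eisenstein_summable[OF assms(3) k3] sub])
  have asm: "(\<lambda>p. cmod (?f p)) summable_on ?Q"
    by (rule summable_on_subset_banach[OF eisenstein_abs_summable[OF assms(3) k3] sub])
  have "infsum ?f prim = infsum ?f {(0, 1), (0, - 1)} + infsum ?f ?Q"
    by (subst prim_fst_zero, rule infsum_Un_disjoint[OF _ sm]) auto
  also have "infsum ?f {(0, 1), (0, - 1)} = 2" using assms by simp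
  finally have eq: "eisenstein k z - 1 = 1 / 2 * infsum ?f ?Q"
    using assms by (simp add: eisenstein_eq algebra_simps)
  have bound: "cmod (?f p) \<le> 8 / cmod z ^ (k - 3) * (1 / real (supnorm p) ^ 3)" if "p \<in> ?Q" for p
  proof -
    have s: "real (supnorm p) > 0" using supnorm_prim[of p] that by auto
    have z0: "cmod z > 0" using assms(2) by linarith
    have "(real (supnorm p) / 2)\<^sup>2 = (real (supnorm p))\<^sup>2 / 4" by (simp add: power_divide)
    then have "(real (supnorm p) / 2)\<^sup>2 \<le> (cmod (lin z p))\<^sup>2"
      using lin_lower_fund(1)[OF assms(1,2), of p] zero_le_power2[of "real (supnorm p)"] by linarith
    then have a: "real (supnorm p) / 2 \<le> cmod (lin z p)" by (simp add: power2_le_iff_abs_le)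
    have b: "cmod z \<le> cmod (lin z p)" using lin_lower_fund(2)[OF assms(1,2)] that by auto
    have "cmod z ^ (k - 3) * (real (supnorm p) / 2) ^ 3 \<le> cmod (lin z p) ^ (k - 3) * cmod (lin z p) ^ 3"
      by (intro mult_mono power_mono a b) auto
    also have "\<dots> = cmod (lin z p) ^ k" using assms by (simp flip: power_add)
    finally have c: "cmod z ^ (k - 3) * (real (supnorm p) / 2) ^ 3 \<le> cmod (lin z p) ^ k" .
    have "cmod (?f p) = 1 / cmod (lin z p) ^ k" by (simp add: norm_divide norm_power)
    also have "\<dots> \<le> 1 / (cmod z ^ (k - 3) * (real (supnorm p) / 2) ^ 3)"
      using s z0 less_le_trans[OF z0 b] by (intro divide_left_mono[OF c]) auto
    also have "\<dots> = 8 / cmod z ^ (k - 3) * (1 / real (supnorm p) ^ 3)"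
      by (simp add: power_divide)
    finally show ?thesis .
  qed
  have "cmod (infsum ?f ?Q) \<le> (\<Sum>\<^sub>\<infinity>p\<in>?Q. cmod (?f p))" by (rule norm_infsum_bound[OF asm])
  also have "\<dots> \<le> (\<Sum>\<^sub>\<infinity>p\<in>prim. 8 / cmod z ^ (k - 3) * (1 / real (supnorm p) ^ 3))"
    by (rule infsum_mono_neutral[OF asm summable_prim]) (use bound in auto)
  also have "\<dots> = 8 / cmod z ^ (k - 3) * (\<Sum>\<^sub>\<infinity>p\<in>prim. 1 / real (supnorm p) ^ 3)"
    by (rule infsum_cmult_right')
  also have "\<dots> = 2 * (lattice_const / cmod z ^ (k - 3))" by (simp add: lattice_const_def)
  finally have "1 / 2 * cmod (infsum ?f ?Q) \<le> lattice_const / cmod z ^ (k - 3)" by linarith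
  then show ?thesis unfolding eq norm_mult by simp
qed

section \<open>Expansions in the nome\<close>

definition nome :: "complex \<Rightarrow> complex" where
  "nome z = exp (2 * of_real pi * \<i> * z)"

lemma cmod_nome: "cmod (nome z) = exp (- (2 * pi * Im z))"
  by (simp add: nome_def)

lemma nome_nonzero: "nome z \<noteq> 0" by (simp add: nome_def)

lemma nome_in_disc: "Im z > 0 \<Longrightarrow> nome z \<in> ball 0 1"
  by (simp add: cmod_nome)

lemma nome_shift: "nome (z + of_int n) = nome z"
proof -
  have "nome (z + of_int n) = exp (2 * of_real pi * \<i> * z + (of_int (2 * n) * pi) * \<i>)"
    by (simp add: nome_def algebra_simps)
  then show ?thesis unfolding nome_def using exp_eq by metis
qed

lemma nome_eqD:
  assumes "nome z = nome w"
  obtains n :: int where "z = w + of_int n"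
proof -
  obtain n :: int where "2 * of_real pi * \<i> * z = 2 * of_real pi * \<i> * w + (of_int (2 * n) * pi) * \<i>"
    using assms unfolding nome_def exp_eq by blast
  then have "2 * of_real pi * \<i> * z = 2 * of_real pi * \<i> * (w + of_int n)"
    by (simp add: algebra_simps)
  then have "z = w + of_int n" by simp
  then show ?thesis by (rule that)
qed

lemma nome_holomorphic: "nome holomorphic_on S"
  unfolding nome_def[abs_def] by (intro holomorphic_intros)

lemma nome_has_derivative: "(nome has_field_derivative 2 * of_real pi * \<i> * nome z) (at z)"
  unfolding nome_def[abs_def] by (auto intro!: derivative_eq_intros)

lemma nome_Ln:
  assumes "q \<noteq> 0"
  shows "nome (Ln q / (2 * of_real pi * \<i>)) = q"
    and "Im (Ln q / (2 * of_real pi * \<i>)) = - ln (cmod q) / (2 * pi)"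
proof -
  show "nome (Ln q / (2 * of_real pi * \<i>)) = q" using assms by (simp add: nome_def)
  have "Ln q / (2 * of_real pi * \<i>) = - \<i> * Ln q / of_real (2 * pi)" by (simp add: field_simps)
  then show "Im (Ln q / (2 * of_real pi * \<i>)) = - ln (cmod q) / (2 * pi)"
    using assms by (simp only: Im_divide_of_real) simp
qed

lemma Im_nome_inverse_pos:
  assumes "q \<in> ball 0 1" "q \<noteq> 0"
  shows "Im (Ln q / (2 * of_real pi * \<i>)) > 0"
proof -
  have "ln (cmod q) < 0" using assms by simp
  then show ?thesis unfolding nome_Ln(2)[OF assms(2)] by (simp add: divide_neg_pos)
qed

lemma nome_surj:
  assumes "q \<in> ball 0 1" "q \<noteq> 0"
  obtains z where "Im z > 0" "q = nome z"
  using nome_Ln(1)[OF assms(2)] Im_nome_inverse_pos[OF assms] by metis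

text \<open>A logarithm recovers \<open>z\<close> from \<open>q\<close> up to an integer. Two logarithms, cut along the negative and along
  the positive real axis, cover the punctured disc, and \<open>F\<close> does not see the difference. The limit makes
  the singularity at 0 removable.\<close>

lemma q_expansion_exists:
  assumes hol: "F holomorphic_on {z. Im z > 0}"
    and shift: "\<And>z. Im z > 0 \<Longrightarrow> F (z + 1) = F z"
    and lim: "\<And>e. e > 0 \<Longrightarrow> \<exists>Y. \<forall>z. Im z > Y \<longrightarrow> cmod (F z - L) < e"
  obtains g where "g holomorphic_on ball 0 1" "g 0 = L" "\<And>z. Im z > 0 \<Longrightarrow> F z = g (nome z)"
proof -
  define t where "t = (\<lambda>q. Ln q / (2 * of_real pi * \<i>))"
  define g where "g = (\<lambda>q. if q = 0 then L else F (t q))"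
  have Fint: "F (z + of_int n) = F z" if "Im z > 0" for z n
  proof (induction n rule: int_induct[where k = 0])
    case (step1 i)
    then show ?case using shift[of "z + of_int i"] that by (simp add: add_ac)
  next
    case (step2 i)
    then show ?case using shift[of "z + of_int (i - 1)"] that by simp
  qed simp
  have Fqq: "F z = F w" if "Im w > 0" "nome z = nome w" for z w
    using nome_eqD[OF that(2)] Fint[OF that(1)] by metis
  have t_pos: "Im (t q) > 0" if "q \<in> ball 0 1" "q \<noteq> 0" for q
    unfolding t_def by (rule Im_nome_inverse_pos[OF that])
  have qt: "nome (t q) = q" if "q \<noteq> 0" for q unfolding t_def by (rule nome_Ln(1)[OF that])
  have gq: "g q = F z" if "q \<in> ball 0 1" "q \<noteq> 0" "nome z = q" "Im z > 0" for q z
    using Fqq[of z "t q"] Fqq[OF that(4), of "t q"] that qt by (simp add: g_def)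
  have hol1: "g holomorphic_on ball 0 1 - \<real>\<^sub>\<le>\<^sub>0"
  proof (rule holomorphic_transform)
    have "t holomorphic_on ball 0 1 - \<real>\<^sub>\<le>\<^sub>0"
      unfolding t_def by (intro holomorphic_intros) auto
    then have "F \<circ> t holomorphic_on ball 0 1 - \<real>\<^sub>\<le>\<^sub>0"
      by (rule holomorphic_on_compose_gen[OF _ hol]) (use t_pos in force)
    then show "(\<lambda>q. F (t q)) holomorphic_on ball 0 1 - \<real>\<^sub>\<le>\<^sub>0" by (simp add: o_def)
  qed (auto simp: g_def)
  define t2 where "t2 = (\<lambda>q. t (- q) + 1 / 2)"
  have cl: "closed (\<real>\<^sub>\<ge>\<^sub>0 :: complex set)" by (rule closed_nonneg_Reals_complex)
  have hol2: "g holomorphic_on ball 0 1 - \<real>\<^sub>\<ge>\<^sub>0"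
  proof (rule holomorphic_transform)
    have neg: "- q \<notin> \<real>\<^sub>\<le>\<^sub>0" if "q \<notin> \<real>\<^sub>\<ge>\<^sub>0" for q :: complex
      using that by (auto simp: complex_nonpos_Reals_iff complex_nonneg_Reals_iff)
    have "t2 holomorphic_on ball 0 1 - \<real>\<^sub>\<ge>\<^sub>0"
      unfolding t2_def t_def by (intro holomorphic_intros) (auto dest: neg)
    moreover have pos: "Im (t2 q) > 0" if "q \<in> ball 0 1 - \<real>\<^sub>\<ge>\<^sub>0" for q
      using t_pos[of "- q"] that by (cases "q = 0") (auto simp: t2_def)
    ultimately have "F \<circ> t2 holomorphic_on ball 0 1 - \<real>\<^sub>\<ge>\<^sub>0"
      by (intro holomorphic_on_compose_gen[OF _ hol]) auto
    then show "(\<lambda>q. F (t2 q)) holomorphic_on ball 0 1 - \<real>\<^sub>\<ge>\<^sub>0" by (simp add: o_def)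
    fix q :: complex assume q: "q \<in> ball 0 1 - \<real>\<^sub>\<ge>\<^sub>0"
    then have q0: "q \<noteq> 0" by auto
    have "nome (t2 q) = nome (t (- q)) * exp (of_real pi * \<i>)"
      by (simp add: t2_def nome_def ring_distribs exp_add)
    also have "\<dots> = q" using qt[of "- q"] q0 by simp
    finally show "F (t2 q) = g q" using gq[of q "t2 q"] q q0 pos[OF q] by simp
  qed
  have "g holomorphic_on (ball 0 1 - \<real>\<^sub>\<le>\<^sub>0) \<union> (ball 0 1 - \<real>\<^sub>\<ge>\<^sub>0)"
    by (rule holomorphic_on_Un[OF hol1 hol2]) (use cl in \<open>auto intro: open_Diff\<close>)
  moreover have "ball 0 1 - {0} \<subseteq> (ball 0 1 - \<real>\<^sub>\<le>\<^sub>0) \<union> (ball 0 1 - (\<real>\<^sub>\<ge>\<^sub>0 :: complex set))"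
    by (auto simp: complex_nonpos_Reals_iff complex_nonneg_Reals_iff complex_eq_iff)
  ultimately have hol3: "g holomorphic_on ball 0 1 - {0}" by (rule holomorphic_on_subset)
  have "(g \<longlongrightarrow> g 0) (at 0)"
  proof (rule tendstoI)
    fix e :: real assume "e > 0"
    then obtain Y where Y: "\<And>z. Im z > Y \<Longrightarrow> cmod (F z - L) < e" using lim by blast
    have "eventually (\<lambda>q. q \<in> ball 0 (exp (- (2 * pi * Y))) - {0}) (at 0)"
      by (rule eventually_at_in_open) auto
    then show "\<forall>\<^sub>F q in at 0. dist (g q) (g 0) < e"
    proof eventually_elim
      case (elim q)
      then have q: "q \<noteq> 0" "cmod q < exp (- (2 * pi * Y))" by auto
      then have "ln (cmod q) < ln (exp (- (2 * pi * Y)))" by (subst ln_less_cancel_iff) auto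
      then have "ln (cmod q) < - (2 * pi * Y)" by simp
      then have "Im (t q) > Y" using q unfolding t_def nome_Ln(2)[OF q(1)] by (simp add: field_simps)
      then show ?case using Y q by (simp add: g_def dist_norm)
    qed
  qed
  then have lim0: "(g \<longlongrightarrow> g 0) (at 0 within ball 0 1)" by (rule tendsto_within_subset) simp
  have "g holomorphic_on ball 0 1"
  proof (rule no_isolated_singularity'[where K = "{0}"])
    show "(g \<longlongrightarrow> g z) (at z within ball 0 1)" if "z \<in> {0}" for z using lim0 that by simp
  qed (use hol3 in simp_all)
  moreover have "g 0 = L" by (simp add: g_def)
  moreover have "F z = g (nome z)" if "Im z > 0" for z
    using gq[OF nome_in_disc[OF that] nome_nonzero refl that] by simp
  ultimately show ?thesis by (rule that)
qed

text \<open>A modular form is represented by its \<open>q\<close>-expansion \<open>g\<close>. Periodicity and holomorphy at the cusp are then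
  part of the encoding, and the inversion \<open>z \<mapsto> - 1 / z\<close> is the one transformation left to require.\<close>

definition mform :: "nat \<Rightarrow> (complex \<Rightarrow> complex) \<Rightarrow> bool" where
  "mform k g \<longleftrightarrow> g holomorphic_on ball 0 1 \<and>
     (\<forall>z. Im z > 0 \<longrightarrow> g (nome (- 1 / z)) = z ^ k * g (nome z))"

lemma mform_holomorphic: "mform k g \<Longrightarrow> g holomorphic_on ball 0 1"
  by (simp add: mform_def)

lemma mform_invert: "mform k g \<Longrightarrow> Im z > 0 \<Longrightarrow> g (nome (- 1 / z)) = z ^ k * g (nome z)"
  by (simp add: mform_def)

lemma mform_mult: "mform k g \<Longrightarrow> mform l h \<Longrightarrow> mform (k + l) (\<lambda>q. g q * h q)"
  by (auto simp: mform_def power_add intro!: holomorphic_intros)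

lemma mform_power: "mform k g \<Longrightarrow> mform (k * n) (\<lambda>q. g q ^ n)"
  by (auto simp: mform_def power_mult power_mult_distrib intro!: holomorphic_intros)

lemma mform_add: "mform k g \<Longrightarrow> mform k h \<Longrightarrow> mform k (\<lambda>q. g q + h q)"
  by (auto simp: mform_def algebra_simps intro!: holomorphic_intros)

lemma mform_cmult: "mform k g \<Longrightarrow> mform k (\<lambda>q. c * g q)"
  by (auto simp: mform_def algebra_simps intro!: holomorphic_intros)

lemma mform_diff: "mform k g \<Longrightarrow> mform k h \<Longrightarrow> mform k (\<lambda>q. g q - h q)"
  by (auto simp: mform_def algebra_simps intro!: holomorphic_intros)

lemma mform_sum: "(\<And>j. j \<in> J \<Longrightarrow> mform k (g j)) \<Longrightarrow> mform k (\<lambda>q. \<Sum>j\<in>J. g j q)"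
  by (auto simp: mform_def sum_distrib_left intro!: holomorphic_intros)

lemma Im_neg_inverse: "Im (- 1 / z) = Im z / (cmod z)\<^sup>2"
  by (simp add: Im_divide cmod_power2)

definition eis_q :: "nat \<Rightarrow> complex \<Rightarrow> complex" where
  "eis_q k = (SOME g. mform k g \<and> g 0 = 1 \<and> (\<forall>z. Im z > 0 \<longrightarrow> eisenstein k z = g (nome z)))"

lemma eisenstein_tendsto_one:
  assumes "even k" "k \<ge> 4" "e > 0"
  shows "\<exists>Y. \<forall>z. Im z > Y \<longrightarrow> cmod (eisenstein k z - 1) < e"
proof (intro exI allI impI)
  fix z assume z: "Im z > max 1 (lattice_const / e)"
  define w where "w = z + of_int (- round (Re z))"
  have w: "Im w = Im z" "\<bar>Re w\<bar> \<le> 1 / 2" "eisenstein k w = eisenstein k z"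
    using of_int_round_abs_le[of "Re z"] unfolding w_def eisenstein_shift_int by (auto simp: abs_minus_commute)
  have Im_le: "Im w \<le> cmod w" using abs_Im_le_cmod[of w] by linarith
  have "cmod (eisenstein k w - 1) \<le> lattice_const / cmod w ^ (k - 3)"
    by (rule eisenstein_near_one) (use z w Im_le assms in auto)
  also have "\<dots> \<le> lattice_const / Im z"
  proof (rule divide_left_mono)
    have "Im z \<le> cmod w ^ 1" using Im_le w by simp
    also have "\<dots> \<le> cmod w ^ (k - 3)" using Im_le w z assms by (intro power_increasing) auto
    finally show "Im z \<le> cmod w ^ (k - 3)" .
    show "0 < cmod w ^ (k - 3) * Im z" using z Im_le w by (intro mult_pos_pos zero_less_power) auto
  qed (rule lattice_const_nonneg)
  also have "\<dots> < e" using z assms(3) by (simp add: field_simps)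
  finally show "cmod (eisenstein k z - 1) < e" by (simp add: w(3))
qed

lemma eis_q_props:
  assumes "even k" "k \<ge> 4"
  shows "mform k (eis_q k)" "eis_q k 0 = 1" "\<And>z. Im z > 0 \<Longrightarrow> eisenstein k z = eis_q k (nome z)"
proof -
  have "\<exists>g. mform k g \<and> g 0 = 1 \<and> (\<forall>z. Im z > 0 \<longrightarrow> eisenstein k z = g (nome z))"
  proof -
    have k3: "k \<ge> 3" using assms by simp
    obtain g where g: "g holomorphic_on ball 0 1" "g 0 = 1" "\<And>z. Im z > 0 \<Longrightarrow> eisenstein k z = g (nome z)"
      by (rule q_expansion_exists[OF eisenstein_holomorphic[OF k3] eisenstein_shift
            eisenstein_tendsto_one[OF assms]]) auto
    have "g (nome (- 1 / z)) = z ^ k * g (nome z)" if "Im z > 0" for z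
    proof -
      have "Im (- 1 / z) > 0" unfolding Im_neg_inverse using that by (auto intro!: divide_pos_pos)
      then have "g (nome (- 1 / z)) = eisenstein k (- 1 / z)" using g(3) by metis
      also have "\<dots> = z ^ k * eisenstein k z" by (rule eisenstein_invert[OF that])
      finally show ?thesis using g(3)[OF that] by simp
    qed
    then show ?thesis using g by (auto simp: mform_def)
  qed
  from someI_ex[OF this] show "mform k (eis_q k)" "eis_q k 0 = 1"
    "\<And>z. Im z > 0 \<Longrightarrow> eisenstein k z = eis_q k (nome z)"
    unfolding eis_q_def by blast+
qed

section \<open>The maximum principle for cusp forms\<close>

lemma shift_into_strip:
  obtains n :: int where "\<bar>Re (z + of_int n)\<bar> \<le> 1 / 2" "Im (z + of_int n) = Im z"
  using that[of "- round (Re z)"] of_int_round_abs_le[of "Re z"] by (auto simp: abs_minus_commute)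

text \<open>Sets invariant under the modular group, which is given by its two generators.\<close>

locale invariant_set =
  fixes Z :: "complex set"
  assumes upper: "\<And>z. z \<in> Z \<Longrightarrow> Im z > 0"
    and shift: "\<And>z n. z \<in> Z \<Longrightarrow> z + of_int n \<in> Z"
    and invert: "\<And>z. z \<in> Z \<Longrightarrow> - 1 / z \<in> Z"
begin

lemma strip_point:
  assumes "z \<in> Z"
  shows "\<exists>w\<in>Z. \<bar>Re w\<bar> \<le> 1 / 2 \<and> Im w = Im z"
  using shift_into_strip[of z] shift[OF assms] by metis

lemma high_point:
  assumes "Z \<noteq> {}"
  shows "\<exists>w\<in>Z. \<bar>Re w\<bar> \<le> 1 / 2 \<and> 1 / 2 \<le> Im w"
proof -
  obtain z where z: "z \<in> Z" using assms by auto
  \<comment> \<open>Below height 1/2 in the strip one has \<open>(cmod w)\<^sup>2 \<le> 1 / 2\<close>, so inversion doubles the height.\<close>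
  have doubling: "\<exists>w\<in>Z. \<bar>Re w\<bar> \<le> 1 / 2 \<and> (1 / 2 \<le> Im w \<or> 2 ^ n * Im z \<le> Im w)" for n
  proof (induction n)
    case 0
    then show ?case using strip_point[OF z] by auto
  next
    case (Suc n)
    then obtain w where w: "w \<in> Z" "\<bar>Re w\<bar> \<le> 1 / 2" "1 / 2 \<le> Im w \<or> 2 ^ n * Im z \<le> Im w" by auto
    show ?case
    proof (cases "1 / 2 \<le> Im w")
      case False
      have pos: "Im w > 0" using upper w by auto
      have "(Re w)\<^sup>2 \<le> (1 / 2)\<^sup>2" using w(2) by (simp add: abs_le_square_iff[symmetric])
      moreover have "(Im w)\<^sup>2 \<le> (1 / 2)\<^sup>2" using pos False by (intro power_mono) auto
      ultimately have sq: "(cmod w)\<^sup>2 \<le> 1 / 2" unfolding cmod_power2 by (simp add: power_divide)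
      have "w \<noteq> 0" using pos by auto
      then have "2 * Im w \<le> Im w / (cmod w)\<^sup>2" using sq pos by (simp add: field_simps)
      then have "2 ^ Suc n * Im z \<le> Im (- 1 / w)" using w(3) False unfolding Im_neg_inverse by simp
      then show ?thesis using strip_point[OF invert[OF w(1)]] by auto
    qed (use w in auto)
  qed
  obtain n where "1 / 2 / Im z < 2 ^ n" using real_arch_pow[of 2 "1 / 2 / Im z"] by auto
  then have "1 / 2 < 2 ^ n * Im z" using upper[OF z] by (simp add: field_simps)
  then show ?thesis using doubling[of n] by fastforce
qed

lemma fundamental_point:
  assumes "Z \<noteq> {}" and closed: "closed (Z \<inter> {z. 1 / 2 \<le> Im z})" and bounded: "\<And>z. z \<in> Z \<Longrightarrow> Im z \<le> Y"
  shows "\<exists>z\<in>Z. \<bar>Re z\<bar> \<le> 1 / 2 \<and> 1 \<le> cmod z"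
proof -
  define K where "K = (Z \<inter> {z. 1 / 2 \<le> Im z}) \<inter> {z. - (1 / 2) \<le> Re z \<and> Re z \<le> 1 / 2}"
  have KI: "w \<in> K \<longleftrightarrow> w \<in> Z \<and> \<bar>Re w\<bar> \<le> 1 / 2 \<and> 1 / 2 \<le> Im w" for w
    by (auto simp: K_def)
  have "closed {z. - (1 / 2) \<le> Re z \<and> Re z \<le> 1 / 2}"
    by (intro closed_Collect_conj closed_Collect_le continuous_intros)
  then have "closed K" unfolding K_def by (rule closed_Int[OF closed])
  moreover have "bounded K"
  proof (rule boundedI)
    fix w assume w: "w \<in> K"
    have "cmod w \<le> \<bar>Re w\<bar> + \<bar>Im w\<bar>" by (rule cmod_le)
    then show "cmod w \<le> 1 / 2 + Y" using w bounded[of w] by (auto simp: KI)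
  qed
  ultimately have "compact K" by (simp add: compact_eq_bounded_closed)
  moreover have "K \<noteq> {}" using high_point[OF assms(1)] KI by auto
  moreover have "continuous_on K Im" by (intro continuous_intros)
  ultimately obtain z where z: "z \<in> K" and max: "\<And>w. w \<in> K \<Longrightarrow> Im w \<le> Im z"
    using continuous_attains_sup[of K Im] by blast
  have zZ: "z \<in> Z" "Im z > 0" "1 / 2 \<le> Im z" using z by (auto simp: KI)
  \<comment> \<open>At maximal height the point is not inside the unit circle: inversion would raise it.\<close>
  have "1 \<le> cmod z"
  proof (rule ccontr)
    assume "\<not> 1 \<le> cmod z"
    then have "(cmod z)\<^sup>2 < 1" by (simp add: abs_square_less_1)
    moreover have "(cmod z)\<^sup>2 > 0" using zZ(2) by auto
    ultimately have higher: "Im z < Im (- 1 / z)" unfolding Im_neg_inverse using zZ(2) by (simp add: field_simps)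
    obtain w where w: "w \<in> Z" "\<bar>Re w\<bar> \<le> 1 / 2" "Im w = Im (- 1 / z)"
      using strip_point[OF invert[OF zZ(1)]] by auto
    have "1 / 2 \<le> Im w" using higher zZ(3) w(3) by linarith
    then have "w \<in> K" using w KI by blast
    then show False using max[of w] higher w(3) by linarith
  qed
  then show ?thesis using z by (auto simp: KI)
qed

end

lemma Im_fundamental:
  assumes "\<bar>Re z\<bar> \<le> 1 / 2" "1 \<le> cmod z" "Im z > 0"
  shows "sqrt 3 / 2 \<le> Im z"
proof -
  have "(Re z)\<^sup>2 \<le> (1 / 2)\<^sup>2" using assms(1) by (simp add: abs_le_square_iff[symmetric])
  moreover have "1 \<le> (cmod z)\<^sup>2" using assms(2) by simp
  ultimately have "3 / 4 \<le> (Im z)\<^sup>2" unfolding cmod_power2 by (simp add: power_divide)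
  then have "sqrt (3 / 4) \<le> \<bar>Im z\<bar>" using real_sqrt_le_mono[of "3 / 4" "(Im z)\<^sup>2"] by simp
  then show ?thesis using assms(3) by (simp add: real_sqrt_divide)
qed

text \<open>The modulus of a form, normalised so that it is invariant under the modular group.\<close>

definition petersson :: "nat \<Rightarrow> (complex \<Rightarrow> complex) \<Rightarrow> complex \<Rightarrow> real" where
  "petersson k g z = cmod (g (nome z)) * sqrt (Im z) ^ k"

lemma petersson_shift: "petersson k g (z + of_int n) = petersson k g z"
  by (simp add: petersson_def nome_shift)

lemma petersson_invert:
  assumes "mform k g" "Im z > 0"
  shows "petersson k g (- 1 / z) = petersson k g z"
proof -
  have z: "cmod z > 0" using assms(2) by auto
  have "sqrt (Im (- 1 / z)) = sqrt (Im z) / cmod z"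
    unfolding Im_neg_inverse by (simp add: real_sqrt_divide)
  then show ?thesis
    using z unfolding petersson_def mform_invert[OF assms]
    by (simp add: norm_mult norm_power power_divide)
qed

lemma petersson_level_set:
  assumes "mform k g"
  shows "invariant_set {z. Im z > 0 \<and> petersson k g z = M}"
proof
  fix z assume z: "z \<in> {z. Im z > 0 \<and> petersson k g z = M}"
  show "- 1 / z \<in> {z. Im z > 0 \<and> petersson k g z = M}"
    using z petersson_invert[OF assms, of z] by (auto simp: Im_divide intro!: divide_pos_pos sum_power2_gt_zero_iff[THEN iffD2])
qed (auto simp: petersson_shift)

lemma petersson_continuous:
  assumes "mform k g" "S \<subseteq> {z. Im z > 0}"
  shows "continuous_on S (petersson k g)"
proof -
  have "continuous_on S (\<lambda>z. g (nome z))"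
    by (rule continuous_on_compose2[OF holomorphic_on_imp_continuous_on[OF mform_holomorphic[OF assms(1)]]
          holomorphic_on_imp_continuous_on[OF nome_holomorphic]]) (use assms(2) nome_in_disc in auto)
  then show ?thesis unfolding petersson_def[abs_def] by (intro continuous_intros)
qed

lemma divide_out_zero:
  assumes "g holomorphic_on ball 0 1" "a \<in> ball 0 1" "g a = 0"
  obtains h where "h holomorphic_on ball 0 1" "\<And>q. q \<in> ball 0 1 \<Longrightarrow> g q = (q - a) * h q"
    "h a = deriv g a"
proof -
  define h where "h = (\<lambda>z. if z = a then deriv g a else (g z - g a) / (z - a))"
  have "h holomorphic_on ball 0 1"
    unfolding h_def by (rule pole_lemma[OF assms(1)]) (use assms(2) in \<open>simp add: interior_open\<close>)
  moreover have "g q = (q - a) * h q" if "q \<in> ball 0 1" for q using assms(3) by (simp add: h_def)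
  moreover have "h a = deriv g a" by (simp add: h_def)
  ultimately show ?thesis by (rule that)
qed

lemma petersson_decays:
  assumes "mform k g" "g 0 = 0" "e > 0"
  shows "\<exists>Y. \<forall>z. Im z > Y \<longrightarrow> petersson k g z < e"
proof -
  obtain h where h: "h holomorphic_on ball 0 1" "\<And>q. q \<in> ball 0 1 \<Longrightarrow> g q = (q - 0) * h q"
    using divide_out_zero[OF mform_holomorphic[OF assms(1)] _ assms(2)] by auto
  have "compact (h ` cball 0 (1 / 2))"
    by (rule compact_continuous_image[OF holomorphic_on_imp_continuous_on[OF holomorphic_on_subset[OF h(1)]]])
       auto
  then obtain C where C: "\<And>q. q \<in> cball 0 (1 / 2) \<Longrightarrow> cmod (h q) \<le> C" and "C > 0"
    using compact_imp_bounded[THEN bounded_pos[THEN iffD1]] by (metis imageI)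
  have "((\<lambda>y. y ^ k / exp y) \<longlongrightarrow> (0::real)) at_top" by (rule tendsto_power_div_exp_0)
  then have "\<forall>\<^sub>F y in at_top. y ^ k / exp y < e / C"
    by (rule order_tendstoD) (use assms(3) \<open>C > 0\<close> in simp)
  then obtain Y where Y: "\<And>y. y \<ge> Y \<Longrightarrow> y ^ k / exp y < e / C"
    by (auto simp: eventually_at_top_linorder)
  show ?thesis
  proof (intro exI allI impI)
    fix z assume z: "Im z > max 1 Y"
    have "Im z * 1 \<le> Im z * (2 * pi)" using z pi_ge_two by (intro mult_left_mono) auto
    then have small: "cmod (nome z) \<le> exp (- Im z)" by (simp add: cmod_nome mult_ac)
    also have "\<dots> \<le> exp (- 1)" using z by simp
    also have "\<dots> \<le> 1 / 2" using exp_ge_add_one_self[of 1] by (simp add: exp_minus field_simps)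
    finally have disc: "nome z \<in> cball 0 (1 / 2)" by simp
    have "cmod (g (nome z)) = cmod (nome z) * cmod (h (nome z))" using h(2)[of "nome z"] disc by (simp add: norm_mult)
    also have "\<dots> \<le> exp (- Im z) * C" by (intro mult_mono small C disc) auto
    finally have a: "cmod (g (nome z)) \<le> exp (- Im z) * C" .
    have "sqrt (Im z) \<le> Im z" using z by (intro real_le_lsqrt) (auto simp: power2_eq_square)
    then have b: "sqrt (Im z) ^ k \<le> Im z ^ k" using z by (intro power_mono) auto
    have "petersson k g z \<le> (exp (- Im z) * C) * Im z ^ k"
      unfolding petersson_def using z \<open>C > 0\<close> by (intro mult_mono a b) auto
    also have "\<dots> = C * (Im z ^ k / exp (Im z))" by (simp add: exp_minus field_simps)
    also have "\<dots> < e" using Y[of "Im z"] z \<open>C > 0\<close> by (simp add: field_simps)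
    finally show "petersson k g z < e" .
  qed
qed

text \<open>A cusp form decays exponentially at the cusp, so the invariant modulus has a maximum. Among the
  maximisers one of greatest height lies in the closed fundamental domain, hence at height at least \<open>sqrt 3 / 2\<close>.\<close>

lemma petersson_maximum:
  assumes "mform k g" "g 0 = 0" "q \<in> ball 0 1" "g q \<noteq> 0"
  obtains z where "sqrt 3 / 2 \<le> Im z" "petersson k g z > 0"
    "\<And>w. Im w > 0 \<Longrightarrow> petersson k g w \<le> petersson k g z"
proof -
  have "q \<noteq> 0" using assms by auto
  then obtain a where a: "Im a > 0" "q = nome a" using nome_surj assms(3) by blast
  define m where "m = petersson k g a"
  have m: "m > 0" using assms(4) a by (simp add: m_def petersson_def)
  obtain Y where Y: "\<And>z. Im z > Y \<Longrightarrow> petersson k g z < m" using petersson_decays[OF assms(1,2) m] by auto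
  define S where "S = {z. - (1 / 2) \<le> Re z \<and> Re z \<le> 1 / 2 \<and> 1 / 2 \<le> Im z \<and> Im z \<le> Y}"
  have "closed S" unfolding S_def by (intro closed_Collect_conj closed_Collect_le continuous_intros)
  moreover have "bounded S"
  proof (rule boundedI)
    fix w assume "w \<in> S"
    then show "cmod w \<le> 1 / 2 + Y" using cmod_le[of w] by (auto simp: S_def)
  qed
  ultimately have "compact S" by (simp add: compact_eq_bounded_closed)
  have reduce: "\<exists>w. Im w > 0 \<and> petersson k g w = petersson k g z \<and> \<bar>Re w\<bar> \<le> 1 / 2 \<and> 1 / 2 \<le> Im w"
    if "Im z > 0" for z
    using invariant_set.high_point[OF petersson_level_set[OF assms(1)], of "petersson k g z"] that by auto
  have inS: "w \<in> S" if "\<bar>Re w\<bar> \<le> 1 / 2" "1 / 2 \<le> Im w" "m \<le> petersson k g w" for w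
    using that Y[of w] by (fastforce simp: S_def)
  obtain a' where a': "a' \<in> S" "petersson k g a' = m" using reduce[OF a(1)] inS m_def by force
  obtain b where b: "b \<in> S" "\<And>w. w \<in> S \<Longrightarrow> petersson k g w \<le> petersson k g b"
    using continuous_attains_sup[OF \<open>compact S\<close> _ petersson_continuous[OF assms(1)], of] a'(1)
    by (force simp: S_def)
  define M where "M = petersson k g b"
  have mM: "m \<le> M" using b(2)[OF a'(1)] a'(2) by (simp add: M_def)
  have bound: "petersson k g z \<le> M" if "Im z > 0" for z
  proof -
    obtain w where w: "petersson k g w = petersson k g z" "\<bar>Re w\<bar> \<le> 1 / 2" "1 / 2 \<le> Im w"
      using reduce[OF \<open>Im z > 0\<close>] by auto
    show ?thesis
    proof (cases "m \<le> petersson k g w")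
      case True
      then show ?thesis using b(2)[OF inS[OF w(2,3)]] w(1) by (simp add: M_def)
    qed (use w mM in linarith)
  qed
  define Z where "Z = {z. Im z > 0 \<and> petersson k g z = M}"
  interpret invariant_set Z unfolding Z_def by (rule petersson_level_set[OF assms(1)])
  have "\<exists>z\<in>Z. \<bar>Re z\<bar> \<le> 1 / 2 \<and> 1 \<le> cmod z"
  proof (rule fundamental_point)
    show "Z \<noteq> {}" using b(1) by (auto simp: Z_def M_def S_def intro!: exI[of _ b])
    show "Im z \<le> Y" if "z \<in> Z" for z using that Y[of z] mM by (force simp: Z_def)
    have "closed ({z. 1 / 2 \<le> Im z} \<inter> petersson k g -` {M})"
      by (rule continuous_closed_preimage[OF petersson_continuous[OF assms(1)]])
         (auto intro!: closed_Collect_le continuous_intros)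
    moreover have "Z \<inter> {z. 1 / 2 \<le> Im z} = {z. 1 / 2 \<le> Im z} \<inter> petersson k g -` {M}"
      by (auto simp: Z_def)
    ultimately show "closed (Z \<inter> {z. 1 / 2 \<le> Im z})" by simp
  qed
  then obtain z where z: "z \<in> Z" "\<bar>Re z\<bar> \<le> 1 / 2" "1 \<le> cmod z" by auto
  show ?thesis
  proof (rule that)
    show "sqrt 3 / 2 \<le> Im z" using Im_fundamental z by (auto simp: Z_def)
    show "petersson k g z > 0" using z m mM by (simp add: Z_def)
    show "\<And>w. Im w > 0 \<Longrightarrow> petersson k g w \<le> petersson k g z" using bound z by (simp add: Z_def)
  qed
qed

lemma circle_bound:
  assumes max: "\<And>w. Im w > 0 \<Longrightarrow> petersson k g w \<le> M"
    and "Y > 0" "cmod q = exp (- (2 * pi * Y))"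
  shows "cmod (g q) \<le> M / sqrt Y ^ k"
proof -
  have "q \<in> ball 0 1" "q \<noteq> 0" using assms(2,3) by auto
  then obtain w where w: "Im w > 0" "q = nome w" by (rule nome_surj)
  then have "Im w = Y" using assms(3) by (simp add: cmod_nome)
  then show ?thesis using max[OF w(1)] w assms(2) by (simp add: petersson_def field_simps)
qed

lemma max_modulus_disc:
  assumes "h holomorphic_on ball 0 1" "0 < R" "R < 1" "\<And>q. cmod q = R \<Longrightarrow> cmod (h q) \<le> B" "cmod q \<le> R"
  shows "cmod (h q) \<le> B"
proof (rule maximum_modulus_frontier[where S = "cball 0 R" and f = h and \<xi> = q])
  show "h holomorphic_on interior (cball 0 R)"
    by (rule holomorphic_on_subset[OF assms(1)]) (use assms(3) in auto)
  show "continuous_on (closure (cball 0 R)) h"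
    by (rule holomorphic_on_imp_continuous_on[OF holomorphic_on_subset[OF assms(1)]]) (use assms(3) in auto)
qed (use assms in auto)

text \<open>This replaces the valence formula. Let the invariant modulus be maximal at height \<open>y\<close>. Comparing
  \<open>g / q ^ n\<close> there with its values at a smaller height \<open>Y\<close> by the maximum principle gives
  \<open>exp (2 * pi * n * (y - Y)) \<le> (y / Y) powr (k / 2)\<close>, which fails for \<open>Y\<close> close to \<open>sqrt 3 / 2\<close>
  when \<open>n\<close> is large compared with \<open>k\<close>.\<close>

lemma order_at_cusp_bound:
  assumes "mform k g" "h holomorphic_on ball 0 1" "\<And>q. q \<in> ball 0 1 \<Longrightarrow> g q = q ^ n * h q"
    and "n > 0" "real k < 2 * pi * sqrt 3 * real n" "q \<in> ball 0 1"
  shows "g q = 0"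
proof (rule ccontr)
  assume "g q \<noteq> 0"
  have g0: "g 0 = 0" using assms(3)[of 0] assms(4) by simp
  obtain z where z: "sqrt 3 / 2 \<le> Im z" "petersson k g z > 0"
    "\<And>w. Im w > 0 \<Longrightarrow> petersson k g w \<le> petersson k g z"
    using petersson_maximum[OF assms(1) g0 assms(6) \<open>g q \<noteq> 0\<close>] by blast
  define y M where "y = Im z" and "M = petersson k g z"
  \<comment> \<open>Above \<open>k / (4 * pi * n)\<close> the exponential grows faster than the power of the height.\<close>
  have "max 0 (real k / (4 * pi * real n)) < sqrt 3 / 2"
    using assms(4,5) by (simp add: field_simps)
  then obtain Y where Y: "max 0 (real k / (4 * pi * real n)) < Y" "Y < sqrt 3 / 2" using dense by blast
  have Ypos: "Y > 0" using Y(1) by (simp only: max_less_iff_conj)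
  have y: "Y < y" "y > 0" using Y(2) z(1) Ypos unfolding y_def by linarith+
  define R where "R = exp (- (2 * pi * Y))"
  have R: "0 < R" "R < 1" using Ypos by (auto simp: R_def)
  have disc: "nome z \<in> ball 0 1" using nome_in_disc y by (simp add: y_def)
  have "cmod (h (nome z)) \<le> M / sqrt Y ^ k / R ^ n"
  proof (rule max_modulus_disc[OF assms(2) R])
    fix q assume q: "cmod q = R"
    then have "cmod (g q) \<le> M / sqrt Y ^ k"
      unfolding M_def by (intro circle_bound[OF z(3) Ypos]) (auto simp: R_def)
    moreover have "cmod (g q) = R ^ n * cmod (h q)"
      using assms(3)[of q] q R by (simp add: norm_mult norm_power)
    ultimately show "cmod (h q) \<le> M / sqrt Y ^ k / R ^ n"
      using R by (subst pos_le_divide_eq) (simp_all add: mult.commute)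
  next
    show "cmod (nome z) \<le> R" using y by (simp add: R_def cmod_nome y_def)
  qed
  then have "cmod (nome z) ^ n * sqrt y ^ k * cmod (h (nome z)) \<le>
      cmod (nome z) ^ n * sqrt y ^ k * (M / sqrt Y ^ k / R ^ n)"
    using y by (intro mult_left_mono) auto
  moreover have "M = cmod (nome z) ^ n * sqrt y ^ k * cmod (h (nome z))"
    using assms(3)[OF disc] by (simp add: M_def petersson_def norm_mult norm_power y_def mult_ac)
  ultimately have "M \<le> cmod (nome z) ^ n * sqrt y ^ k * (M / sqrt Y ^ k / R ^ n)" by simp
  then have "M * (sqrt Y ^ k * R ^ n) \<le> M * (cmod (nome z) ^ n * sqrt y ^ k)"
    using R Ypos by (simp add: pos_le_divide_eq mult_ac)
  then have "sqrt Y ^ k * R ^ n \<le> cmod (nome z) ^ n * sqrt y ^ k"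
    using z(2) by (simp add: M_def)
  then have "ln (sqrt Y ^ k * R ^ n) \<le> ln (cmod (nome z) ^ n * sqrt y ^ k)"
    using R Ypos y by (subst ln_le_cancel_iff) (auto simp: nome_nonzero)
  then have "real k * (ln Y / 2) - real n * (2 * pi * Y) \<le> real k * (ln y / 2) - real n * (2 * pi * y)"
    using R Ypos y nome_nonzero[of z]
    by (simp add: ln_mult ln_realpow ln_sqrt cmod_nome R_def y_def)
  then have "real n * (2 * pi) * (y - Y) \<le> real k / 2 * (ln y - ln Y)"
    by (simp add: algebra_simps)
  also have "\<dots> \<le> real k / 2 * ((y - Y) / Y)"
    using ln_diff_le[OF y(2) Ypos] by (intro mult_left_mono) auto
  finally have "real n * (2 * pi) * (y - Y) \<le> (real k / (2 * Y)) * (y - Y)" by simp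
  then have "real n * (2 * pi) \<le> real k / (2 * Y)" by (rule mult_right_le_imp_le) (use y in simp)
  then have "Y \<le> real k / (4 * pi * real n)" using Ypos assms(4) by (simp add: field_simps)
  then show False using Y by simp
qed

section \<open>Eisenstein series on the arc\<close>

abbreviation closed_arc :: "real set" where "closed_arc \<equiv> {pi / 2..2 * pi / 3}"
abbreviation open_arc :: "real set" where "open_arc \<equiv> {pi / 2<..<2 * pi / 3}"

text \<open>For weight \<open>2 * l\<close>, the four summands bound what the Eisenstein series on the arc receives from the
  pairs \<open>(1, - 1)\<close>; \<open>(2, 1)\<close> and \<open>(1, 2)\<close>; \<open>(2, - 1)\<close> and \<open>(1, - 2)\<close>; and from all pairs of
  supremum norm at least 3, where each pair is taken together with its negative.\<close>

definition arc_tail :: "nat \<Rightarrow> real" where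
  "arc_tail l = (1 / 2) ^ l + 2 * (1 / 3) ^ l + 2 * (1 / 5) ^ l + 16 / 27 * (4 / 27) ^ (l - 2)"

lemma small_primitive:
  "{p \<in> prim. supnorm p \<le> 2} =
    {(1, 0), (- 1, 0), (0, 1), (0, - 1), (1, 1), (- 1, - 1), (1, - 1), (- 1, 1),
     (2, 1), (- 2, - 1), (1, 2), (- 1, - 2), (2, - 1), (- 2, 1), (1, - 2), (- 1, 2)}" (is "?L = ?R")
proof
  show "?L \<subseteq> ?R"
  proof
    fix p assume p: "p \<in> ?L"
    obtain c d where cd: "p = (c, d)" by (cases p)
    have "\<bar>c\<bar> \<le> 2" "\<bar>d\<bar> \<le> 2" and cop: "coprime c d" using p by (auto simp: supnorm_def cd)
    then have "c = - 2 \<or> c = - 1 \<or> c = 0 \<or> c = 1 \<or> c = 2" "d = - 2 \<or> d = - 1 \<or> d = 0 \<or> d = 1 \<or> d = 2"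
      by auto
    then show "p \<in> ?R" using cop unfolding cd by (elim disjE) (simp_all add: coprime_iff_gcd_eq_1)
  qed
  show "?R \<subseteq> ?L" by (auto simp: supnorm_def)
qed

lemma arc_cos_bounds:
  assumes "\<theta> \<in> closed_arc"
  shows "- 1 / 2 \<le> cos \<theta>" "cos \<theta> \<le> 0"
proof -
  have "cos (2 * pi / 3) \<le> cos \<theta>" using assms by (intro cos_monotone_0_pi_le) auto
  moreover have "cos (2 * pi / 3) = - 1 / 2" using cos_120 by simp
  ultimately show "- 1 / 2 \<le> cos \<theta>" by simp
  have "cos \<theta> \<le> cos (pi / 2)" using assms by (intro cos_monotone_0_pi_le) auto
  then show "cos \<theta> \<le> 0" by simp
qed

lemma arc_sin_pos:
  assumes "\<theta> \<in> closed_arc"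
  shows "sin \<theta> > 0"
proof (rule sin_gt_zero)
  show "0 < \<theta>" "\<theta> < pi" using assms pi_gt_zero unfolding atLeastAtMost_iff by linarith+
qed

text \<open>On the unit circle conjugation is inversion, which exchanges \<open>c\<close> and \<open>d\<close> in \<open>c * z + d\<close>.\<close>

lemma eisenstein_arc_real:
  "cnj (arc_fun (2 * l) (eisenstein (2 * l)) \<theta>) = arc_fun (2 * l) (eisenstein (2 * l)) \<theta>"
proof (cases "l = 0")
  case False
  define z where "z = cis \<theta>"
  have z: "z \<noteq> 0" "cnj z = 1 / z" by (auto simp: z_def cis_cnj cis_inverse[symmetric] inverse_eq_divide)
  have G: "arc_fun (2 * l) (eisenstein (2 * l)) \<theta> = 1 / 2 * (\<Sum>\<^sub>\<infinity>p\<in>prim. z ^ l * (1 / lin z p ^ (2 * l)))"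
  proof -
    have "cis (real (2 * l) * \<theta> / 2) = z ^ l" by (simp add: z_def Complex.DeMoivre)
    moreover have "(\<Sum>\<^sub>\<infinity>p\<in>prim. z ^ l * (1 / lin z p ^ (2 * l))) = z ^ l * (\<Sum>\<^sub>\<infinity>p\<in>prim. 1 / lin z p ^ (2 * l))"
      by (rule infsum_cmult_right')
    ultimately show ?thesis using False by (simp only: arc_fun_def z_def[symmetric]) (simp add: eisenstein_eq)
  qed
  have flip: "cnj (z ^ l * (1 / lin z p ^ (2 * l))) = z ^ l * (1 / lin z (snd p, fst p) ^ (2 * l))" for p
  proof -
    have "cnj (lin z p) = lin z (snd p, fst p) / z" using z by (simp add: field_simps)
    then have "cnj (z ^ l * (1 / lin z p ^ (2 * l))) = (1 / z) ^ l * (1 / (lin z (snd p, fst p) / z) ^ (2 * l))"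
      by (simp only: complex_cnj_mult complex_cnj_power complex_cnj_divide complex_cnj_one z(2))
    also have "\<dots> = z ^ l * (1 / lin z (snd p, fst p) ^ (2 * l))"
      using z(1) by (simp add: power_divide mult_2 power_add)
    finally show ?thesis .
  qed
  have "cnj (\<Sum>\<^sub>\<infinity>p\<in>prim. z ^ l * (1 / lin z p ^ (2 * l))) =
      (\<Sum>\<^sub>\<infinity>p\<in>prim. z ^ l * (1 / lin z (snd p, fst p) ^ (2 * l)))"
    unfolding infsum_cnj[symmetric] flip ..
  also have "\<dots> = (\<Sum>\<^sub>\<infinity>p\<in>prim. z ^ l * (1 / lin z p ^ (2 * l)))"
    by (rule infsum_reindex_bij_betw[OF bij_prim_swap])
  finally show ?thesis unfolding G by simp
qed (simp add: arc_fun_def eisenstein_def)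

lemma power_inverse_bound:
  fixes x a :: real
  assumes "0 < a" "a \<le> x"
  shows "1 / x ^ l \<le> (1 / a) ^ l"
  unfolding power_one_over using assms by (simp add: frac_le power_mono)

lemma arc_term_bound:
  assumes "0 < a" "a \<le> (cmod w)\<^sup>2"
  shows "cmod (1 / w ^ (2 * l)) \<le> (1 / a) ^ l"
  using power_inverse_bound[OF assms, of l] by (simp add: norm_divide norm_power power_mult)

lemma arc_tail_bound:
  assumes "\<theta> \<in> closed_arc" "l \<ge> 2"
  defines "z \<equiv> cis \<theta>"
  shows "cmod (\<Sum>\<^sub>\<infinity>p\<in>{p \<in> prim. 2 < supnorm p}. 1 / lin z p ^ (2 * l)) \<le> 32 / 27 * (4 / 27) ^ (l - 2)"
proof -
  let ?f = "\<lambda>p. 1 / lin z p ^ (2 * l)" and ?Q = "{p \<in> prim. 2 < supnorm p}"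
  have "\<bar>Re z\<bar> \<le> 1 / 2" "Im z > 0" "cmod z \<ge> 1"
    using arc_cos_bounds[OF assms(1)] arc_sin_pos[OF assms(1)] by (auto simp: z_def)
  note z = this
  have sub: "?Q \<subseteq> prim" by auto
  have asm: "(\<lambda>p. cmod (?f p)) summable_on ?Q"
    by (rule summable_on_subset_banach[OF eisenstein_abs_summable[OF z(2)] sub]) (use assms in simp)
  have bound: "cmod (?f p) \<le> 16 / 9 * (4 / 27) ^ (l - 2) * (1 / real (supnorm p) ^ 4)" if p: "p \<in> ?Q" for p
  proof -
    define s x where "s = real (supnorm p)" and "x = (cmod (lin z p))\<^sup>2"
    have s: "s \<ge> 3" using p by (auto simp: s_def)
    have sx: "3 / 4 * s\<^sup>2 \<le> x" unfolding s_def x_def by (rule lin_lower_fund(1)[OF z(1,3)])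
    have "(3::real)\<^sup>2 \<le> s\<^sup>2" using s by (intro power_mono) auto
    then have x: "27 / 4 \<le> x" using sx by simp
    have "(3 / 4 * s\<^sup>2) ^ 2 * (27 / 4) ^ (l - 2) \<le> x ^ 2 * x ^ (l - 2)"
      by (intro mult_mono power_mono sx x) auto
    also have "\<dots> = x ^ (2 + (l - 2))" by (simp only: power_add)
    also have "2 + (l - 2) = l" using assms(2) by simp
    finally have le: "(3 / 4 * s\<^sup>2) ^ 2 * (27 / 4) ^ (l - 2) \<le> x ^ l" .
    have "cmod (?f p) = 1 / x ^ l" by (simp add: norm_divide norm_power x_def power_mult)
    also have "\<dots> \<le> 1 / ((3 / 4 * s\<^sup>2) ^ 2 * (27 / 4) ^ (l - 2))"
      using s by (intro divide_left_mono[OF le] mult_pos_pos zero_less_power) (auto intro: less_le_trans[OF _ x])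
    also have "\<dots> = 16 / 9 * (4 / 27) ^ (l - 2) * (1 / s ^ 4)"
      using s by (simp add: power_divide power_mult_distrib field_simps flip: power_mult)
    finally show ?thesis by (simp add: s_def)
  qed
  have sm4: "(\<lambda>p. 16 / 9 * (4 / 27) ^ (l - 2) * (1 / real (supnorm p) ^ 4)) summable_on {p. 2 < supnorm p}"
    by (intro summable_on_cmult_right lattice_fourth_tail)
  have "cmod (infsum ?f ?Q) \<le> (\<Sum>\<^sub>\<infinity>p\<in>?Q. cmod (?f p))" by (rule norm_infsum_bound[OF asm])
  also have "\<dots> \<le> (\<Sum>\<^sub>\<infinity>p | 2 < supnorm p. 16 / 9 * (4 / 27) ^ (l - 2) * (1 / real (supnorm p) ^ 4))"
    by (rule infsum_mono_neutral[OF asm sm4]) (use bound in auto)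
  also have "\<dots> = 16 / 9 * (4 / 27) ^ (l - 2) * (\<Sum>\<^sub>\<infinity>p | 2 < supnorm p. 1 / real (supnorm p) ^ 4)"
    by (rule infsum_cmult_right')
  also have "\<dots> \<le> 16 / 9 * (4 / 27) ^ (l - 2) * (2 / 3)"
    by (intro mult_left_mono lattice_fourth_tail) auto
  finally show ?thesis by simp
qed

text \<open>The pairs \<open>(1, 0)\<close> and \<open>(0, 1)\<close> produce the cosine. The pair \<open>(1, 1)\<close> produces the power, as
  \<open>(z + 1)\<^sup>2 = z * (2 + 2 * cos \<theta>)\<close> for \<open>z = cis \<theta>\<close>. The power is close to 1 at the endpoint
  \<open>2 * pi / 3\<close>, so it belongs to the main term.\<close>

lemma eisenstein_on_arc:
  assumes "\<theta> \<in> closed_arc" "l \<ge> 2"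
  shows "cmod (arc_fun (2 * l) (eisenstein (2 * l)) \<theta>
           - of_real (2 * cos (real l * \<theta>) + 1 / (2 + 2 * cos \<theta>) ^ l)) \<le> arc_tail l"
proof -
  define z where "z = cis \<theta>"
  let ?f = "\<lambda>p. 1 / lin z p ^ (2 * l)" and ?Q = "{p \<in> prim. 2 < supnorm p}"
  have c: "- 1 / 2 \<le> cos \<theta>" "cos \<theta> \<le> 0" using arc_cos_bounds[OF assms(1)] .
  have z0: "z \<noteq> 0" "cmod z = 1" "Im z > 0" using arc_sin_pos[OF assms(1)] by (auto simp: z_def)
  have sm: "?f summable_on prim" by (rule eisenstein_summable[OF z0(3)]) (use assms in simp)
  have even: "?f (- fst p, - snd p) = ?f p" for p
  proof -
    have "lin z (- fst p, - snd p) = - lin z p" by simp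
    then show ?thesis by (simp only: power_mult power2_minus)
  qed
  have split: "prim = {p \<in> prim. supnorm p \<le> 2} \<union> ?Q" by auto
  have "infsum ?f prim = infsum ?f {p \<in> prim. supnorm p \<le> 2} + infsum ?f ?Q"
    by (subst split, rule infsum_Un_disjoint) (auto intro: summable_on_subset_banach[OF sm])
  also have "infsum ?f {p \<in> prim. supnorm p \<le> 2} =
      2 * (?f (1, 0) + ?f (0, 1) + ?f (1, 1) + ?f (1, - 1) + ?f (2, 1) + ?f (1, 2) + ?f (2, - 1) + ?f (1, - 2))"
    unfolding small_primitive
    using even[of "(1,0)"] even[of "(0,1)"] even[of "(1,1)"] even[of "(1,-1)"] even[of "(2,1)"]
      even[of "(1,2)"] even[of "(2,-1)"] even[of "(1,-2)"]
    by (simp del: of_int_minus of_int_numeral)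
  finally have E: "eisenstein (2 * l) z = ?f (1, 0) + ?f (0, 1) + ?f (1, 1) + (?f (1, - 1) + ?f (2, 1) + ?f (1, 2)
      + ?f (2, - 1) + ?f (1, - 2) + 1 / 2 * infsum ?f ?Q)"
    using assms(2) by (simp add: eisenstein_eq ring_distribs)
  have norm_eq: "(cmod (lin z p))\<^sup>2 = (real_of_int (fst p))\<^sup>2 + 2 * real_of_int (fst p) * real_of_int (snd p) * cos \<theta>
      + (real_of_int (snd p))\<^sup>2" for p
    unfolding cmod_lin_squared by (simp add: z_def)
  have b: "cmod (?f (1, - 1)) \<le> (1 / 2) ^ l" "cmod (?f (2, 1)) \<le> (1 / 3) ^ l" "cmod (?f (1, 2)) \<le> (1 / 3) ^ l"
    "cmod (?f (2, - 1)) \<le> (1 / 5) ^ l" "cmod (?f (1, - 2)) \<le> (1 / 5) ^ l"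
    by (rule arc_term_bound; use c in \<open>simp only: norm_eq\<close>; use c in simp)+
  have t: "cmod (1 / 2 * infsum ?f ?Q) \<le> 16 / 27 * (4 / 27) ^ (l - 2)"
    using arc_tail_bound[OF assms] unfolding norm_mult z_def by simp
  have R: "cmod (?f (1, - 1) + ?f (2, 1) + ?f (1, 2) + ?f (2, - 1) + ?f (1, - 2) + 1 / 2 * infsum ?f ?Q) \<le> arc_tail l"
    unfolding arc_tail_def
    using norm_triangle_mono[OF norm_triangle_mono[OF norm_triangle_mono[OF norm_triangle_mono[OF
      norm_triangle_mono[OF b(1) b(2)] b(3)] b(4)] b(5)] t] by simp
  have zl: "cis (real (2 * l) * \<theta> / 2) = z ^ l" "cis (real l * \<theta>) = z ^ l"
    by (simp_all add: z_def Complex.DeMoivre)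
  have zz: "z * cnj z = 1" using complex_norm_square[of z] z0(2) by simp
  have "(z + 1)\<^sup>2 = z * (2 + (z + cnj z))" using zz by (simp add: power2_eq_square algebra_simps)
  also have "\<dots> = z * of_real (2 + 2 * cos \<theta>)" by (simp add: z_def complex_eq_iff)
  finally have sq: "(z + 1) ^ (2 * l) = z ^ l * of_real ((2 + 2 * cos \<theta>) ^ l)"
    by (simp add: power_mult power_mult_distrib)
  have "z ^ l * (?f (1, 0) + ?f (0, 1)) = z ^ l + 1 / z ^ l"
  proof -
    have "z ^ (2 * l) = z ^ l * z ^ l" by (simp add: mult_2 power_add)
    then show ?thesis using z0 by (simp add: distrib_left)
  qed
  also have "1 / z ^ l = cnj (z ^ l)"
    using zz z0(1) by (metis complex_cnj_power divide_eq_eq mult.commute one_neq_zero power_mult_distrib power_one power_eq_0_iff)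
  also have "z ^ l + cnj (z ^ l) = of_real (2 * cos (real l * \<theta>))"
    unfolding zl(2)[symmetric] by (simp add: complex_eq_iff)
  finally have m1: "z ^ l * (?f (1, 0) + ?f (0, 1)) = of_real (2 * cos (real l * \<theta>))" .
  have m2: "z ^ l * ?f (1, 1) = of_real (1 / (2 + 2 * cos \<theta>) ^ l)"
    using z0(1) sq by simp
  have "arc_fun (2 * l) (eisenstein (2 * l)) \<theta> = z ^ l * (?f (1, 0) + ?f (0, 1)) + z ^ l * ?f (1, 1)
      + z ^ l * (?f (1, - 1) + ?f (2, 1) + ?f (1, 2) + ?f (2, - 1) + ?f (1, - 2) + 1 / 2 * infsum ?f ?Q)"
    unfolding arc_fun_def zl(1) z_def[symmetric] E by (simp only: ring_distribs)
  then have "arc_fun (2 * l) (eisenstein (2 * l)) \<theta> - of_real (2 * cos (real l * \<theta>) + 1 / (2 + 2 * cos \<theta>) ^ l)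
      = z ^ l * (?f (1, - 1) + ?f (2, 1) + ?f (1, 2) + ?f (2, - 1) + ?f (1, - 2) + 1 / 2 * infsum ?f ?Q)"
    unfolding m1 m2 by simp
  then show ?thesis using R z0(2) by (simp only: norm_mult norm_power) simp
qed

lemma arc_tail_le:
  assumes "l \<ge> 6"
  shows "arc_tail l \<le> 2 * (1 / 2) ^ l" "arc_tail l \<le> 22 / 1000"
proof -
  define n where "n = l - 6"
  have l: "l = n + 6" "l - 2 = n + 4" using assms by (auto simp: n_def)
  have "(1 / 3 :: real) ^ n \<le> (1 / 2) ^ n" "(1 / 5 :: real) ^ n \<le> (1 / 2) ^ n" "(4 / 27 :: real) ^ n \<le> (1 / 2) ^ n"
    by (intro power_mono; simp)+
  moreover have "(1 / 2 :: real) ^ n \<ge> 0" "(1 / 2 :: real) ^ n \<le> 1" by (auto intro: power_le_one)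
  moreover have "(1 / 2 :: real) ^ (n + 6) = 1 / 64 * (1 / 2) ^ n" "(1 / 3 :: real) ^ (n + 6) = 1 / 729 * (1 / 3) ^ n"
    "(1 / 5 :: real) ^ (n + 6) = 1 / 15625 * (1 / 5) ^ n" "(4 / 27 :: real) ^ (n + 4) = 256 / 531441 * (4 / 27) ^ n"
    by (simp_all add: power_add power_divide)
  ultimately show "arc_tail l \<le> 2 * (1 / 2) ^ l" "arc_tail l \<le> 22 / 1000"
    unfolding arc_tail_def l(2) unfolding l(1) by linarith+
qed

lemma cmod_arc_fun: "cmod (arc_fun k f \<theta>) = cmod (f (cis \<theta>))"
  by (simp add: arc_fun_def norm_mult)

lemma eisenstein_arc_norm:
  assumes "\<theta> \<in> closed_arc" "l \<ge> 2"
  shows "cmod (eisenstein (2 * l) (cis \<theta>)) \<le> 3 + arc_tail l"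
proof -
  let ?m = "of_real (2 * cos (real l * \<theta>) + 1 / (2 + 2 * cos \<theta>) ^ l) :: complex"
  have "1 / (2 + 2 * cos \<theta>) ^ l \<le> (1 / 1) ^ l"
    by (rule power_inverse_bound) (use arc_cos_bounds[OF assms(1)] in auto)
  then have "1 / (2 + 2 * cos \<theta>) ^ l \<le> 1" by simp
  moreover have "0 \<le> 1 / (2 + 2 * cos \<theta>) ^ l" using arc_cos_bounds[OF assms(1)] by simp
  ultimately have "cmod ?m \<le> 3" 
    unfolding norm_of_real abs_le_iff using cos_le_one[of "real l * \<theta>"] cos_ge_minus_one[of "real l * \<theta>"]
    by linarith
  then have "cmod (arc_fun (2 * l) (eisenstein (2 * l)) \<theta>) \<le> 3 + arc_tail l"
    using eisenstein_on_arc[OF assms] norm_triangle_sub[of "arc_fun (2 * l) (eisenstein (2 * l)) \<theta>" ?m] by linarith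
  then show ?thesis by (simp add: cmod_arc_fun)
qed

section \<open>The discriminant and the structure of modular forms\<close>

abbreviation e4 :: "complex \<Rightarrow> complex" where "e4 \<equiv> eis_q 4"
abbreviation e6 :: "complex \<Rightarrow> complex" where "e6 \<equiv> eis_q 6"

definition delta_q :: "complex \<Rightarrow> complex" where
  "delta_q q = (e4 q ^ 3 - e6 q ^ 2) / 1728"

lemma e4_form: "mform 4 e4" "e4 0 = 1" and e6_form: "mform 6 e6" "e6 0 = 1"
  by (rule eis_q_props; simp)+

lemma delta_form: "mform 12 delta_q" "delta_q 0 = 0"
proof -
  have "mform 12 (\<lambda>q. 1 / 1728 * (e4 q ^ 3 - e6 q ^ 2))"
    by (intro mform_cmult mform_diff)
       (use mform_power[OF e4_form(1), of 3] mform_power[OF e6_form(1), of 2] in simp_all)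
  then show "mform 12 delta_q" by (simp add: delta_q_def[abs_def])
  show "delta_q 0 = 0" by (simp add: delta_q_def e4_form e6_form)
qed

lemma cusp_delta_eq: "Im z > 0 \<Longrightarrow> cusp_delta z = delta_q (nome z)"
  by (simp add: cusp_delta_def delta_q_def eis_q_props(3))

lemma sqrt3_pi: "1.73 \<le> sqrt 3" "3.14 \<le> pi" "pi \<le> 3.15"
proof -
  show "1.73 \<le> sqrt 3" by (rule real_le_rsqrt) (simp add: power2_eq_square)
qed (use pi_approx in simp_all)

text \<open>Even a simple zero at the cusp needs weight at least \<open>2 * pi * sqrt 3\<close>, which is about 10.88.\<close>

lemma small_weight_cusp_form:
  assumes "mform k g" "g 0 = 0" "k \<le> 10" "q \<in> ball 0 1"
  shows "g q = 0"
proof -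
  obtain h where h: "h holomorphic_on ball 0 1" "\<And>q. q \<in> ball 0 1 \<Longrightarrow> g q = (q - 0) * h q"
    using divide_out_zero[OF mform_holomorphic[OF assms(1)] _ assms(2)] by auto
  have "3.14 * 1.73 \<le> pi * sqrt 3" using sqrt3_pi by (intro mult_mono) auto
  then have "real k < 2 * pi * sqrt 3 * real 1" using assms(3) by simp
  then show ?thesis
    using order_at_cusp_bound[OF assms(1) h(1), of 1] h(2) assms(4) by simp
qed

lemma e8_eq: "q \<in> ball 0 1 \<Longrightarrow> eis_q 8 q = e4 q ^ 2"
proof -
  have "mform 8 (\<lambda>q. eis_q 8 q - e4 q ^ 2)"
    using mform_diff[OF eis_q_props(1), of 8 "\<lambda>q. e4 q ^ 2"] mform_power[OF e4_form(1), of 2] by simp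
  then show "q \<in> ball 0 1 \<Longrightarrow> eis_q 8 q = e4 q ^ 2"
    using small_weight_cusp_form[of 8 "\<lambda>q. eis_q 8 q - e4 q ^ 2" q] by (simp add: eis_q_props(2))
qed

lemma form_zero_at_i:
  assumes "mform k g" "k mod 4 = 2"
  shows "g (nome \<i>) = 0"
proof -
  have "k = 4 * (k div 4) + 2" using assms(2) by presburger
  then have "\<i> ^ k = (\<i> ^ 4) ^ (k div 4) * \<i> ^ 2" by (metis power_add power_mult)
  then have "\<i> ^ k = - 1" by simp
  then show ?thesis using mform_invert[OF assms(1), of \<i>] by simp
qed

text \<open>The estimate on the arc shows that \<open>E\<^sub>8 = E\<^sub>4\<^sup>2\<close> does not vanish at \<open>\<i>\<close>, the endpoint \<open>\<theta> = pi / 2\<close>.\<close>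

lemma e4_at_i: "e4 (nome \<i>) \<noteq> 0"
proof -
  have th: "pi / 2 \<in> closed_arc" by simp
  have "arc_tail 4 < 1" by (simp add: arc_tail_def power_divide)
  then have "cmod (arc_fun 8 (eisenstein 8) (pi / 2) - of_real (2 + 1 / 16)) < 1"
    using eisenstein_on_arc[OF th, of 4] by simp
  then have "arc_fun 8 (eisenstein 8) (pi / 2) \<noteq> 0" by (auto simp del: of_real_add)
  then have "eisenstein 8 \<i> \<noteq> 0" by (simp add: arc_fun_def)
  then have "eis_q 8 (nome \<i>) \<noteq> 0" using eis_q_props(3)[of 8 \<i>] by simp
  then show ?thesis using e8_eq[OF nome_in_disc[of \<i>]] by simp
qed

lemma delta_at_i: "delta_q (nome \<i>) \<noteq> 0"
  using e4_at_i form_zero_at_i[OF e6_form(1)] by (simp add: delta_q_def)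

text \<open>A double zero at the cusp is excluded by \<open>12 < 2 * pi * sqrt 3 * 2\<close>.\<close>

lemma delta_simple_zero:
  obtains d where "d holomorphic_on ball 0 1" "\<And>q. q \<in> ball 0 1 \<Longrightarrow> delta_q q = q * d q"
    "d 0 = deriv delta_q 0" "d 0 \<noteq> 0"
proof -
  obtain d where d: "d holomorphic_on ball 0 1" "\<And>q. q \<in> ball 0 1 \<Longrightarrow> delta_q q = (q - 0) * d q"
    "d 0 = deriv delta_q 0"
    using divide_out_zero[OF mform_holomorphic[OF delta_form(1)] _ delta_form(2)] by auto
  have "d 0 \<noteq> 0"
  proof
    assume "d 0 = 0"
    then obtain h where h: "h holomorphic_on ball 0 1" "\<And>q. q \<in> ball 0 1 \<Longrightarrow> d q = (q - 0) * h q"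
      using divide_out_zero[OF d(1) _ \<open>d 0 = 0\<close>] by auto
    have "3.14 * 1.73 \<le> pi * sqrt 3" using sqrt3_pi by (intro mult_mono) auto
    then have "real 12 < 2 * pi * sqrt 3 * real 2" by simp
    then have "delta_q (nome \<i>) = 0"
      using order_at_cusp_bound[OF delta_form(1) h(1), of 2] d(2) h(2) nome_in_disc[of \<i>]
      by (simp add: power2_eq_square)
    then show False using delta_at_i by simp
  qed
  then show ?thesis using that[of d] d by simp
qed

lemma exp_one_bounds: "271 / 100 \<le> exp (1::real)" "exp (1::real) \<le> 272 / 100"
proof -
  have "inverse (2 ^ 32 :: real) \<le> 1 / 1000" by simp
  then have "\<bar>exp 1 - 5837465777 / 2147483648\<bar> \<le> (1 / 1000 :: real)" using e_approx_32 by linarith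
  then show "271 / 100 \<le> exp (1::real)" "exp (1::real) \<le> 272 / 100" by linarith+
qed

text \<open>The maximum is attained at \<open>y = 3 / pi\<close>; the tangent line of the exponential there gives the bound.\<close>

lemma weight_six_decay: "y > 0 \<Longrightarrow> y ^ 6 * exp (- (2 * pi * y)) \<le> 1 / 450" for y :: real
proof -
  assume y: "y > 0"
  have "2.8 * y \<le> 2.71 * (3.14 / 3 * y)" using y by simp
  also have "\<dots> \<le> exp 1 * (pi / 3 * y)"
    using sqrt3_pi exp_one_bounds y by (intro mult_mono) auto
  also have "\<dots> \<le> exp 1 * exp (pi / 3 * y - 1)"
    using exp_ge_add_one_self[of "pi / 3 * y - 1"] by simp
  also have "\<dots> = exp (pi / 3 * y)" by (simp flip: exp_add)
  finally have "(2.8 * y) ^ 6 \<le> exp (pi / 3 * y) ^ 6" using y by (intro power_mono) auto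
  also have "\<dots> = exp (2 * pi * y)" by (simp flip: exp_of_nat_mult)
  finally have "(2.8 * y) ^ 6 \<le> exp (2 * pi * y)" .
  moreover have "(2.8 * y) ^ 6 = 7529536 / 15625 * y ^ 6" by (simp add: power_mult_distrib power_divide)
  moreover have "0 \<le> y ^ 6" using y by simp
  ultimately have "450 * y ^ 6 \<le> exp (2 * pi * y)" by linarith
  then show "y ^ 6 * exp (- (2 * pi * y)) \<le> 1 / 450" by (simp add: exp_minus field_simps)
qed

lemma exp_minus_pi_bounds:
  "exp (- pi) \<ge> 1 / 24" "exp (- (pi * sqrt 3)) \<le> exp (- pi) / 9"
proof -
  have "exp (- 0.15) \<ge> (0.85 :: real)" using exp_ge_add_one_self[of "- 0.15 :: real"] by simp
  moreover have "exp (3 :: real) \<le> 20.13"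
  proof -
    have "exp (3 :: real) = exp 1 ^ 3" by (simp flip: exp_of_nat_mult)
    also have "\<dots> \<le> 2.72 ^ 3" using exp_one_bounds by (intro power_mono) auto
    also have "\<dots> \<le> 20.13" by (simp add: power3_eq_cube)
    finally show ?thesis .
  qed
  then have "exp (- 3 :: real) \<ge> 1 / 20.13" by (simp add: exp_minus field_simps)
  ultimately have "(1 / 20.13) * 0.85 \<le> exp (- 3) * exp (- 0.15 :: real)" by (intro mult_mono) auto
  also have "\<dots> = exp (- 3.15)" by (simp flip: exp_add)
  also have "\<dots> \<le> exp (- pi)" using sqrt3_pi by simp
  finally show "exp (- pi) \<ge> 1 / 24" by simp
  have "9 \<le> exp (2.28 :: real)"
  proof -
    have "9 \<le> (2.71 :: real) ^ 2 * 1.28" by (simp add: power2_eq_square)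
    also have "\<dots> \<le> exp 1 ^ 2 * exp 0.28"
      using exp_one_bounds exp_ge_add_one_self[of "0.28 :: real"] by (intro mult_mono power_mono) auto
    also have "\<dots> = exp (2.28 :: real)" by (simp flip: exp_of_nat_mult exp_add)
    finally show ?thesis .
  qed
  moreover have "2.28 \<le> pi * sqrt 3 - pi"
  proof -
    have "3.14 * 0.73 \<le> pi * (sqrt 3 - 1)" using sqrt3_pi by (intro mult_mono) auto
    then show ?thesis by (simp add: algebra_simps)
  qed
  ultimately have "9 \<le> exp (pi * sqrt 3 - pi)" by (meson exp_le_cancel_iff order_trans)
  also have "\<dots> = exp (- pi) / exp (- (pi * sqrt 3))" by (simp flip: exp_diff)
  finally show "exp (- (pi * sqrt 3)) \<le> exp (- pi) / 9" by (simp add: field_simps)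
qed

text \<open>A zero could be moved to \<open>q0\<close> with \<open>cmod q0 \<le> r = exp (- (pi * sqrt 3))\<close>. The maximum principle on
  the circle of radius \<open>R = exp (- pi)\<close> is applied to the discriminant divided by \<open>q * (q - q0)\<close>. At the
  maximiser of the invariant modulus the factor \<open>q - q0\<close> is at most \<open>2 * r\<close>, on the circle it is at
  least \<open>R - r\<close>, and this gain contradicts the maximality.\<close>

lemma delta_nonzero:
  assumes "q \<in> ball 0 1" "q \<noteq> 0"
  shows "delta_q q \<noteq> 0"
proof
  assume zero: "delta_q q = 0"
  obtain d where d: "d holomorphic_on ball 0 1" "\<And>q. q \<in> ball 0 1 \<Longrightarrow> delta_q q = q * d q" "d 0 \<noteq> 0"
    using delta_simple_zero by metis
  define Z where "Z = {z. Im z > 0 \<and> petersson 12 delta_q z = 0}"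
  interpret invariant_set Z unfolding Z_def by (rule petersson_level_set[OF delta_form(1)])
  have Z: "z \<in> Z \<longleftrightarrow> Im z > 0 \<and> d (nome z) = 0" for z
    using d(2)[OF nome_in_disc[of z]] nome_nonzero[of z] by (auto simp: Z_def petersson_def)
  have "\<exists>z\<in>Z. \<bar>Re z\<bar> \<le> 1 / 2 \<and> 1 \<le> cmod z"
  proof -
    obtain z where "Im z > 0" "q = nome z" using nome_surj[OF assms] by blast
    then have ne: "Z \<noteq> {}" using zero by (auto simp: Z_def petersson_def)
    have "continuous (at 0) d"
      using holomorphic_on_imp_continuous_on[OF d(1)] by (simp add: continuous_on_eq_continuous_at)
    then obtain r where r: "r > 0" "\<And>q. dist 0 q < r \<Longrightarrow> d q \<noteq> 0"
      using continuous_at_avoid[of 0 d 0] d(3) by blast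
    have bounded: "Im z \<le> - ln r / (2 * pi)" if "z \<in> Z" for z
    proof -
      have "r \<le> exp (- (2 * pi * Im z))" using r(2)[of "nome z"] that by (auto simp: Z cmod_nome not_less[symmetric])
      then have "ln r \<le> - (2 * pi * Im z)" using r(1) by (metis exp_gt_zero ln_exp ln_le_cancel_iff)
      then show ?thesis by (simp add: field_simps)
    qed
    have "closed ({z. 1 / 2 \<le> Im z} \<inter> petersson 12 delta_q -` {0})"
      by (rule continuous_closed_preimage[OF petersson_continuous[OF delta_form(1)]])
         (auto intro!: closed_Collect_le continuous_intros)
    moreover have "Z \<inter> {z. 1 / 2 \<le> Im z} = {z. 1 / 2 \<le> Im z} \<inter> petersson 12 delta_q -` {0}"
      by (auto simp: Z_def)
    ultimately show ?thesis using fundamental_point[OF ne _ bounded] by simp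
  qed
  then obtain z0 where z0: "Im z0 > 0" "d (nome z0) = 0" "sqrt 3 / 2 \<le> Im z0"
    using Im_fundamental Z by blast
  define q0 r R where "q0 = nome z0" and "r = exp (- (pi * sqrt 3))" and "R = exp (- pi)"
  have small: "exp (- (2 * pi * y)) \<le> r" if "sqrt 3 / 2 \<le> y" for y
  proof -
    have "pi * sqrt 3 \<le> pi * (2 * y)" using that by (intro mult_left_mono) auto
    then show ?thesis by (simp add: r_def mult_ac)
  qed
  have q0: "q0 \<in> ball 0 1" "cmod q0 \<le> r"
    using nome_in_disc[OF z0(1)] small[OF z0(3)] by (simp_all add: q0_def cmod_nome)
  obtain h where h: "h holomorphic_on ball 0 1" "\<And>q. q \<in> ball 0 1 \<Longrightarrow> d q = (q - q0) * h q"
    using divide_out_zero[OF d(1) q0(1)] z0(2) unfolding q0_def by blast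
  obtain z where z: "sqrt 3 / 2 \<le> Im z" "petersson 12 delta_q z > 0"
    "\<And>w. Im w > 0 \<Longrightarrow> petersson 12 delta_q w \<le> petersson 12 delta_q z"
    using petersson_maximum[OF delta_form nome_in_disc[of \<i>] delta_at_i] by auto
  define y M where "y = Im z" and "M = petersson 12 delta_q z"
  have "0 < sqrt 3 / 2" by simp
  then have y: "y > 0" "sqrt 3 / 2 \<le> y" using z(1) unfolding y_def by linarith+
  have R: "0 < R" "R < 1" "1 / 24 \<le> R" "r \<le> R / 9" "0 < r"
    using exp_minus_pi_bounds pi_gt_zero by (auto simp: R_def r_def)
  have q1: "nome z \<in> ball 0 1" "cmod (nome z) \<le> r"
    using nome_in_disc y small[OF y(2)] by (simp_all add: y_def cmod_nome)
  have hb: "cmod (h (nome z)) \<le> 64 * M / (R * (R - r))"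
  proof (rule max_modulus_disc[OF h(1) R(1,2)])
    fix q assume q: "cmod q = R"
    have "cmod (delta_q q) \<le> M / sqrt (1 / 2) ^ 12"
      unfolding M_def by (rule circle_bound[OF z(3)]) (use q in \<open>auto simp: R_def\<close>)
    also have "sqrt (1 / 2) ^ 12 = (1 / 2) ^ 6" using power_mult[of "sqrt (1 / 2)" 2 6] by simp
    finally have up: "cmod (delta_q q) \<le> 64 * M" by (simp add: power_divide)
    have "R - r \<le> cmod (q - q0)" using norm_triangle_ineq2[of q q0] q q0 by linarith
    then have "R * (R - r) * cmod (h q) \<le> cmod q * cmod (q - q0) * cmod (h q)"
      using q R by (intro mult_right_mono mult_mono) auto
    also have "\<dots> = cmod (delta_q q)" using d(2)[of q] h(2)[of q] q R by (simp add: norm_mult mult.assoc)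
    finally have "R * (R - r) * cmod (h q) \<le> 64 * M" using up by linarith
    then show "cmod (h q) \<le> 64 * M / (R * (R - r))"
      using R by (subst pos_le_divide_eq) (auto simp: mult_ac)
  qed (use q1 R in linarith)
  have "sqrt y ^ 12 = (sqrt y ^ 2) ^ 6" by (simp flip: power_mult)
  also have "sqrt y ^ 2 = y" using y by simp
  finally have "M = cmod (delta_q (nome z)) * y ^ 6" by (simp add: M_def petersson_def y_def)
  also have "\<dots> = cmod (nome z) * y ^ 6 * (cmod (nome z - q0) * cmod (h (nome z)))"
    using d(2)[OF q1(1)] h(2)[OF q1(1)] by (simp add: norm_mult mult_ac)
  also have "\<dots> \<le> (1 / 450) * ((r + r) * (64 * M / (R * (R - r))))"
  proof (intro mult_mono hb)
    show "cmod (nome z) * y ^ 6 \<le> 1 / 450" using weight_six_decay[OF y(1)] by (simp add: cmod_nome y_def mult_ac)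
    show "cmod (nome z - q0) \<le> r + r" using norm_triangle_ineq4[of "nome z" q0] q0 q1 by linarith
  qed (use y R in auto)
  finally have "M * 1 \<le> M * (128 / 450 * r / (R * (R - r)))" by (simp add: mult_ac)
  then have "1 \<le> 128 / 450 * r / (R * (R - r))" using z(2) by (simp only: mult_le_cancel_left_pos M_def)
  then have "R * (R - r) \<le> 128 / 450 * r" using R by (subst (asm) pos_le_divide_eq) auto
  also have "\<dots> \<le> 128 / 450 * (R / 9)" using R by simp
  finally have "R * (R - r) \<le> R * (128 / 4050)" by simp
  then have "R - r \<le> 128 / 4050" using R by (simp only: mult_le_cancel_left_pos)
  then show False using R by simp
qed

lemma divide_by_delta:
  assumes "mform (k + 12) g" "g 0 = 0"
  obtains h where "mform k h" "\<And>q. q \<in> ball 0 1 \<Longrightarrow> g q = delta_q q * h q"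
proof -
  obtain d where d: "d holomorphic_on ball 0 1" "\<And>q. q \<in> ball 0 1 \<Longrightarrow> delta_q q = q * d q" "d 0 \<noteq> 0"
    using delta_simple_zero by metis
  obtain h where h: "h holomorphic_on ball 0 1" "\<And>q. q \<in> ball 0 1 \<Longrightarrow> g q = (q - 0) * h q"
    using divide_out_zero[OF mform_holomorphic[OF assms(1)] _ assms(2)] by auto
  have d0: "d q \<noteq> 0" if "q \<in> ball 0 1" for q
    using delta_nonzero[OF that] d(2)[OF that] d(3) by (cases "q = 0") auto
  have eq: "g q = delta_q q * (h q / d q)" if "q \<in> ball 0 1" for q
    using h(2)[OF that] d(2)[OF that] d0[OF that] by simp
  have "mform k (\<lambda>q. h q / d q)" unfolding mform_def
  proof (intro conjI allI impI)
    show "(\<lambda>q. h q / d q) holomorphic_on ball 0 1" by (intro holomorphic_intros h d d0)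
    fix z :: complex assume z: "Im z > 0"
    have quot: "h (nome w) / d (nome w) = g (nome w) / delta_q (nome w)" if "Im w > 0" for w
      using eq[OF nome_in_disc[OF that]] delta_nonzero[OF nome_in_disc[OF that] nome_nonzero] by simp
    have "Im (- 1 / z) > 0" unfolding Im_neg_inverse using z by (auto intro!: divide_pos_pos)
    moreover have "z \<noteq> 0" using z by auto
    ultimately show "h (nome (- 1 / z)) / d (nome (- 1 / z)) = z ^ k * (h (nome z) / d (nome z))"
      unfolding quot[OF z] using quot[of "- 1 / z"]
      by (simp only: mform_invert[OF assms(1) z] mform_invert[OF delta_form(1) z]) (simp add: power_add)
  qed
  then show ?thesis using that eq by blast
qed

text \<open>The square of such a form is a multiple of \<open>E\<^sub>4\<close>, but weight 2 forces a zero at \<open>\<i>\<close>, where \<open>E\<^sub>4\<close> has none.\<close>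

lemma weight_two_zero:
  assumes "mform 2 h" "q \<in> ball 0 1"
  shows "h q = 0"
proof -
  have "mform 4 (\<lambda>q. h q ^ 2 - h 0 ^ 2 * e4 q)"
    using mform_diff[OF mform_power[OF assms(1), of 2], of "\<lambda>q. h 0 ^ 2 * e4 q"] mform_cmult[OF e4_form(1)]
    by simp
  then have "h (nome \<i>) ^ 2 - h 0 ^ 2 * e4 (nome \<i>) = 0"
    by (rule small_weight_cusp_form) (auto simp: e4_form intro: nome_in_disc[of \<i>, simplified])
  then have "h 0 = 0" using form_zero_at_i[OF assms(1)] e4_at_i by simp
  then show ?thesis using small_weight_cusp_form[OF assms(1)] assms(2) by simp
qed

text \<open>For \<open>s\<close> in \<open>wt_residues\<close> this is the monomial in \<open>E\<^sub>4\<close> and \<open>E\<^sub>6\<close> of weight \<open>s\<close>.\<close>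

definition base_form :: "nat \<Rightarrow> complex \<Rightarrow> complex" where
  "base_form s q = e4 q ^ (if s = 4 \<or> s = 10 then 1 else if s = 8 \<or> s = 14 then 2 else 0) *
     e6 q ^ (if s = 6 \<or> s = 10 \<or> s = 14 then 1 else 0)"

lemma base_form_mform:
  assumes "s \<in> wt_residues"
  shows "mform s (base_form s)" "base_form s 0 = 1"
proof -
  have "mform (4 * a + 6 * b) (\<lambda>q. e4 q ^ a * e6 q ^ b)" for a b
    by (intro mform_mult mform_power e4_form e6_form)
  from this[of "if s = 4 \<or> s = 10 then 1 else if s = 8 \<or> s = 14 then 2 else 0"
      "if s = 6 \<or> s = 10 \<or> s = 14 then 1 else 0"]
  show "mform s (base_form s)" using assms unfolding base_form_def[abs_def] wt_residues_def by auto
  show "base_form s 0 = 1" by (simp add: base_form_def e4_form e6_form)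
qed

text \<open>The \<open>j\<close>-invariant as a function of \<open>q\<close>; the value at its pole 0 is a default.\<close>

definition j_q :: "complex \<Rightarrow> complex" where
  "j_q q = e4 q ^ 3 / delta_q q"

text \<open>Subtracting the multiple of \<open>E\<^sub>4 ^ (3 * m) * E\<close> with the same constant term, \<open>E\<close> the base form,
  leaves a cusp form. It is the discriminant times a form of weight less by 12, and \<open>E\<^sub>4\<^sup>3\<close> is the
  discriminant times \<open>j\<close>. At \<open>m = 0\<close> the cusp form vanishes; for \<open>s = 14\<close> because weight 2 is trivial.\<close>

lemma modular_structure:
  assumes "s \<in> wt_residues" "mform (12 * m + s) g"
  shows "\<exists>P :: complex poly. degree P \<le> m \<and>
    (\<forall>q\<in>ball 0 1 - {0}. g q = base_form s q * delta_q q ^ m * poly P (j_q q))"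
  using assms(2)
proof (induction m arbitrary: g)
  case 0
  let ?f = "\<lambda>q. g q - g 0 * base_form s q"
  have f: "mform s ?f" "?f 0 = 0"
    using mform_diff[OF _ mform_cmult[OF base_form_mform(1)[OF assms(1)]], of g] 0
    by (auto simp: base_form_mform(2)[OF assms(1)])
  have zero: "?f q = 0" if q: "q \<in> ball 0 1" for q
  proof (cases "s \<le> 10")
    case True
    then show ?thesis using small_weight_cusp_form[OF f True q] by simp
  next
    case False
    then have "s = 2 + 12" using assms(1) by (auto simp: wt_residues_def)
    then have f14: "mform (2 + 12) ?f" using f(1) by simp
    obtain h where h: "mform 2 h" "\<And>q. q \<in> ball 0 1 \<Longrightarrow> ?f q = delta_q q * h q"
      using divide_by_delta[OF f14 f(2)] by blast
    show ?thesis unfolding h(2)[OF q] weight_two_zero[OF h(1) q] by simp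
  qed
  show ?case
  proof (intro exI[of _ "[:g 0:]"] conjI ballI)
    fix q :: complex assume "q \<in> ball 0 1 - {0}"
    then have "?f q = 0" using zero by blast
    then show "g q = base_form s q * delta_q q ^ 0 * poly [:g 0:] (j_q q)" by simp
  qed simp
next
  case (Suc m)
  let ?f = "\<lambda>q. g q - g 0 * (e4 q ^ (3 * Suc m) * base_form s q)"
  have "mform (4 * (3 * Suc m) + s) (\<lambda>q. e4 q ^ (3 * Suc m) * base_form s q)"
    by (rule mform_mult[OF mform_power[OF e4_form(1)] base_form_mform(1)[OF assms(1)]])
  then have "mform (12 * Suc m + s) (\<lambda>q. e4 q ^ (3 * Suc m) * base_form s q)" by (simp add: algebra_simps)
  then have "mform (12 * Suc m + s) ?f" by (intro mform_diff mform_cmult Suc.prems)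
  then have f: "mform (12 * m + s + 12) ?f" by (simp add: algebra_simps)
  have f0: "?f 0 = 0" by (simp add: base_form_mform(2)[OF assms(1)] e4_form)
  obtain h where h: "mform (12 * m + s) h" "\<And>q. q \<in> ball 0 1 \<Longrightarrow> ?f q = delta_q q * h q"
    using divide_by_delta[OF f f0] by blast
  obtain P where P: "degree P \<le> m"
    "\<And>q. q \<in> ball 0 1 - {0} \<Longrightarrow> h q = base_form s q * delta_q q ^ m * poly P (j_q q)"
    using Suc.IH[OF h(1)] by blast
  show ?case
  proof (intro exI conjI ballI)
    show "degree (P + monom (g 0) (Suc m)) \<le> Suc m"
      using P(1) by (intro degree_add_le) (auto intro: degree_monom_le)
    fix q :: complex assume q: "q \<in> ball 0 1 - {0}"
    have "e4 q ^ 3 = delta_q q * j_q q" using delta_nonzero q by (simp add: j_q_def)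
    then have "e4 q ^ (3 * Suc m) = (delta_q q * j_q q) ^ Suc m" by (simp only: power_mult)
    moreover have "g q = delta_q q * h q + g 0 * (e4 q ^ (3 * Suc m) * base_form s q)"
      using h(2)[of q] q by (simp add: algebra_simps)
    ultimately show "g q = base_form s q * delta_q q ^ Suc m * poly (P + monom (g 0) (Suc m)) (j_q q)"
      using P(2)[OF q] by (simp add: poly_monom power_mult_distrib algebra_simps)
  qed
qed

section \<open>The derivative of the j-invariant\<close>

lemma Im_neg_inverse_pos: "Im z > 0 \<Longrightarrow> Im (- 1 / z) > 0"
  unfolding Im_neg_inverse by (auto intro!: divide_pos_pos)

lemma mform_has_derivative:
  assumes "mform k g" "Im z > 0"
  shows "((\<lambda>z. g (nome z)) has_field_derivative 2 * of_real pi * \<i> * (nome z * deriv g (nome z))) (at z)"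
proof -
  have "(g has_field_derivative deriv g (nome z)) (at (nome z))"
    by (rule holomorphic_derivI[OF mform_holomorphic[OF assms(1)] open_ball nome_in_disc[OF assms(2)]])
  from DERIV_chain2[OF this nome_has_derivative] show ?thesis by (simp add: mult_ac)
qed

lemma open_upper: "open {z. Im z > 0}"
  by (intro open_Collect_less continuous_intros)

lemma theta_transform:
  assumes "mform k g" "Im z > 0"
  defines "c \<equiv> 2 * of_real pi * \<i>"
  shows "c * (nome (- 1 / z) * deriv g (nome (- 1 / z))) =
    of_nat k * z ^ (k + 1) * g (nome z) + c * z ^ (k + 2) * (nome z * deriv g (nome z))"
proof -
  have z: "z \<noteq> 0" using assms(2) by auto
  let ?D = "\<lambda>z. nome z * deriv g (nome z)"
  have "((\<lambda>z. - 1 / z) has_field_derivative 1 / z ^ 2) (at z)"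
    using z by (auto intro!: derivative_eq_intros simp: power2_eq_square)
  from DERIV_chain2[OF mform_has_derivative[OF assms(1) Im_neg_inverse_pos[OF assms(2)]] this]
  have "((\<lambda>z. g (nome (- 1 / z))) has_field_derivative c * ?D (- 1 / z) * (1 / z ^ 2)) (at z)"
    by (simp only: c_def)
  then have d1: "((\<lambda>z. z ^ k * g (nome z)) has_field_derivative c * ?D (- 1 / z) * (1 / z ^ 2)) (at z)"
    by (rule has_field_derivative_transform_within_open[OF _ open_upper])
       (use assms(2) mform_invert[OF assms(1)] in auto)
  have d2: "((\<lambda>z. z ^ k * g (nome z)) has_field_derivative
      (of_nat k * z ^ (k - 1)) * g (nome z) + (c * ?D z) * z ^ k) (at z)"
  proof -
    have "((\<lambda>z. z ^ k) has_field_derivative of_nat k * z ^ (k - 1)) (at z)"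
      by (auto intro!: derivative_eq_intros)
    from DERIV_mult[OF this mform_has_derivative[OF assms(1,2)]] show ?thesis by (simp only: c_def)
  qed
  have "c * ?D (- 1 / z) * (1 / z ^ 2) = (of_nat k * z ^ (k - 1)) * g (nome z) + (c * ?D z) * z ^ k"
    by (rule DERIV_unique[OF d1 d2])
  then have "c * ?D (- 1 / z) = ((of_nat k * z ^ (k - 1)) * g (nome z) + (c * ?D z) * z ^ k) * z ^ 2"
    using z by (simp add: divide_eq_eq)
  also have "\<dots> = of_nat k * z ^ (k + 1) * g (nome z) + c * z ^ (k + 2) * ?D z"
    by (cases k) (simp_all add: algebra_simps power2_eq_square)
  finally show ?thesis .
qed

text \<open>Differentiation spoils the transformation law by a multiple of the form itself, and these defects
  cancel in the bracket.\<close>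

lemma rankin_cohen_bracket:
  assumes g: "mform k g" and h: "mform l h"
  shows "mform (k + l + 2) (\<lambda>q. of_nat k * g q * (q * deriv h q) - of_nat l * (q * deriv g q) * h q)"
  unfolding mform_def
proof (intro conjI allI impI)
  show "(\<lambda>q. of_nat k * g q * (q * deriv h q) - of_nat l * (q * deriv g q) * h q) holomorphic_on ball 0 1"
    by (intro holomorphic_intros holomorphic_deriv mform_holomorphic[OF g] mform_holomorphic[OF h]) auto
  fix z :: complex assume z: "Im z > 0"
  let ?c = "2 * of_real pi * \<i>" and ?w = "nome (- 1 / z)" and ?q = "nome z"
  have "?c * (of_nat k * g ?w * (?w * deriv h ?w) - of_nat l * (?w * deriv g ?w) * h ?w) =
      of_nat k * g ?w * (?c * (?w * deriv h ?w)) - of_nat l * (?c * (?w * deriv g ?w)) * h ?w"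
    by (simp add: algebra_simps)
  also have "\<dots> = of_nat k * (z ^ k * g ?q) * (of_nat l * z ^ (l + 1) * h ?q + ?c * z ^ (l + 2) * (?q * deriv h ?q))
      - of_nat l * (of_nat k * z ^ (k + 1) * g ?q + ?c * z ^ (k + 2) * (?q * deriv g ?q)) * (z ^ l * h ?q)"
    unfolding theta_transform[OF g z] theta_transform[OF h z] mform_invert[OF g z] mform_invert[OF h z] ..
  also have "\<dots> = ?c * (z ^ (k + l + 2) * (of_nat k * g ?q * (?q * deriv h ?q) - of_nat l * (?q * deriv g ?q) * h ?q))"
    by (simp add: algebra_simps power_add)
  finally have eq: "?c * (of_nat k * g ?w * (?w * deriv h ?w) - of_nat l * (?w * deriv g ?w) * h ?w) =
      ?c * (z ^ (k + l + 2) * (of_nat k * g ?q * (?q * deriv h ?q) - of_nat l * (?q * deriv g ?q) * h ?q))" .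
  have c0: "?c \<noteq> 0" by simp
  show "of_nat k * g ?w * (?w * deriv h ?w) - of_nat l * (?w * deriv g ?w) * h ?w =
      z ^ (k + l + 2) * (of_nat k * g ?q * (?q * deriv h ?q) - of_nat l * (?q * deriv g ?q) * h ?q)"
    by (rule mult_left_cancel[OF c0, THEN iffD1, OF eq])
qed

lemma weight_six_form:
  assumes "mform 6 h" "q \<in> ball 0 1"
  shows "h q = h 0 * e6 q"
  using small_weight_cusp_form[OF mform_diff[OF assms(1) mform_cmult[OF e6_form(1)]], of "h 0" q]
    assms(2) e6_form(2) by simp

text \<open>The bracket vanishes at the cusp, so it is the discriminant times a form of weight 6, a multiple of
  \<open>E\<^sub>6\<close>. The factor 4 is read off from the derivative at \<open>q = 0\<close>.\<close>

lemma e4_delta_bracket: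
  assumes "q \<in> ball 0 1" "q \<noteq> 0"
  shows "4 * e4 q * (q * deriv delta_q q) - 12 * (q * deriv e4 q) * delta_q q = 4 * delta_q q * e6 q"
proof -
  define w where "w = (\<lambda>q. 4 * e4 q * deriv delta_q q - 12 * deriv e4 q * delta_q q)"
  have "mform (6 + 12) (\<lambda>q. 4 * e4 q * (q * deriv delta_q q) - 12 * (q * deriv e4 q) * delta_q q)"
    using rankin_cohen_bracket[OF e4_form(1) delta_form(1)] by simp
  from divide_by_delta[OF this] delta_form(2)
  obtain h where h: "mform 6 h"
    "\<And>q. q \<in> ball 0 1 \<Longrightarrow> 4 * e4 q * (q * deriv delta_q q) - 12 * (q * deriv e4 q) * delta_q q = delta_q q * h q"
    by auto
  obtain d where d: "d holomorphic_on ball 0 1" "\<And>q. q \<in> ball 0 1 \<Longrightarrow> delta_q q = q * d q"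
    "d 0 = deriv delta_q 0" "d 0 \<noteq> 0"
    using delta_simple_zero by metis
  have eq: "w q = d q * h q" if "q \<in> ball 0 1" "q \<noteq> 0" for q
  proof -
    have "q * w q = q * (d q * h q)"
      using h(2)[OF that(1)] unfolding w_def d(2)[OF that(1)] by (simp add: algebra_simps)
    then show ?thesis using that(2) by simp
  qed
  have "w holomorphic_on ball 0 1" unfolding w_def
    by (intro holomorphic_intros holomorphic_deriv mform_holomorphic[OF e4_form(1)] mform_holomorphic[OF delta_form(1)]) auto
  then have w0: "isCont w 0"
    using holomorphic_on_imp_continuous_on continuous_on_eq_continuous_at[OF open_ball, of 0 1 w] by auto
  have "(\<lambda>q. d q * h q) holomorphic_on ball 0 1"
    by (intro holomorphic_intros d mform_holomorphic[OF h(1)])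
  then have dh0: "isCont (\<lambda>q. d q * h q) 0"
    using holomorphic_on_imp_continuous_on continuous_on_eq_continuous_at[OF open_ball, of 0 1 "\<lambda>q. d q * h q"] by auto
  have ev: "\<forall>\<^sub>F q in at 0. w q = d q * h q"
    using eventually_at_in_open[of "ball 0 1" "0 :: complex"] by (rule eventually_mono) (use eq in auto)
  have "w 0 = d 0 * h 0"
    by (rule LIM_unique[OF Lim_transform_eventually[OF w0[unfolded isCont_def] ev] dh0[unfolded isCont_def]])
  moreover have "w 0 = 4 * d 0" by (simp add: w_def e4_form delta_form d(3))
  ultimately have "h 0 = 4" using d(4) by simp
  then show ?thesis using h(2)[OF assms(1)] weight_six_form[OF h(1) assms(1)] by simp
qed

lemma j_has_derivative:
  assumes "Im z > 0"
  shows "((\<lambda>z. j_q (nome z)) has_field_derivative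
    - (2 * of_real pi * \<i>) * e4 (nome z) ^ 2 * e6 (nome z) / delta_q (nome z)) (at z)"
proof -
  let ?q = "nome z" and ?c = "2 * of_real pi * \<i>"
  have D: "delta_q ?q \<noteq> 0" using delta_nonzero nome_in_disc[OF assms] nome_nonzero by blast
  have "((\<lambda>z. e4 (nome z) ^ 3 / delta_q (nome z)) has_field_derivative
     ((3 * e4 ?q ^ 2 * (?c * (?q * deriv e4 ?q))) * delta_q ?q - e4 ?q ^ 3 * (?c * (?q * deriv delta_q ?q)))
       / (delta_q ?q * delta_q ?q)) (at z)"
    by (rule derivative_eq_intros mform_has_derivative[OF e4_form(1) assms]
         mform_has_derivative[OF delta_form(1) assms] D refl)+ (simp add: eval_nat_numeral)
  also have "(3 * e4 ?q ^ 2 * (?c * (?q * deriv e4 ?q))) * delta_q ?q - e4 ?q ^ 3 * (?c * (?q * deriv delta_q ?q)) =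
      - ?c * e4 ?q ^ 2 / 4 * (4 * e4 ?q * (?q * deriv delta_q ?q) - 12 * (?q * deriv e4 ?q) * delta_q ?q)"
    by (simp add: power3_eq_cube power2_eq_square algebra_simps)
  also have "\<dots> = - ?c * e4 ?q ^ 2 * e6 ?q * delta_q ?q"
    unfolding e4_delta_bracket[OF nome_in_disc[OF assms] nome_nonzero] by simp
  also have "\<dots> / (delta_q ?q * delta_q ?q) = - ?c * e4 ?q ^ 2 * e6 ?q / delta_q ?q" using D by simp
  finally show ?thesis by (simp add: j_q_def[abs_def])
qed

section \<open>Large weights separate the arc from the rest of the fundamental domain\<close>

lemma eisenstein_fund_limit:
  assumes "\<bar>Re z\<bar> \<le> 1 / 2" "1 < cmod z" "Im z > 0" "even s"
  shows "(\<lambda>n. eisenstein (12 * n + s) z) \<longlonglongrightarrow> 1"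
proof -
  have "(\<lambda>n. eisenstein (12 * n + s) z - 1) \<longlonglongrightarrow> 0"
  proof (rule Lim_null_comparison)
    have "cmod (eisenstein (12 * n + s) z - 1) \<le> lattice_const * (1 / cmod z) ^ n" if "n \<ge> 1" for n
    proof -
      have "cmod (eisenstein (12 * n + s) z - 1) \<le> lattice_const / cmod z ^ (12 * n + s - 3)"
        by (rule eisenstein_near_one) (use assms that in auto)
      also have "\<dots> \<le> lattice_const / cmod z ^ n"
      proof (rule divide_left_mono)
        show "cmod z ^ n \<le> cmod z ^ (12 * n + s - 3)" using assms(2) that by (intro power_increasing) auto
        have "0 < cmod z" using assms(2) by linarith
        then show "0 < cmod z ^ (12 * n + s - 3) * cmod z ^ n" by simp
      qed (rule lattice_const_nonneg)
      finally show ?thesis by (simp add: power_divide)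
    qed
    then show "\<forall>\<^sub>F n in sequentially. cmod (eisenstein (12 * n + s) z - 1) \<le> lattice_const * (1 / cmod z) ^ n"
      by (auto simp: eventually_sequentially)
    have "(\<lambda>n. (1 / cmod z) ^ n) \<longlonglongrightarrow> 0"
    proof (rule LIMSEQ_power_zero)
      have "0 < cmod z" using assms(2) by linarith
      then show "norm (1 / cmod z) < 1" using assms(2) by (simp add: divide_less_eq)
    qed
    then show "(\<lambda>n. lattice_const * (1 / cmod z) ^ n) \<longlonglongrightarrow> 0" using tendsto_mult_right_zero by blast
  qed
  then show ?thesis by (simp add: LIM_zero_iff)
qed

lemma eisenstein_arc_limit:
  assumes "\<theta> \<in> open_arc"
  shows "(\<lambda>l. arc_fun (2 * l) (eisenstein (2 * l)) \<theta> - of_real (2 * cos (real l * \<theta>))) \<longlonglongrightarrow> 0"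
proof -
  have cl: "\<theta> \<in> closed_arc" using assms by simp
  have "cos (2 * pi / 3) < cos \<theta>" using assms by (intro cos_monotone_0_pi) auto
  then have X: "2 + 2 * cos \<theta> > 1" using cos_120 by simp
  define a where "a = 1 / (2 + 2 * cos \<theta>)"
  have a: "0 \<le> a" "a < 1" using X by (auto simp: a_def)
  show ?thesis
  proof (rule Lim_null_comparison)
    have "cmod (arc_fun (2 * l) (eisenstein (2 * l)) \<theta> - of_real (2 * cos (real l * \<theta>))) \<le> a ^ l + 2 * (1 / 2) ^ l"
      if "l \<ge> 6" for l
    proof -
      let ?G = "arc_fun (2 * l) (eisenstein (2 * l)) \<theta>"
      have "cmod (?G - of_real (2 * cos (real l * \<theta>))) \<le>
          cmod (?G - of_real (2 * cos (real l * \<theta>) + a ^ l)) + cmod (of_real (a ^ l))"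
        using norm_triangle_ineq[of "?G - of_real (2 * cos (real l * \<theta>) + a ^ l)" "of_real (a ^ l)"] by simp
      also have "cmod (of_real (a ^ l)) = a ^ l" using a by (simp add: norm_power)
      also have "cmod (?G - of_real (2 * cos (real l * \<theta>) + a ^ l)) \<le> 2 * (1 / 2) ^ l"
        using eisenstein_on_arc[OF cl, of l] arc_tail_le(1)[OF that] that by (simp add: a_def power_divide)
      finally show ?thesis by simp
    qed
    then show "\<forall>\<^sub>F l in sequentially. cmod (arc_fun (2 * l) (eisenstein (2 * l)) \<theta> - of_real (2 * cos (real l * \<theta>)))
        \<le> a ^ l + 2 * (1 / 2) ^ l"
      by (auto simp: eventually_sequentially)
    show "(\<lambda>l. a ^ l + 2 * (1 / 2) ^ l) \<longlonglongrightarrow> 0"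
      using a by (auto intro!: tendsto_add_zero tendsto_mult_right_zero LIMSEQ_power_zero)
  qed
qed

text \<open>By the addition theorem \<open>sin (a n) * sin b\<close> tends to 0 as well, and \<open>sin\<close> and \<open>cos\<close> of \<open>a n\<close> are not
  both small.\<close>

lemma cos_limits_sin_zero:
  assumes "(\<lambda>n. cos (a n)) \<longlonglongrightarrow> 0" "(\<lambda>n. cos (a n + b)) \<longlonglongrightarrow> (0 :: real)"
  shows "sin b = 0"
proof -
  have "(\<lambda>n. (cos (a n) * cos b - cos (a n + b)) ^ 2 + (cos (a n))\<^sup>2 * (sin b)\<^sup>2) \<longlonglongrightarrow> (0 * cos b - 0) ^ 2 + 0\<^sup>2 * (sin b)\<^sup>2"
    by (intro tendsto_intros assms)
  moreover have "(cos (a n) * cos b - cos (a n + b)) ^ 2 + (cos (a n))\<^sup>2 * (sin b)\<^sup>2 = (sin b)\<^sup>2" for n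
  proof -
    have "(cos (a n) * cos b - cos (a n + b)) ^ 2 + (cos (a n))\<^sup>2 * (sin b)\<^sup>2 =
        (sin (a n) * sin b)\<^sup>2 + (cos (a n))\<^sup>2 * (sin b)\<^sup>2" by (simp add: cos_add)
    also have "\<dots> = ((sin (a n))\<^sup>2 + (cos (a n))\<^sup>2) * (sin b)\<^sup>2"
      by (simp only: power_mult_distrib distrib_right)
    finally show ?thesis by simp
  qed
  ultimately have "(\<lambda>n :: nat. (sin b)\<^sup>2) \<longlonglongrightarrow> 0" by simp
  then show ?thesis by (simp add: LIMSEQ_const_iff)
qed

lemma eisenstein_structure:
  assumes "s \<in> wt_residues" "12 * m + s \<ge> 4"
  obtains P where "\<And>z. Im z > 0 \<Longrightarrow>
    eisenstein (12 * m + s) z = base_form s (nome z) * delta_q (nome z) ^ m * poly P (j_q (nome z))"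
proof -
  have ev: "even (12 * m + s)" using assms(1) by (auto simp: wt_residues_def)
  obtain P where P: "\<And>q. q \<in> ball 0 1 - {0} \<Longrightarrow>
      eis_q (12 * m + s) q = base_form s q * delta_q q ^ m * poly P (j_q q)"
    using modular_structure[OF assms(1) eis_q_props(1)[OF ev assms(2)]] by blast
  show ?thesis
    by (rule that[of P]) (use eis_q_props(3)[OF ev assms(2)] P nome_in_disc nome_nonzero in simp)
qed

lemma eisenstein_zero_of_base:
  assumes "s \<in> wt_residues" "12 * m + s \<ge> 4" "Im z > 0" "base_form s (nome z) = 0"
  shows "eisenstein (12 * m + s) z = 0"
  using eisenstein_structure[OF assms(1,2)] assms(3,4) by (metis mult_zero_left)

text \<open>If the base form of residue \<open>s\<close> vanished at \<open>z\<close>, so would the Eisenstein series of all weights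
  \<open>12 * n + s\<close>, but these tend to 1.\<close>

lemma base_forms_nonzero_fund:
  assumes "\<bar>Re z\<bar> \<le> 1 / 2" "1 < cmod z" "Im z > 0"
  shows "e4 (nome z) \<noteq> 0" "e6 (nome z) \<noteq> 0"
proof -
  have nz: "base_form s (nome z) \<noteq> 0" if s: "s \<in> wt_residues" "s \<ge> 4" for s
  proof
    assume "base_form s (nome z) = 0"
    then have "eisenstein (12 * n + s) z = 0" for n using eisenstein_zero_of_base s assms(3) by simp
    moreover have "even s" using s by (auto simp: wt_residues_def)
    ultimately have "(\<lambda>n :: nat. 0 :: complex) \<longlonglongrightarrow> 1" using eisenstein_fund_limit[OF assms, of s] by simp
    then show False by (simp add: LIMSEQ_const_iff)
  qed
  show "e4 (nome z) \<noteq> 0" using nz[of 4] by (auto simp: base_form_def wt_residues_def)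
  show "e6 (nome z) \<noteq> 0" using nz[of 6] by (auto simp: base_form_def wt_residues_def)
qed

lemma open_arc_facts:
  assumes "\<theta> \<in> open_arc"
  shows "Im (cis \<theta>) > 0" "sin \<theta> \<noteq> 0" "sin (2 * \<theta>) \<noteq> 0" "sin (6 * \<theta>) \<noteq> 0" "cos (12 * \<theta>) \<noteq> 1"
proof -
  have th: "pi / 2 < \<theta>" "\<theta> < 2 * pi / 3" using assms by auto
  have "sin \<theta> > 0" using arc_sin_pos[of \<theta>] th by simp
  then show "Im (cis \<theta>) > 0" "sin \<theta> \<noteq> 0" by auto
  have "sin (2 * \<theta> - pi) > 0" using th by (intro sin_gt_zero) auto
  then show "sin (2 * \<theta>) \<noteq> 0" by (simp add: sin_diff)
  have "sin (6 * \<theta> - 3 * pi) > 0" using th by (intro sin_gt_zero) auto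
  moreover have "cos (3 * pi) = - 1" "sin (3 * pi) = 0" using cos_npi[of 3] sin_npi[of 3] by auto
  ultimately show "sin (6 * \<theta>) \<noteq> 0" by (auto simp: sin_diff)
  show "cos (12 * \<theta>) \<noteq> 1"
  proof
    assume "cos (12 * \<theta>) = 1"
    then obtain n :: int where n: "12 * \<theta> = of_int n * 2 * pi" using cos_one_2pi_int[of "12 * \<theta>"] by auto
    have "3 * (2 * pi) < of_int n * (2 * pi)" "of_int n * (2 * pi) < 4 * (2 * pi)" using n th by linarith+
    then have "3 < real_of_int n" "real_of_int n < 4" using pi_gt_zero by (simp_all only: mult_less_cancel_right_pos)
    then have "3 < n" "n < 4" by simp_all
    then show False by linarith
  qed
qed

lemma arc_limit_along:
  assumes "\<theta> \<in> open_arc" "strict_mono l"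
    and "\<And>n :: nat. eisenstein (2 * l n) (cis \<theta>) = 0"
  shows "(\<lambda>n. cos (real (l n) * \<theta>)) \<longlonglongrightarrow> 0"
proof -
  have "(\<lambda>n. arc_fun (2 * l n) (eisenstein (2 * l n)) \<theta> - of_real (2 * cos (real (l n) * \<theta>))) \<longlonglongrightarrow> 0"
    using LIMSEQ_subseq_LIMSEQ[OF eisenstein_arc_limit[OF assms(1)] assms(2)] by (simp add: o_def)
  then have "(\<lambda>n. complex_of_real (- 2 * cos (real (l n) * \<theta>))) \<longlonglongrightarrow> of_real 0"
    using assms(3) by (simp add: arc_fun_def)
  then have "(\<lambda>n. - 2 * cos (real (l n) * \<theta>)) \<longlonglongrightarrow> 0" by (simp only: tendsto_of_real_iff)
  from tendsto_mult_left[OF this, of "- 1 / 2"] show ?thesis by simp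
qed

text \<open>A zero on the arc would make the Eisenstein series vanish for two residues, 8 and 10 or 6 and 10. Then
  \<open>cos\<close> tends to 0 along two progressions with a fixed shift, \<open>\<theta>\<close> or \<open>2 * \<theta>\<close>.\<close>

lemma base_forms_nonzero_arc:
  assumes "\<theta> \<in> open_arc"
  shows "e4 (nome (cis \<theta>)) \<noteq> 0" "e6 (nome (cis \<theta>)) \<noteq> 0"
proof -
  note facts = open_arc_facts[OF assms]
  have lim: "(\<lambda>n. cos (real (6 * n + s) * \<theta>)) \<longlonglongrightarrow> 0"
    if "2 * s \<in> wt_residues" "s \<ge> 2" "base_form (2 * s) (nome (cis \<theta>)) = 0" for s
  proof (rule arc_limit_along[OF assms])
    show "strict_mono (\<lambda>n. 6 * n + s)" by (simp add: strict_mono_def)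
    show "eisenstein (2 * (6 * n + s)) (cis \<theta>) = 0" for n
      using eisenstein_zero_of_base[OF that(1) _ facts(1) that(3), of n] that(2) by (simp add: algebra_simps)
  qed
  show "e4 (nome (cis \<theta>)) \<noteq> 0"
  proof
    assume "e4 (nome (cis \<theta>)) = 0"
    then have "(\<lambda>n. cos (real (6 * n + 4) * \<theta>)) \<longlonglongrightarrow> 0" "(\<lambda>n. cos (real (6 * n + 5) * \<theta>)) \<longlonglongrightarrow> 0"
      using lim[of 4] lim[of 5] by (simp_all add: base_form_def wt_residues_def)
    then have "sin \<theta> = 0"
      using cos_limits_sin_zero[of "\<lambda>n. real (6 * n + 4) * \<theta>" \<theta>] by (simp add: algebra_simps)
    then show False using facts by simp
  qed
  show "e6 (nome (cis \<theta>)) \<noteq> 0"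
  proof
    assume "e6 (nome (cis \<theta>)) = 0"
    then have "(\<lambda>n. cos (real (6 * n + 3) * \<theta>)) \<longlonglongrightarrow> 0" "(\<lambda>n. cos (real (6 * n + 5) * \<theta>)) \<longlonglongrightarrow> 0"
      using lim[of 3] lim[of 5] by (simp_all add: base_form_def wt_residues_def)
    then have "sin (2 * \<theta>) = 0"
      using cos_limits_sin_zero[of "\<lambda>n. real (6 * n + 3) * \<theta>" "2 * \<theta>"] by (simp add: algebra_simps)
    then show False using facts by simp
  qed
qed

text \<open>Equal \<open>j\<close>-values make the Eisenstein series of weight \<open>12 * n\<close> at the two points proportional with
  factor \<open>\<tau> ^ n\<close>, \<open>\<tau>\<close> the quotient of the discriminants. At \<open>z\<close> they tend to 1, on the arc their
  modulus behaves like \<open>\<bar>2 * cos (6 * n * \<theta>)\<bar>\<close>. For each size of \<open>\<tau>\<close> this is impossible.\<close>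

lemma j_separates:
  assumes "\<bar>Re z\<bar> \<le> 1 / 2" "1 < cmod z" "Im z > 0" "\<theta> \<in> open_arc"
  shows "j_q (nome z) \<noteq> j_q (nome (cis \<theta>))"
proof
  assume j: "j_q (nome z) = j_q (nome (cis \<theta>))"
  note facts = open_arc_facts[OF assms(4)]
  define \<tau> where "\<tau> = cmod (delta_q (nome z) / delta_q (nome (cis \<theta>)))"
  have D: "delta_q (nome w) \<noteq> 0" if "Im w > 0" for w
    using delta_nonzero nome_in_disc[OF that] nome_nonzero by blast
  define A where "A = (\<lambda>n. cmod (arc_fun (12 * n) (eisenstein (12 * n)) \<theta>))"
  define c where "c = (\<lambda>n. \<bar>2 * cos (real (6 * n) * \<theta>)\<bar>)"
  have rel: "cmod (eisenstein (12 * n) z) = \<tau> ^ n * A n" for n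
  proof (cases "n = 0")
    case False
    obtain P where P: "\<And>z. Im z > 0 \<Longrightarrow>
        eisenstein (12 * n + 0) z = base_form 0 (nome z) * delta_q (nome z) ^ n * poly P (j_q (nome z))"
      using eisenstein_structure[of 0 n] False by (auto simp: wt_residues_def)
    have "eisenstein (12 * n) z = (delta_q (nome z) / delta_q (nome (cis \<theta>))) ^ n * eisenstein (12 * n) (cis \<theta>)"
      using P[OF assms(3)] P[OF facts(1)] D[OF facts(1)] j by (simp add: base_form_def power_divide)
    then show ?thesis by (simp add: A_def cmod_arc_fun \<tau>_def norm_mult norm_power)
  qed (simp add: A_def cmod_arc_fun eisenstein_def)
  have lim1: "(\<lambda>n. \<tau> ^ n * A n) \<longlonglongrightarrow> 1"
    using tendsto_norm[OF eisenstein_fund_limit[OF assms(1-3), of 0]] by (simp add: rel)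
  have "(\<lambda>n. arc_fun (2 * (6 * n)) (eisenstein (2 * (6 * n))) \<theta> - of_real (2 * cos (real (6 * n) * \<theta>))) \<longlonglongrightarrow> 0"
    using LIMSEQ_subseq_LIMSEQ[OF eisenstein_arc_limit[OF assms(4)], of "\<lambda>n. 6 * n"]
    by (simp add: o_def strict_mono_def)
  from tendsto_norm_zero[OF this]
  have "(\<lambda>n. A n - c n) \<longlonglongrightarrow> 0"
  proof (rule Lim_null_comparison[rotated])
    have "norm (A n - c n) \<le> cmod (arc_fun (2 * (6 * n)) (eisenstein (2 * (6 * n))) \<theta> - of_real (2 * cos (real (6 * n) * \<theta>)))" for n
      using norm_triangle_ineq3[of "arc_fun (12 * n) (eisenstein (12 * n)) \<theta>" "of_real (2 * cos (real (6 * n) * \<theta>))"]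
      unfolding A_def c_def norm_of_real real_norm_def by simp
    then show "\<forall>\<^sub>F n in sequentially. norm (A n - c n) \<le>
        cmod (arc_fun (2 * (6 * n)) (eisenstein (2 * (6 * n))) \<theta> - of_real (2 * cos (real (6 * n) * \<theta>)))" by simp
  qed
  note Ac = this
  have c_le: "0 \<le> c n" "c n \<le> 2" for n
    using abs_cos_le_one[of "real (6 * n) * \<theta>"] by (simp_all add: c_def abs_mult)
  have \<tau>: "\<tau> > 0" using D[OF assms(3)] D[OF facts(1)] by (simp add: \<tau>_def norm_divide)
  consider "\<tau> < 1" | "\<tau> = 1" | "\<tau> > 1" by linarith
  then show False
  proof cases
    case 1
    have pow: "(\<lambda>n. \<tau> ^ n) \<longlonglongrightarrow> 0" using 1 \<tau> by (intro LIMSEQ_power_zero) simp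
    have "(\<lambda>n. \<tau> ^ n * c n) \<longlonglongrightarrow> 0"
    proof (rule Lim_null_comparison)
      show "\<forall>\<^sub>F n in sequentially. norm (\<tau> ^ n * c n) \<le> \<tau> ^ n * 2"
        using c_le \<tau> by (auto simp: abs_mult)
      show "(\<lambda>n. \<tau> ^ n * 2) \<longlonglongrightarrow> 0" using tendsto_mult_left_zero[OF pow] by blast
    qed
    from tendsto_add[OF tendsto_mult[OF pow Ac] this] have "(\<lambda>n. \<tau> ^ n * A n) \<longlonglongrightarrow> 0"
      by (simp add: algebra_simps)
    from LIMSEQ_unique[OF lim1 this] show False by simp
  next
    case 3
    have "(\<lambda>n. (1 / \<tau>) ^ n) \<longlonglongrightarrow> 0" using 3 by (intro LIMSEQ_power_zero) simp
    from tendsto_mult[OF this lim1] have "A \<longlonglongrightarrow> 0" using \<tau> by (simp add: power_divide)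
    from tendsto_diff[OF this Ac] have "c \<longlonglongrightarrow> 0" by simp
    then have "(\<lambda>n. 2 * cos (real (6 * n) * \<theta>)) \<longlonglongrightarrow> 0" unfolding c_def by (rule tendsto_rabs_zero_cancel)
    from tendsto_mult_left[OF this, of "1 / 2"] have cos0: "(\<lambda>n. cos (real (6 * n) * \<theta>)) \<longlonglongrightarrow> 0" by simp
    have "(\<lambda>n. cos (real (6 * n) * \<theta> + 6 * \<theta>)) \<longlonglongrightarrow> 0"
      using LIMSEQ_Suc[OF cos0] by (simp add: algebra_simps)
    then show False using cos_limits_sin_zero[OF cos0] facts by simp
  next
    case 2
    \<comment> \<open>Now \<open>cos (12 * n * \<theta>)\<close> tends to \<open>- 1 / 2\<close>; its three-term recursion then forces \<open>cos (12 * \<theta>) = 1\<close>.\<close>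
    have "A \<longlonglongrightarrow> 1" using lim1 2 by simp
    from tendsto_diff[OF this Ac] have "c \<longlonglongrightarrow> 1" by simp
    from tendsto_power[OF this, of 2] have "(\<lambda>n. (2 * cos (real (6 * n) * \<theta>))\<^sup>2) \<longlonglongrightarrow> 1"
      by (simp add: c_def)
    from tendsto_diff[OF tendsto_mult_left[OF this, of "1 / 2"] tendsto_const[of 1]]
    have "(\<lambda>n. 2 * (cos (real (6 * n) * \<theta>))\<^sup>2 - 1) \<longlonglongrightarrow> - 1 / 2" by (simp add: power_mult_distrib)
    then have c12: "(\<lambda>n. cos (real n * (12 * \<theta>))) \<longlonglongrightarrow> - 1 / 2"
      using cos_double_cos[of "real (6 * n) * \<theta>" for n] by (simp add: mult_ac)
    have "cos (real (Suc (Suc n)) * (12 * \<theta>)) + cos (real n * (12 * \<theta>)) = 2 * cos (real (Suc n) * (12 * \<theta>)) * cos (12 * \<theta>)" for n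
      using cos_add[of "real (Suc n) * (12 * \<theta>)" "12 * \<theta>"] cos_diff[of "real (Suc n) * (12 * \<theta>)" "12 * \<theta>"]
      by (simp add: algebra_simps)
    moreover have "(\<lambda>n. cos (real (Suc (Suc n)) * (12 * \<theta>)) + cos (real n * (12 * \<theta>))) \<longlonglongrightarrow> - 1 / 2 + - 1 / 2"
      by (rule tendsto_add[OF LIMSEQ_Suc[OF LIMSEQ_Suc[OF c12]] c12])
    moreover have "(\<lambda>n. 2 * cos (real (Suc n) * (12 * \<theta>)) * cos (12 * \<theta>)) \<longlonglongrightarrow> 2 * (- 1 / 2) * cos (12 * \<theta>)"
      by (intro tendsto_intros LIMSEQ_Suc[OF c12])
    ultimately have "- 1 / 2 + - 1 / 2 = 2 * (- 1 / 2) * cos (12 * \<theta>)" using LIMSEQ_unique by fastforce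
    then show False using facts by simp
  qed
qed

section \<open>The sign of one form at the zeros of another\<close>

lemma sin_chord_bound:
  fixes x :: real
  assumes "0 \<le> x" "x \<le> pi / 2"
  shows "2 / pi * x \<le> sin x"
proof -
  have conc: "concave_on {0..pi} (sin :: real \<Rightarrow> real)"
  proof (rule f''_le0_imp_concave)
    fix x :: real assume "x \<in> {0..pi}"
    then show "- sin x \<le> 0" using sin_ge_zero[of x] by simp
  qed (auto intro!: derivative_eq_intros)
  define u where "u = 2 / pi * x"
  have u: "0 \<le> u" "u \<le> 1" using assms pi_gt_zero by (auto simp: u_def field_simps)
  have "(1 - u) * sin 0 + u * sin (pi / 2) \<le> sin ((1 - u) *\<^sub>R 0 + u *\<^sub>R (pi / 2))"
    by (rule concave_onD[OF conc]) (use u pi_gt_zero in auto)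
  also have "(1 - u) *\<^sub>R 0 + u *\<^sub>R (pi / 2) = x" by (simp add: u_def)
  finally show ?thesis by (simp add: u_def)
qed

lemma one_minus_cos_bounds:
  fixes x :: real
  shows "1 - cos x \<le> x\<^sup>2 / 2" and "0 \<le> x \<Longrightarrow> 1 - cos x \<le> x"
proof -
  have eq: "1 - cos x = 2 * (sin (x / 2))\<^sup>2" using cos_double_sin[of "x / 2"] by simp
  have le: "\<bar>sin (x / 2)\<bar> \<le> \<bar>x / 2\<bar>" by (rule abs_sin_x_le_abs_x)
  then have "(sin (x / 2))\<^sup>2 \<le> (x / 2)\<^sup>2" by (simp only: abs_le_square_iff)
  then show "1 - cos x \<le> x\<^sup>2 / 2" unfolding eq by (simp add: power2_eq_square)
  assume x: "0 \<le> x"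
  have "\<bar>sin (x / 2)\<bar> * \<bar>sin (x / 2)\<bar> \<le> 1 * \<bar>x / 2\<bar>" using le by (intro mult_mono) auto
  then have "(sin (x / 2))\<^sup>2 \<le> x / 2" using x by (simp add: power2_eq_square abs_mult_self)
  then show "1 - cos x \<le> x" unfolding eq by simp
qed

text \<open>At the endpoint \<open>2 * pi / 3\<close> the value is 1, and the slope lies between \<open>sqrt 3\<close> and 2 in modulus.\<close>

lemma arc_base_bounds:
  assumes "pi / 2 \<le> t" "t \<le> 2 * pi / 3"
  shows "1 + 173 / 100 * (2 * pi / 3 - t) \<le> 2 + 2 * cos t" "2 + 2 * cos t \<le> 1 + 2 * (2 * pi / 3 - t)"
proof -
  have "1 + 173 / 100 * (2 * pi / 3 - t) \<le> 2 + 2 * cos t \<and> 2 + 2 * cos t \<le> 1 + 2 * (2 * pi / 3 - t)"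
  proof (cases "t = 2 * pi / 3")
    case True
    show ?thesis unfolding True using cos_120 by simp
  next
    case False
    then have lt: "t < 2 * pi / 3" using assms by simp
    have "\<exists>z>t. z < 2 * pi / 3 \<and> cos (2 * pi / 3) - cos t = (2 * pi / 3 - t) * - sin z"
      by (rule MVT2[OF lt]) (auto intro!: derivative_eq_intros)
    then obtain z where z: "t < z" "z < 2 * pi / 3" "cos (2 * pi / 3) - cos t = (2 * pi / 3 - t) * - sin z"
      by auto
    have "sin z = cos (z - pi / 2)" by (simp add: cos_diff)
    moreover have "cos (pi / 6) \<le> cos (z - pi / 2)"
      using z assms by (intro cos_monotone_0_pi_le) auto
    ultimately have s: "173 / 200 \<le> sin z" using sqrt3_pi(1) cos_30 by simp
    have "(2 * pi / 3 - t) * (173 / 200) \<le> (2 * pi / 3 - t) * sin z"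
      "(2 * pi / 3 - t) * sin z \<le> (2 * pi / 3 - t) * 1"
      using mult_left_mono[OF s, of "2 * pi / 3 - t"] mult_left_mono[OF sin_le_one[of z], of "2 * pi / 3 - t"] lt
      by simp_all
    moreover have "cos (2 * pi / 3) = - 1 / 2" using cos_120 by simp
    ultimately show ?thesis using z(3) by (simp add: algebra_simps)
  qed
  then show "1 + 173 / 100 * (2 * pi / 3 - t) \<le> 2 + 2 * cos t" "2 + 2 * cos t \<le> 1 + 2 * (2 * pi / 3 - t)"
    by auto
qed

lemma linear_half_power: "6 \<le> l \<Longrightarrow> real l * (1 / 2) ^ l \<le> 6 / 64"
proof (induction l rule: dec_induct)
  case (step l)
  have "real (Suc l) * (1 / 2) ^ Suc l = (real l + 1) / 2 * (1 / 2) ^ l" by simp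
  also have "\<dots> \<le> real l * (1 / 2) ^ l" using step by (intro mult_right_mono) auto
  also note step.IH
  finally show ?case .
qed (simp add: power_divide)

lemma inverse_sixth_power: "0 \<le> y \<Longrightarrow> y \<le> 1 \<Longrightarrow> 1 - 6 * y \<le> 1 / (1 + y) ^ 6" for y :: real
proof -
  assume y: "0 \<le> y" "y \<le> 1"
  have "1 + real 6 * (- y) \<le> (1 + - y) ^ 6" by (rule Bernoulli_inequality) (use y in simp)
  also have "\<dots> \<le> (1 / (1 + y)) ^ 6"
    using y by (intro power_mono) (auto simp: field_simps)
  finally show ?thesis by (simp add: power_divide)
qed

text \<open>Here \<open>G\<close> stands for the form of weight \<open>2 * (l + 6)\<close> at a zero \<open>t\<close> of the form of weight \<open>2 * l\<close>. Put
  \<open>\<psi> = l * t - n * pi\<close> and \<open>\<alpha> = 6 * t - 3 * pi\<close>, both in \<open>{0<..<pi}\<close>. The vanishing at \<open>t\<close> makes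
  \<open>2 * cos \<psi>\<close> small, namely \<open>\<plusminus> B\<close> up to the error \<open>\<eta>\<close>, and the addition theorem then turns \<open>G\<close>, up to
  its sign, into \<open>2 * sin \<psi> * sin \<alpha> \<plusminus> (B * cos \<alpha> + B')\<close> with an error of order \<open>\<eta>\<close>. The first summand
  wins: it is at least of order \<open>1 / l\<close>, while \<open>\<eta>\<close> decays exponentially. In the half
  where \<open>\<alpha>\<close> is small, \<open>B\<close> is of order \<open>1 / l\<close> too, with a smaller constant. Where \<open>\<beta> = pi - \<alpha>\<close> is small, \<open>cos \<alpha>\<close> is near \<open>- 1\<close> and \<open>B * cos \<alpha> + B'\<close> cancels to a small
  multiple of \<open>\<beta>\<close>.\<close>

lemma interlacing_sign:
  fixes l n :: nat and t G :: real
  assumes l: "6 \<le> l" and t: "real n * pi < real l * t" "real l * t < (real n + 1) * pi"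
    and n: "l \<le> 2 * n" "3 * (n + 1) \<le> 2 * l"
    and zero: "\<bar>2 * cos (real l * t) + 1 / (2 + 2 * cos t) ^ l\<bar> \<le> 22 * (1 / 2) ^ l"
    and G: "\<bar>G - (2 * cos (real (l + 6) * t) + 1 / (2 + 2 * cos t) ^ (l + 6))\<bar> \<le> 22 * (1 / 2) ^ (l + 6)"
  shows "(- 1) ^ n * G > 0"
proof -
  have pb: "314 / 100 \<le> pi" "pi \<le> 315 / 100" using sqrt3_pi(2,3) by simp_all
  have lpos: "real l > 0" using l by simp
  have range: "pi / 2 < t" "t < 2 * pi / 3"
  proof -
    have "real l * (pi / 2) \<le> real n * pi"
      using n(1) mult_right_mono[of "real l" "2 * real n" "pi / 2"] pi_gt_zero by simp
    then have "real l * (pi / 2) < real l * t" using t by linarith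
    then show "pi / 2 < t" using lpos by (simp only: mult_less_cancel_left_pos)
    have "real (3 * (n + 1)) \<le> real (2 * l)" using n(2) by (simp only: of_nat_le_iff)
    then have "(real n + 1) * pi \<le> real l * (2 * pi / 3)"
      using mult_right_mono[of "real (3 * (n + 1))" "real (2 * l)" "pi / 3"] pi_gt_zero by simp
    then have "real l * t < real l * (2 * pi / 3)" using t by linarith
    then show "t < 2 * pi / 3" using lpos by (simp only: mult_less_cancel_left_pos)
  qed
  define X \<phi> x B B' \<eta> \<psi> \<alpha> s where "X = 2 + 2 * cos t" and "\<phi> = 2 * pi / 3 - t" and "x = real l * \<phi>"
    and "B = 1 / X ^ l" and "B' = 1 / X ^ (l + 6)" and "\<eta> = 22 * (1 / 2 :: real) ^ l"
    and "\<psi> = real l * t - real n * pi" and "\<alpha> = 6 * t - 3 * pi" and "s = (- 1 :: real) ^ n"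
  have \<phi>: "0 < \<phi>" "\<phi> < pi / 6" using range by (auto simp: \<phi>_def)
  have X: "1 + 173 / 100 * \<phi> \<le> X" "X \<le> 1 + 2 * \<phi>" "X \<le> 2" "1 \<le> X"
    using arc_base_bounds[of t] range arc_cos_bounds(2)[of t] \<phi> by (auto simp: X_def \<phi>_def)
  have B0: "0 \<le> B" using X by (simp add: B_def)
  have B'_eq: "B' = B * (1 / X ^ 6)" by (simp add: B_def B'_def power_add)
  have \<eta>': "22 * (1 / 2 :: real) ^ (l + 6) = \<eta> / 64" by (simp add: \<eta>_def power_add power_divide)
  have \<eta>0: "0 \<le> \<eta>" by (simp add: \<eta>_def)
  have \<eta>l: "real l * \<eta> \<le> 132 / 64" using linear_half_power[OF l] by (simp add: \<eta>_def)
  have \<eta>1: "\<eta> \<le> 22 / 64"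
  proof -
    have "(1 / 2 :: real) ^ l \<le> (1 / 2) ^ 6" using l by (intro power_decreasing) auto
    moreover have "(1 / 2 :: real) ^ 6 = 1 / 64" by (simp add: power_divide)
    ultimately show ?thesis unfolding \<eta>_def by linarith
  qed
  have x0: "x > 0" using \<phi> lpos by (simp add: x_def)
  have Bx: "B * (1 + 173 / 100 * x) \<le> 1"
  proof -
    have "1 + real l * (173 / 100 * \<phi>) \<le> (1 + 173 / 100 * \<phi>) ^ l"
      by (rule Bernoulli_inequality) (use \<phi> in simp)
    also have "\<dots> \<le> X ^ l" using X \<phi> by (intro power_mono) auto
    finally have "1 + 173 / 100 * x \<le> X ^ l" by (simp add: x_def mult_ac)
    moreover have "0 < X ^ l" using X by (intro zero_less_power) simp
    ultimately show ?thesis by (simp add: B_def)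
  qed
  \<comment> \<open>Zeros keep away from \<open>2 * pi / 3\<close>. For \<open>l\<close> not divisible by 3 the interval of \<open>t\<close> already does; otherwise
    closer to the endpoint \<open>2 * cos (l * t)\<close> exceeds 1, and the form of weight \<open>2 * l\<close> is positive.\<close>
  have x_lower: "pi / 3 \<le> x"
  proof (rule ccontr)
    assume x: "\<not> pi / 3 \<le> x"
    have lt: "real l * t = real l * (2 * pi / 3) - x" by (simp add: x_def \<phi>_def algebra_simps)
    have "3 * (n + 1) = 2 * l"
    proof (rule ccontr)
      assume "3 * (n + 1) \<noteq> 2 * l"
      then have "3 * (n + 1) + 1 \<le> 2 * l" using n(2) by linarith
      then have "real (3 * (n + 1) + 1) \<le> real (2 * l)" by (simp only: of_nat_le_iff)
      from mult_right_mono[OF this, of "pi / 3"]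
      have "(real n + 1) * pi + pi / 3 \<le> real l * (2 * pi / 3)" by (simp add: algebra_simps)
      then show False using t(2) x lt by linarith
    qed
    then have even: "even (n + 1)" and eq: "real (3 * (n + 1)) = real (2 * l)" by (presburger, simp)
    have "real l * (2 * pi / 3) = real (2 * l) * (pi / 3)" by simp
    also have "\<dots> = real (n + 1) * pi" unfolding eq[symmetric] by simp
    finally have "real l * (2 * pi / 3) = real (n + 1) * pi" .
    then have "cos (real l * t) = cos (real (n + 1) * pi) * cos x + sin (real (n + 1) * pi) * sin x"
      unfolding lt by (simp only: cos_diff)
    also have "\<dots> = cos x" using even by (simp only: cos_npi sin_npi) simp
    finally have "cos (real l * t) = cos x" .
    moreover have "cos (pi / 3) < cos x" using x x0 by (intro cos_monotone_0_pi) auto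
    ultimately have "1 < 2 * cos (real l * t)" using cos_60 by simp
    then show False using zero \<eta>1 B0 unfolding \<eta>_def[symmetric] X_def[symmetric] B_def[symmetric] by linarith
  qed
  have B_small: "B \<le> 356 / 1000"
  proof -
    have "B * (1 + 173 / 100 * (314 / 300)) \<le> B * (1 + 173 / 100 * x)"
      using x_lower pb B0 by (intro mult_left_mono) auto
    then show ?thesis using Bx by simp
  qed
  have \<psi>: "0 < \<psi>" "\<psi> < pi" using t by (auto simp: \<psi>_def algebra_simps)
  have \<alpha>: "0 < \<alpha>" "\<alpha> < pi" using range by (auto simp: \<alpha>_def)
  have s: "s * s = 1" "\<bar>s\<bar> = 1" by (auto simp: s_def simp flip: power_mult_distrib)
  define C E where "C = 2 * cos (real l * t) + B" and "E = G - (2 * cos (real (l + 6) * t) + B')"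
  have C: "\<bar>C\<bar> \<le> \<eta>" and E: "\<bar>E\<bar> \<le> \<eta> / 64"
    using zero G unfolding C_def E_def \<eta>_def[symmetric] \<eta>' X_def[symmetric] B_def[symmetric] B'_def[symmetric] .
  have lt: "real l * t = real n * pi + \<psi>" by (simp add: \<psi>_def)
  have cs: "cos (real l * t) = s * cos \<psi>" "sin (real l * t) = s * sin \<psi>"
    unfolding lt cos_add sin_add cos_npi sin_npi s_def by simp_all
  have six: "cos (6 * t) = - cos \<alpha>" "sin (6 * t) = - sin \<alpha>"
  proof -
    have "6 * t = \<alpha> + 2 * pi + pi" by (simp add: \<alpha>_def)
    then show "cos (6 * t) = - cos \<alpha>" "sin (6 * t) = - sin \<alpha>" by (simp_all only: cos_periodic_pi sin_periodic_pi cos_periodic sin_periodic)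
  qed
  have cos_l6: "cos (real (l + 6) * t) = s * (sin \<psi> * sin \<alpha> - cos \<psi> * cos \<alpha>)"
  proof -
    have "real (l + 6) * t = real l * t + 6 * t" by (simp add: algebra_simps)
    then show ?thesis by (simp only: cos_add cs six) (simp add: algebra_simps)
  qed
  have cos\<psi>: "2 * cos \<psi> = s * (C - B)"
    using s(1) by (simp add: C_def cs mult.assoc[symmetric])
  have "s * G = s * E + (s * s) * (2 * (sin \<psi> * sin \<alpha>)) - (s * s) * (2 * cos \<psi>) * cos \<alpha> + s * B'"
  proof -
    have G_eq: "G = E + 2 * (s * (sin \<psi> * sin \<alpha> - cos \<psi> * cos \<alpha>)) + B'"
      using cos_l6 by (simp add: E_def)
    show ?thesis by (subst G_eq) (simp add: algebra_simps)
  qed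
  also have "\<dots> = s * E + 2 * (sin \<psi> * sin \<alpha>) - s * C * cos \<alpha> + s * (B * cos \<alpha> + B')"
    unfolding s(1) cos\<psi> by (simp add: algebra_simps)
  finally have sG: "s * G = s * E + 2 * (sin \<psi> * sin \<alpha>) - s * C * cos \<alpha> + s * (B * cos \<alpha> + B')" .
  have "\<bar>s * E\<bar> \<le> \<eta> / 64" "\<bar>s * (B * cos \<alpha> + B')\<bar> = \<bar>B * cos \<alpha> + B'\<bar>"
    using E s(2) by (simp_all only: abs_mult) simp_all
  moreover have "\<bar>s * C * cos \<alpha>\<bar> \<le> \<eta>"
    using mult_mono[OF C abs_cos_le_one[of \<alpha>]] \<eta>0 s(2) by (simp add: abs_mult)
  ultimately have main: "2 * (sin \<psi> * sin \<alpha>) - \<bar>B * cos \<alpha> + B'\<bar> - 65 / 64 * \<eta> \<le> s * G"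
    unfolding sG by linarith
  have cos_small: "\<bar>cos \<psi>\<bar> \<le> 35 / 100"
  proof -
    have "\<bar>2 * cos \<psi>\<bar> = \<bar>C - B\<bar>" unfolding cos\<psi> abs_mult s(2) by simp
    then show ?thesis using C B0 B_small \<eta>1 by linarith
  qed
  have sin\<psi>: "93 / 100 \<le> sin \<psi>"
  proof (rule power2_le_imp_le)
    have "(cos \<psi>)\<^sup>2 \<le> (35 / 100)\<^sup>2" using cos_small by (simp add: abs_le_square_iff[symmetric])
    then show "(93 / 100)\<^sup>2 \<le> (sin \<psi>)\<^sup>2" using sin_cos_squared_add[of \<psi>] by (simp add: power2_eq_square)
    show "0 \<le> sin \<psi>" using \<psi> by (intro sin_ge_zero) auto
  qed
  have "0 < 2 * (sin \<psi> * sin \<alpha>) - \<bar>B * cos \<alpha> + B'\<bar> - 65 / 64 * \<eta>"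
  proof (cases "\<alpha> \<le> pi / 2")
    case True
    have "pi / 12 \<le> \<phi>" using True by (simp add: \<alpha>_def \<phi>_def)
    then have "real l * (314 / 1200) \<le> x" unfolding x_def using pb by (intro mult_left_mono) auto
    then have "B * (173 / 100 * (real l * (314 / 1200))) \<le> B * (1 + 173 / 100 * x)"
      using B0 by (intro mult_left_mono) auto
    also note Bx
    finally have "173 / 100 * (314 / 1200) * (real l * B) \<le> 1" by (simp only: mult_ac)
    then have Bl: "real l * B \<le> 222 / 100" by linarith
    have "B' \<le> B * 1" unfolding B'_eq using B0 X by (intro mult_left_mono) (auto simp: divide_le_eq)
    moreover have "0 \<le> B'" using X by (simp add: B'_def)
    moreover have "\<bar>B * cos \<alpha>\<bar> \<le> B" using B0 mult_left_mono[OF abs_cos_le_one[of \<alpha>] B0] by (simp add: abs_mult)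
    ultimately have "\<bar>B * cos \<alpha> + B'\<bar> \<le> 2 * B" by linarith
    then have "real l * \<bar>B * cos \<alpha> + B'\<bar> \<le> real l * (2 * B)" using lpos by (intro mult_left_mono) auto
    then have R: "real l * \<bar>B * cos \<alpha> + B'\<bar> \<le> 444 / 100" using Bl by linarith
    have \<psi>1: "114 / 100 \<le> \<psi>"
    proof (rule power2_le_imp_le)
      show "(114 / 100)\<^sup>2 \<le> \<psi>\<^sup>2" using one_minus_cos_bounds(1)[of \<psi>] cos_small by (simp add: power2_eq_square)
    qed (use \<psi> in simp)
    have "real l * (pi / 2) \<le> real n * pi"
      using n(1) mult_right_mono[of "real l" "2 * real n" "pi / 2"] pi_gt_zero by simp
    then have "real l * \<alpha> \<ge> 6 * \<psi>" by (simp add: \<alpha>_def \<psi>_def algebra_simps)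
    then have l\<alpha>: "real l * \<alpha> \<ge> 684 / 100" using \<psi>1 by simp
    have "2 / 3.15 * \<alpha> \<le> 2 / pi * \<alpha>" using pb \<alpha> by (intro mult_right_mono divide_left_mono) auto
    also have "\<dots> \<le> sin \<alpha>" using \<alpha> True by (intro sin_chord_bound) auto
    finally have "93 / 100 * (2 / 3.15 * \<alpha>) \<le> sin \<psi> * sin \<alpha>" using sin\<psi> \<alpha> by (intro mult_mono) auto
    from mult_left_mono[OF this, of "real l"]
    have "93 / 100 * (2 / 3.15) * (real l * \<alpha>) \<le> real l * (sin \<psi> * sin \<alpha>)" using lpos by (simp add: mult_ac)
    then have "4 \<le> real l * (sin \<psi> * sin \<alpha>)" using l\<alpha> by simp
    then have "0 < real l * (2 * (sin \<psi> * sin \<alpha>) - \<bar>B * cos \<alpha> + B'\<bar> - 65 / 64 * \<eta>)"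
      using R \<eta>l unfolding right_diff_distrib by linarith
    then show ?thesis using lpos by (simp only: zero_less_mult_pos)
  next
    case False
    define \<beta> Y where "\<beta> = 6 * \<phi>" and "Y = 1 / X ^ 6"
    have \<beta>: "0 < \<beta>" "\<beta> < pi / 2" "\<alpha> = pi - \<beta>" using False \<phi> by (auto simp: \<beta>_def \<alpha>_def \<phi>_def)
    have trig: "cos \<alpha> = - cos \<beta>" "sin \<alpha> = sin \<beta>" unfolding \<beta>(3) by simp_all
    have "1 - 6 * (X - 1) \<le> Y" using inverse_sixth_power[of "X - 1"] X by (simp add: Y_def)
    moreover have "6 * (X - 1) \<le> 2 * \<beta>" using X(2) by (simp add: \<beta>_def)
    ultimately have up: "cos \<beta> - Y \<le> 2 * \<beta>" using cos_le_one[of \<beta>] by linarith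
    have "Y \<le> 1" using X by (simp add: Y_def divide_le_eq)
    then have "Y - cos \<beta> \<le> 2 * \<beta>" using one_minus_cos_bounds(2)[of \<beta>] \<beta> by linarith
    with up have "\<bar>- cos \<beta> + Y\<bar> \<le> 2 * \<beta>" by linarith
    then have "B * \<bar>- cos \<beta> + Y\<bar> \<le> 356 / 1000 * (2 * \<beta>)" using B_small B0 \<beta> by (intro mult_mono) auto
    moreover have "\<bar>B * cos \<alpha> + B'\<bar> = B * \<bar>- cos \<beta> + Y\<bar>"
      unfolding trig B'_eq Y_def[symmetric] using B0 by (simp only: distrib_left[symmetric] abs_mult)
    ultimately have R: "\<bar>B * cos \<alpha> + B'\<bar> \<le> 712 / 1000 * \<beta>" by simp
    have "2 / 3.15 * \<beta> \<le> 2 / pi * \<beta>" using pb \<beta> by (intro mult_right_mono divide_left_mono) auto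
    also have "\<dots> \<le> sin \<beta>" using \<beta> by (intro sin_chord_bound) auto
    finally have "93 / 100 * (2 / 3.15 * \<beta>) \<le> sin \<psi> * sin \<alpha>"
      unfolding trig using sin\<psi> \<beta> by (intro mult_mono) auto
    then have "46 / 100 * \<beta> \<le> 2 * (sin \<psi> * sin \<alpha>) - \<bar>B * cos \<alpha> + B'\<bar>" using R \<beta> by simp
    moreover have "65 / 64 * \<eta> < 46 / 100 * \<beta>"
    proof -
      have "real l * \<beta> = 6 * x" by (simp add: \<beta>_def x_def)
      then have "628 / 100 \<le> real l * \<beta>" using x_lower pb by linarith
      then have "65 / 64 * (real l * \<eta>) < 46 / 100 * (real l * \<beta>)" using \<eta>l by linarith
      then have "real l * (65 / 64 * \<eta>) < real l * (46 / 100 * \<beta>)" by (simp only: mult.left_commute)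
      then show ?thesis using lpos by (simp only: mult_less_cancel_left_pos)
    qed
    ultimately show ?thesis by linarith
  qed
  then show ?thesis using main unfolding s_def by linarith
qed

section \<open>Perturbed Eisenstein series on the arc\<close>

text \<open>The index \<open>j = wt_m k\<close> with \<open>wt_s k = 0\<close> calls for \<open>E\<^sub>0\<close>, which is 1 by convention.\<close>

definition weight_form :: "nat \<Rightarrow> complex \<Rightarrow> complex" where
  "weight_form w = (if w = 0 then \<lambda>_. 1 else eis_q w)"

lemma weight_form_props:
  assumes "even w" "w = 0 \<or> w \<ge> 4"
  shows "mform w (weight_form w)" "\<And>z. Im z > 0 \<Longrightarrow> eisenstein w z = weight_form w (nome z)"
  using assms eis_q_props[of w] by (auto simp: weight_form_def mform_def eisenstein_def)

lemma weight_facts: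
  assumes "even k" "k \<ge> 12"
  shows "wt_s k \<in> wt_residues" "k = 12 * wt_m k + wt_s k" "even (wt_s k)"
    "wt_m (k + 12) = wt_m k + 1" "wt_s (k + 12) = wt_s k"
    "\<And>j. j \<le> wt_m k \<Longrightarrow> k - 12 * j = 12 * (wt_m k - j) + wt_s k"
proof -
  show dec: "wt_s k \<in> wt_residues" "k = 12 * wt_m k + wt_s k" using wt_decomp assms by auto
  then show "even (wt_s k)" by (auto simp: wt_residues_def)
  show "wt_m (k + 12) = wt_m k + 1" "wt_s (k + 12) = wt_s k"
    using wt_decomp_unique[OF dec(1), of "k + 12" "wt_m k + 1"] dec(2) by simp_all
  show "k - 12 * j = 12 * (wt_m k - j) + wt_s k" if "j \<le> wt_m k" for j
    using dec(2) that by (simp add: diff_mult_distrib2)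
qed

lemma mod_form_is_mform:
  assumes "even k" "k \<ge> 12"
  obtains g where "mform k g" "\<And>z. Im z > 0 \<Longrightarrow> mod_form a k z = g (nome z)"
proof -
  note wf = weight_facts[OF assms]
  define g where "g = (\<lambda>q. eis_q k q +
     (\<Sum>j = 1..wt_m k. of_real (a j) * (weight_form (k - 12 * j) q * delta_q q ^ j)))"
  have w: "even (k - 12 * j)" "k - 12 * j = 0 \<or> k - 12 * j \<ge> 4" if "j \<in> {1..wt_m k}" for j
    using wf(1,3) wf(6)[of j] that by (auto simp: wt_residues_def)
  have "mform k (\<lambda>q. of_real (a j) * (weight_form (k - 12 * j) q * delta_q q ^ j))" if "j \<in> {1..wt_m k}" for j
  proof -
    have "mform (k - 12 * j + 12 * j) (\<lambda>q. weight_form (k - 12 * j) q * delta_q q ^ j)"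
      by (rule mform_mult[OF weight_form_props(1)[OF w[OF that]] mform_power[OF delta_form(1)]])
    moreover have "k - 12 * j + 12 * j = k"
    proof -
      have "12 * j \<le> k" using wf(2) that by auto
      then show ?thesis by simp
    qed
    ultimately show ?thesis by (intro mform_cmult) simp
  qed
  then have "mform k g" unfolding g_def
    by (intro mform_add mform_sum eis_q_props) (use assms in auto)
  moreover have "mod_form a k z = g (nome z)" if "Im z > 0" for z
  proof -
    have "of_real (a j) * eisenstein (k - 12 * j) z * cusp_delta z ^ j =
        of_real (a j) * (weight_form (k - 12 * j) (nome z) * delta_q (nome z) ^ j)" if "j \<in> {1..wt_m k}" for j
      using weight_form_props(2)[OF w[OF that] \<open>Im z > 0\<close>] cusp_delta_eq[OF \<open>Im z > 0\<close>] by simp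
    then have "(\<Sum>j = 1..wt_m k. of_real (a j) * eisenstein (k - 12 * j) z * cusp_delta z ^ j) =
        (\<Sum>j = 1..wt_m k. of_real (a j) * (weight_form (k - 12 * j) (nome z) * delta_q (nome z) ^ j))"
      by (intro sum.cong refl)
    moreover have "eisenstein k z = eis_q k (nome z)"
      by (rule eis_q_props(3)[OF assms(1) _ that]) (use assms(2) in simp)
    ultimately show ?thesis unfolding mod_form_def g_def by (simp only:)
  qed
  ultimately show ?thesis by (rule that)
qed

lemma eisenstein_arc_Reals: "even w \<Longrightarrow> arc_fun w (eisenstein w) \<theta> \<in> \<real>"
  using eisenstein_arc_real[of "w div 2" \<theta>] by (simp add: Reals_cnj_iff)

lemma cusp_delta_arc_Reals: "arc_fun 12 cusp_delta \<theta> \<in> \<real>"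
proof -
  have "cis (6 * \<theta>) = cis (2 * \<theta>) ^ 3" "cis (6 * \<theta>) = cis (3 * \<theta>) ^ 2"
    by (simp_all add: Complex.DeMoivre)
  then have "arc_fun 12 cusp_delta \<theta> = (arc_fun 4 (eisenstein 4) \<theta> ^ 3 - arc_fun 6 (eisenstein 6) \<theta> ^ 2) / of_real 1728"
    by (simp add: arc_fun_def cusp_delta_def power_mult_distrib algebra_simps diff_divide_distrib)
  also have "\<dots> \<in> \<real>"
    by (intro Reals_divide Reals_diff Reals_power Reals_of_real eisenstein_arc_Reals) auto
  finally show ?thesis .
qed

lemma mod_form_arc_Reals:
  assumes "even k" "k \<ge> 12"
  shows "arc_fun k (mod_form a k) \<theta> \<in> \<real>"
proof -
  note wf = weight_facts[OF assms]
  have "arc_fun k (mod_form a k) \<theta> = arc_fun k (eisenstein k) \<theta> +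
      (\<Sum>j = 1..wt_m k. of_real (a j) * arc_fun (k - 12 * j) (eisenstein (k - 12 * j)) \<theta> * arc_fun 12 cusp_delta \<theta> ^ j)"
  proof -
    have "cis (real k * \<theta> / 2) * (of_real (a j) * eisenstein (k - 12 * j) (cis \<theta>) * cusp_delta (cis \<theta>) ^ j) =
      of_real (a j) * arc_fun (k - 12 * j) (eisenstein (k - 12 * j)) \<theta> * arc_fun 12 cusp_delta \<theta> ^ j"
      if "j \<in> {1..wt_m k}" for j
    proof -
      have "12 * j \<le> k" using wf(2) that by auto
      then have "real k = real (k - 12 * j) + 12 * real j" by (simp add: of_nat_diff)
      moreover have "(A + 12 * B) * \<theta> / 2 = A * \<theta> / 2 + B * (real 12 * \<theta> / 2)" for A B :: real
        by (simp add: field_simps)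
      ultimately have angle: "real k * \<theta> / 2 = real (k - 12 * j) * \<theta> / 2 + real j * (real 12 * \<theta> / 2)"
        by metis
      have "cis (real k * \<theta> / 2) = cis (real (k - 12 * j) * \<theta> / 2) * cis (real 12 * \<theta> / 2) ^ j"
        unfolding angle cis_mult[symmetric] Complex.DeMoivre ..
      then show ?thesis unfolding arc_fun_def by (simp add: power_mult_distrib)
    qed
    then have "(\<Sum>j = 1..wt_m k. cis (real k * \<theta> / 2) * (of_real (a j) * eisenstein (k - 12 * j) (cis \<theta>) * cusp_delta (cis \<theta>) ^ j)) =
        (\<Sum>j = 1..wt_m k. of_real (a j) * arc_fun (k - 12 * j) (eisenstein (k - 12 * j)) \<theta> * arc_fun 12 cusp_delta \<theta> ^ j)"
      by (intro sum.cong refl)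
    moreover have "arc_fun k (mod_form a k) \<theta> = arc_fun k (eisenstein k) \<theta> +
        (\<Sum>j = 1..wt_m k. cis (real k * \<theta> / 2) * (of_real (a j) * eisenstein (k - 12 * j) (cis \<theta>) * cusp_delta (cis \<theta>) ^ j))"
      unfolding mod_form_def arc_fun_def distrib_left sum_distrib_left ..
    ultimately show ?thesis by (simp only:)
  qed
  also have "\<dots> \<in> \<real>"
    using wf(2,3) by (intro Reals_add Reals_mult Reals_power sum_in_Reals Reals_of_real eisenstein_arc_Reals cusp_delta_arc_Reals) (use assms in auto)
  finally show ?thesis .
qed

lemma cusp_delta_le_eps:
  assumes "z \<in> unit_arc"
  shows "cmod (cusp_delta z) \<le> eps"
proof -
  have sub: "unit_arc \<subseteq> {z. Im z > 0}" using arc_sin_pos by (auto simp: unit_arc_def)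
  have "continuous_on unit_arc (\<lambda>z. cmod (delta_q (nome z)))"
    by (intro continuous_intros continuous_on_compose2[OF holomorphic_on_imp_continuous_on[OF mform_holomorphic[OF delta_form(1)]]
          holomorphic_on_imp_continuous_on[OF nome_holomorphic]]) (use sub nome_in_disc in auto)
  then have "continuous_on unit_arc (\<lambda>z. cmod (cusp_delta z))"
    by (rule continuous_on_eq) (use sub cusp_delta_eq in auto)
  moreover have "compact unit_arc"
    unfolding unit_arc_def by (rule compact_continuous_image) (auto intro!: continuous_intros)
  ultimately have "compact ((\<lambda>z. cmod (cusp_delta z)) ` unit_arc)" by (rule compact_continuous_image)
  then show ?thesis unfolding eps_def
    by (intro cSUP_upper assms bounded_imp_bdd_above compact_imp_bounded)
qed

text \<open>For \<open>s = 4\<close> the estimate by absolute values, 3 plus \<open>arc_tail 2\<close>, is too large, so \<open>E\<^sub>4\<close> is bounded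
  through its square \<open>E\<^sub>8\<close>.\<close>

lemma eisenstein_delta_const:
  assumes "\<theta> \<in> closed_arc" "s \<in> wt_residues"
  shows "cmod (eisenstein s (cis \<theta>)) \<le> 3 + delta_const s"
proof -
  have b: "cmod (eisenstein (2 * l) (cis \<theta>)) \<le> 3 + arc_tail l" if "l \<ge> 2" for l
    by (rule eisenstein_arc_norm[OF assms(1) that])
  have four: "cmod (eisenstein 4 (cis \<theta>)) \<le> 4"
  proof (rule power2_le_imp_le)
    have z: "Im (cis \<theta>) > 0" using arc_sin_pos[OF assms(1)] by simp
    have "eisenstein 8 (cis \<theta>) = eisenstein 4 (cis \<theta>) ^ 2"
      using e8_eq[OF nome_in_disc[OF z]] eis_q_props(3)[of 8, OF _ _ z] eis_q_props(3)[of 4, OF _ _ z] by simp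
    then have "(cmod (eisenstein 4 (cis \<theta>)))\<^sup>2 \<le> 3 + arc_tail 4" using b[of 4] by (simp add: norm_power)
    also have "\<dots> \<le> 4\<^sup>2" by (simp add: arc_tail_def power_divide)
    finally show "(cmod (eisenstein 4 (cis \<theta>)))\<^sup>2 \<le> 4\<^sup>2" .
  qed simp
  consider "s = 0" | "s = 4" | "s = 6" | "s = 8" | "s = 10" | "s = 14"
    using assms(2) by (auto simp: wt_residues_def)
  then show ?thesis
  proof cases
    case 6
    then show ?thesis using b[of 7] arc_tail_le(2)[of 7] by (simp add: delta_const_def)
  qed (use four b[of 3] b[of 4] b[of 5] in \<open>simp_all add: delta_const_def arc_tail_def power_divide eisenstein_def\<close>)
qed

lemma mod_form_perturbation:
  assumes "even k" "k \<ge> 12" "\<theta> \<in> closed_arc"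
  shows "cmod (arc_fun k (mod_form a k) \<theta> - arc_fun k (eisenstein k) \<theta>) \<le> coeff_size a k"
proof -
  note wf = weight_facts[OF assms(1,2)]
  define m z where "m = wt_m k" and "z = cis \<theta>"
  have zA: "z \<in> unit_arc" using assms(3) by (auto simp: unit_arc_def z_def)
  have D: "cmod (cusp_delta z) ^ j \<le> eps ^ j" for j
    by (intro power_mono cusp_delta_le_eps[OF zA]) auto
  let ?T = "\<lambda>j. of_real (a j) * eisenstein (k - 12 * j) z * cusp_delta z ^ j"
  have T: "cmod (?T j) \<le> C * (\<bar>a j\<bar> * eps ^ j)" if "cmod (eisenstein (k - 12 * j) z) \<le> C" for j C
  proof -
    have "C \<ge> 0" using that norm_ge_zero order_trans by blast
    then have "\<bar>a j\<bar> * cmod (eisenstein (k - 12 * j) z) * cmod (cusp_delta z) ^ j \<le> \<bar>a j\<bar> * C * eps ^ j"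
      by (intro mult_mono that D) auto
    then show ?thesis by (simp add: norm_mult norm_power mult_ac)
  qed
  have lower: "cmod (?T j) \<le> (3 + delta_const 12) * (\<bar>a j\<bar> * eps ^ j)" if "j \<in> {1..m - 1}" for j
  proof (rule T)
    have w: "k - 12 * j = 12 * (m - j) + wt_s k" using wf(6)[of j] that by (auto simp: m_def)
    define l where "l = (k - 12 * j) div 2"
    have "even (k - 12 * j)" "k - 12 * j \<ge> 12" using w wf(3) that by auto
    then have l: "k - 12 * j = 2 * l" "l \<ge> 6" by (auto simp: l_def)
    then show "cmod (eisenstein (k - 12 * j) z) \<le> 3 + delta_const 12"
      using eisenstein_arc_norm[OF assms(3), of l] arc_tail_le(2)[OF l(2)] by (simp add: z_def delta_const_def)
  qed
  have "arc_fun k (mod_form a k) \<theta> - arc_fun k (eisenstein k) \<theta> = cis (real k * \<theta> / 2) * (\<Sum>j = 1..m. ?T j)"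
    by (simp add: arc_fun_def mod_form_def m_def z_def algebra_simps)
  then have eq: "cmod (arc_fun k (mod_form a k) \<theta> - arc_fun k (eisenstein k) \<theta>) = cmod (\<Sum>j = 1..m. ?T j)"
    by (simp add: norm_mult)
  show ?thesis
  proof (cases "m = 0")
    case True
    then show ?thesis unfolding eq by (simp add: coeff_size_def m_def)
  next
    case False
    then have set: "{1..m} = insert m {1..m - 1}" by auto
    have "cmod (\<Sum>j = 1..m. ?T j) \<le> (\<Sum>j = 1..m. cmod (?T j))" by (rule norm_sum)
    also have "\<dots> = cmod (?T m) + (\<Sum>j = 1..m - 1. cmod (?T j))"
      unfolding set by (rule sum.insert) (use False in auto)
    also have "\<dots> \<le> (3 + delta_const (wt_s k)) * (\<bar>a m\<bar> * eps ^ m) +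
        (\<Sum>j = 1..m - 1. (3 + delta_const 12) * (\<bar>a j\<bar> * eps ^ j))"
    proof (intro add_mono sum_mono lower T)
      have "k - 12 * m = wt_s k" using wf(6)[of m] by (simp add: m_def)
      then show "cmod (eisenstein (k - 12 * m) z) \<le> 3 + delta_const (wt_s k)"
        using eisenstein_delta_const[OF assms(3) wf(1)] by (simp add: z_def)
    qed
    also have "\<dots> = coeff_size a k"
      using False by (simp add: coeff_size_def m_def sum_distrib_left mult_ac)
    finally show ?thesis unfolding eq .
  qed
qed

text \<open>The constant 22 is 20 from the coefficients plus 2 from \<open>arc_tail\<close>.\<close>

lemma mod_form_on_arc:
  assumes "even k" "k \<ge> 12" "\<theta> \<in> closed_arc" "coeff_size a k \<le> 20 * (1 / 2) ^ (k div 2)" "k = 2 * l"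
  shows "\<bar>Re (arc_fun k (mod_form a k) \<theta>) - (2 * cos (real l * \<theta>) + 1 / (2 + 2 * cos \<theta>) ^ l)\<bar> \<le> 22 * (1 / 2) ^ l"
proof -
  let ?F = "arc_fun k (mod_form a k) \<theta>" and ?E = "arc_fun (2 * l) (eisenstein (2 * l)) \<theta>"
  let ?M = "2 * cos (real l * \<theta>) + 1 / (2 + 2 * cos \<theta>) ^ l"
  have l: "l \<ge> 6" "k div 2 = l" using assms by auto
  have "cmod (?F - ?E) \<le> 20 * (1 / 2) ^ l"
    using mod_form_perturbation[OF assms(1-3), of a] assms(4) unfolding assms(5) by simp
  moreover have "cmod (?E - of_real ?M) \<le> 2 * (1 / 2) ^ l"
    using eisenstein_on_arc[OF assms(3), of l] arc_tail_le(1)[OF l(1)] l by simp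
  moreover have "cmod (?F - of_real ?M) \<le> cmod (?F - ?E) + cmod (?E - of_real ?M)"
    using dist_triangle[of ?F "of_real ?M" ?E] by (simp only: dist_norm)
  moreover have "\<bar>Re (?F - of_real ?M)\<bar> \<le> cmod (?F - of_real ?M)" by (rule abs_Re_le_cmod)
  ultimately show ?thesis by simp
qed

section \<open>Counting zeros\<close>

lemma arc_vector_derivative:
  assumes "Im (cis \<theta>) > 0" "(f has_field_derivative f') (at (cis \<theta>))"
  shows "((\<lambda>\<theta>. f (cis \<theta>)) has_vector_derivative f' * (\<i> * cis \<theta>)) (at \<theta>)"
proof -
  have "((\<lambda>w. exp (\<i> * w)) has_field_derivative \<i> * cis \<theta>) (at (of_real \<theta>))"
    by (auto intro!: derivative_eq_intros simp: cis_conv_exp)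
  moreover have "(f has_field_derivative f') (at (exp (\<i> * of_real \<theta>)))" using assms(2) by (simp add: cis_conv_exp)
  ultimately have "((\<lambda>w. f (exp (\<i> * w))) has_field_derivative f' * (\<i> * cis \<theta>)) (at (of_real \<theta>))"
    by (rule DERIV_chain2[rotated])
  from has_vector_derivative_real_field[OF this] show ?thesis by (simp add: cis_conv_exp)
qed

lemma j_arc_real:
  assumes "Im (cis \<theta>) > 0"
  shows "j_q (nome (cis \<theta>)) \<in> \<real>"
proof -
  have "cis (6 * \<theta>) = cis (2 * \<theta>) ^ 3" by (simp add: Complex.DeMoivre)
  then have "arc_fun 4 (eisenstein 4) \<theta> ^ 3 / arc_fun 12 cusp_delta \<theta> = eisenstein 4 (cis \<theta>) ^ 3 / cusp_delta (cis \<theta>)"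
    by (simp add: arc_fun_def power_mult_distrib)
  also have "\<dots> = j_q (nome (cis \<theta>))"
    using eis_q_props(3)[of 4, OF _ _ assms] cusp_delta_eq[OF assms] by (simp add: j_q_def)
  finally show ?thesis
    using Reals_divide[OF Reals_power[OF eisenstein_arc_Reals[of 4 \<theta>], of 3] cusp_delta_arc_Reals[of \<theta>]] by simp
qed

lemma j_derivative_nonzero_arc:
  assumes "\<theta> \<in> open_arc"
  obtains D where "((\<lambda>z. j_q (nome z)) has_field_derivative D) (at (cis \<theta>))" "D \<noteq> 0"
proof -
  note pos = open_arc_facts(1)[OF assms]
  show ?thesis
    by (rule that[OF j_has_derivative[OF pos]])
       (use base_forms_nonzero_arc[OF assms] delta_nonzero[OF nome_in_disc[OF pos] nome_nonzero] in auto)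
qed

text \<open>On the arc \<open>j\<close> is real with nonvanishing derivative, so Rolle applies.\<close>

lemma j_inj_on_arc: "inj_on (\<lambda>\<theta>. j_q (nome (cis \<theta>))) open_arc"
proof (rule inj_onI, rule ccontr)
  fix a b :: real
  assume a: "a \<in> open_arc" and b: "b \<in> open_arc"
    and eq: "j_q (nome (cis a)) = j_q (nome (cis b))" and ne: "a \<noteq> b"
  let ?j = "\<lambda>\<theta>. j_q (nome (cis \<theta>))"
  have der: "\<exists>D. (?j has_vector_derivative D) (at \<theta>) \<and> D \<noteq> 0" if th: "\<theta> \<in> open_arc" for \<theta>
  proof -
    obtain D where D: "((\<lambda>z. j_q (nome z)) has_field_derivative D) (at (cis \<theta>))" "D \<noteq> 0"
      using j_derivative_nonzero_arc[OF th] by blast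
    show ?thesis
      using arc_vector_derivative[OF open_arc_facts(1)[OF th] D(1)] D(2)
      by (intro exI[of _ "D * (\<i> * cis \<theta>)"]) simp
  qed
  define j' where "j' = (\<lambda>\<theta>. vector_derivative ?j (at \<theta>))"
  have j': "(?j has_vector_derivative j' \<theta>) (at \<theta>)" "j' \<theta> \<noteq> 0" if "\<theta> \<in> open_arc" for \<theta>
    using der[OF that] vector_derivative_at unfolding j'_def by metis+
  have reim: "((\<lambda>\<theta>. Re (?j \<theta>)) has_vector_derivative Re (j' \<theta>)) (at \<theta>)"
    "((\<lambda>\<theta>. Im (?j \<theta>)) has_vector_derivative Im (j' \<theta>)) (at \<theta>)" if "\<theta> \<in> open_arc" for \<theta>
    using bounded_linear.has_vector_derivative[OF bounded_linear_Re j'(1)[OF that]]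
      bounded_linear.has_vector_derivative[OF bounded_linear_Im j'(1)[OF that]] by auto
  have Im0: "Im (j' \<theta>) = 0" if th: "\<theta> \<in> open_arc" for \<theta>
  proof -
    have "((\<lambda>\<theta>. 0 :: real) has_vector_derivative Im (j' \<theta>)) (at \<theta>)"
      by (rule has_vector_derivative_transform_within_open[OF reim(2)[OF th] open_greaterThanLessThan th])
         (use j_arc_real open_arc_facts(1) in \<open>simp add: complex_is_Real_iff\<close>)
    then show ?thesis using vector_derivative_unique_at has_vector_derivative_const by blast
  qed
  define p q where "p = min a b" and "q = max a b"
  have pq: "p < q" "Re (?j p) = Re (?j q)" using ne eq by (auto simp: p_def q_def min_def max_def)
  have sub: "{p..q} \<subseteq> open_arc" using a b by (auto simp: p_def q_def)
  have "\<exists>z>p. z < q \<and> Re (?j q) - Re (?j p) = (q - p) * Re (j' z)"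
    by (rule MVT2[OF pq(1)]) (use reim(1) sub in \<open>auto simp: has_real_derivative_iff_has_vector_derivative\<close>)
  then obtain z where z: "p < z" "z < q" "Re (j' z) = 0" using pq by auto
  then have "z \<in> {p..q}" by simp
  then have "z \<in> open_arc" using sub by blast
  then show False using Im0 j'(2) z(3) by (metis complex_eqI zero_complex.sel)
qed

text \<open>Removing one factor of a double root keeps the root set but lowers the degree below its size.\<close>

lemma simple_roots_of_many_roots:
  fixes P :: "complex poly"
  assumes "P \<noteq> 0" "degree P \<le> card {x. poly P x = 0}" "poly P a = 0"
  shows "poly (pderiv P) a \<noteq> 0"
proof
  assume der: "poly (pderiv P) a = 0"
  obtain Q where Q: "P = [:- a, 1:] * Q" using assms(3) poly_eq_0_iff_dvd by (metis dvdE)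
  have "Q \<noteq> 0" using Q assms(1) by auto
  have "poly Q a = 0" using der unfolding Q pderiv_mult by (simp add: pderiv_pCons)
  then have sub: "{x. poly P x = 0} \<subseteq> {x. poly Q x = 0}" unfolding Q by auto
  have "card {x. poly P x = 0} \<le> card {x. poly Q x = 0}"
    by (rule card_mono[OF poly_roots_finite[OF \<open>Q \<noteq> 0\<close>] sub])
  also have "\<dots> \<le> degree Q" by (rule card_poly_roots_bound[OF \<open>Q \<noteq> 0\<close>])
  also have "\<dots> < degree P" unfolding Q using \<open>Q \<noteq> 0\<close> by (subst degree_mult_eq) auto
  finally show False using assms(2) by simp
qed

lemma sign_change_zero:
  fixes f :: "real \<Rightarrow> real"
  assumes "a < b" "continuous_on {a..b} f" "f a * f b < 0"
  shows "\<exists>z. a < z \<and> z < b \<and> f z = 0"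
proof -
  consider "f a < 0" "0 < f b" | "0 < f a" "f b < 0" using assms(3) by (auto simp: mult_less_0_iff)
  then obtain z where "a \<le> z" "z \<le> b" "f z = 0"
    using IVT'[of f a 0 b] IVT2'[of f b 0 a] assms(1,2) by (metis less_imp_le)
  then show ?thesis using assms(3) by (metis less_le mult_eq_0_iff less_irrefl)
qed

lemma fund_domain_cases:
  assumes "z \<in> fund_domain"
  shows "Im z > 0" "\<bar>Re z\<bar> \<le> 1 / 2" "1 < cmod z \<or> z \<in> unit_arc"
proof -
  show "Im z > 0" "\<bar>Re z\<bar> \<le> 1 / 2" using assms by (auto simp: fund_domain_def upper_half_plane_def)
  show "1 < cmod z \<or> z \<in> unit_arc"
  proof (cases "1 < cmod z")
    case False
    then have z: "cmod z = 1" "- 1 / 2 \<le> Re z" "Re z \<le> 0" "Im z > 0"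
      using assms by (auto simp: fund_domain_def upper_half_plane_def)
    have sq: "(Re z)\<^sup>2 + (Im z)\<^sup>2 = 1" using cmod_power2[of z] z(1) by simp
    have "1 - (Re z)\<^sup>2 = (Im z)\<^sup>2" using sq by simp
    then have "sin (arccos (Re z)) = Im z" using z by (simp add: sin_arccos)
    then have "z = cis (arccos (Re z))" using z by (simp add: complex_eq_iff cos_arccos)
    moreover have "pi / 2 \<le> arccos (Re z)" using arccos_le_arccos[of "Re z" 0] z by simp
    moreover have "arccos (Re z) \<le> 2 * pi / 3"
    proof -
      have "arccos (Re z) \<le> arccos (- 1 / 2)" using arccos_le_arccos[of "- 1 / 2" "Re z"] z by simp
      also have "arccos (- 1 / 2) = 2 * pi / 3"
        using arccos_cos[of "2 * pi / 3"] cos_120 by simp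
      finally show ?thesis .
    qed
    ultimately show ?thesis unfolding unit_arc_def by (metis atLeastAtMost_iff imageI)
  qed simp
qed

text \<open>The form equals the base form times a power of the discriminant times \<open>P j\<close> with \<open>degree P \<le> m\<close>. The
  \<open>m\<close> sign changes produce \<open>m\<close> zeros on the open arc. There \<open>j\<close> is injective, so these are \<open>m\<close> distinct
  roots of \<open>P\<close>, hence all roots, and simple ones. In the fundamental domain off the arc neither the base
  form nor the discriminant vanishes, and \<open>j\<close> takes none of these values. The points \<open>x\<close> are left open
  because the second form is treated with the zeros of the first.\<close>

lemma zeros_from_sign_changes:
  fixes x :: "nat \<Rightarrow> real"
  assumes k: "even k" "k \<ge> 12" and m: "m = wt_m k"
    and incr: "\<And>i. i < m \<Longrightarrow> x i < x (Suc i)" and range: "pi / 2 \<le> x 0" "x m \<le> 2 * pi / 3"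
    and sign: "\<And>i. i \<le> m \<Longrightarrow> (- 1) ^ (c + i) * Re (arc_fun k (mod_form a k) (x i)) > 0"
  obtains t where "\<And>i. i \<in> {1..m} \<Longrightarrow> x (i - 1) < t i \<and> t i < x i"
    "strict_mono_on {1..m} t"
    "t ` {1..m} = {\<theta> \<in> open_arc. arc_fun k (mod_form a k) \<theta> = 0}"
    "simple_zeros_on (arc_fun k (mod_form a k)) open_arc"
    "\<And>z. z \<in> fund_domain \<Longrightarrow> mod_form a k z = 0 \<Longrightarrow> z \<in> unit_arc"
proof -
  note wf = weight_facts[OF k]
  let ?I = "open_arc" and ?G = "arc_fun k (mod_form a k)"
  obtain g where g: "mform k g" "\<And>z. Im z > 0 \<Longrightarrow> mod_form a k z = g (nome z)"
    using mod_form_is_mform[OF k] by blast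
  have mono: "x i \<le> x j" if "i \<le> j" "j \<le> m" for i j
    using that
  proof (induction j rule: dec_induct)
    case (step j)
    then show ?case using incr[of j] by auto
  qed simp
  have arc_pos: "Im (cis \<theta>) > 0" if "\<theta> \<in> closed_arc" for \<theta> using arc_sin_pos[OF that] by simp
  have contG: "continuous_on closed_arc (\<lambda>\<theta>. Re (?G \<theta>))"
  proof -
    have "continuous_on closed_arc (\<lambda>\<theta>. g (nome (cis \<theta>)))"
      by (rule continuous_on_compose2[OF holomorphic_on_imp_continuous_on[OF mform_holomorphic[OF g(1)]]
            continuous_on_compose2[OF holomorphic_on_imp_continuous_on[OF nome_holomorphic[of UNIV]]]])
         (use arc_pos nome_in_disc in \<open>auto intro!: continuous_intros\<close>)
    then have "continuous_on closed_arc (\<lambda>\<theta>. mod_form a k (cis \<theta>))"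
      by (rule continuous_on_eq) (use g(2) arc_pos in auto)
    then show ?thesis unfolding arc_fun_def by (intro continuous_intros) simp
  qed
  have "\<exists>z. x (i - 1) < z \<and> z < x i \<and> Re (?G z) = 0" if i: "i \<in> {1..m}" for i
  proof (rule sign_change_zero)
    obtain h where h: "i = Suc h" "h < m" using i by (cases i) auto
    show "x (i - 1) < x i" using incr[of h] h by simp
    have "{x (i - 1)..x i} \<subseteq> closed_arc" using mono[of 0 h] mono[of i m] range h by auto
    then show "continuous_on {x (i - 1)..x i} (\<lambda>\<theta>. Re (?G \<theta>))" using contG continuous_on_subset by blast
    have "0 < ((- 1) ^ (c + h) * Re (?G (x h))) * ((- 1) ^ (c + Suc h) * Re (?G (x (Suc h))))"
      by (intro mult_pos_pos sign) (use h in auto)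
    also have "\<dots> = ((- 1) ^ (c + h) * (- 1) ^ (c + h)) * - (Re (?G (x h)) * Re (?G (x (Suc h))))" by simp
    also have "(- 1 :: real) ^ (c + h) * (- 1) ^ (c + h) = 1" by (simp flip: power_mult_distrib)
    finally show "Re (?G (x (i - 1))) * Re (?G (x i)) < 0" using h by simp
  qed
  then obtain t where t: "\<And>i. i \<in> {1..m} \<Longrightarrow> x (i - 1) < t i \<and> t i < x i \<and> Re (?G (t i)) = 0"
    by metis
  have tI: "t i \<in> ?I" if "i \<in> {1..m}" for i
  proof -
    have "i - 1 \<le> m" "i \<le> m" using that by auto
    then have "x 0 \<le> x (i - 1)" "x i \<le> x m" by (auto intro: mono)
    then show ?thesis using t[OF that] range by auto
  qed
  have smono: "strict_mono_on {1..m} t"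
  proof (rule strict_mono_onI)
    fix i j assume ij: "i \<in> {1..m}" "j \<in> {1..m}" "i < j"
    then have "x i \<le> x (j - 1)" by (intro mono) auto
    then show "t i < t j" using t[OF ij(1)] t[OF ij(2)] by linarith
  qed
  have G0: "?G (t i) = 0" if "i \<in> {1..m}" for i
    using t[OF that] mod_form_arc_Reals[OF k, of a "t i"] by (auto simp: complex_is_Real_iff complex_eq_iff)
  have F0: "?G \<theta> = 0 \<longleftrightarrow> mod_form a k (cis \<theta>) = 0" for \<theta> by (simp add: arc_fun_def)
  have gw: "mform (12 * m + wt_s k) g" using g(1) wf(2) m by simp
  obtain P where P: "degree P \<le> m" "\<And>q. q \<in> ball 0 1 - {0} \<Longrightarrow>
      g q = base_form (wt_s k) q * delta_q q ^ m * poly P (j_q q)"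
    using modular_structure[OF wf(1) gw] by blast
  have form: "mod_form a k z = (base_form (wt_s k) (nome z) * delta_q (nome z) ^ m) * poly P (j_q (nome z))" if "Im z > 0" for z
    using P(2)[of "nome z"] g(2)[OF that] nome_in_disc[OF that] nome_nonzero[of z] by simp
  have D: "delta_q (nome z) \<noteq> 0" if "Im z > 0" for z
    using delta_nonzero[OF nome_in_disc[OF that] nome_nonzero] .
  have base: "base_form (wt_s k) (nome (cis \<theta>)) \<noteq> 0" if "\<theta> \<in> ?I" for \<theta>
    using base_forms_nonzero_arc[OF that] by (simp add: base_form_def)
  have P0: "P \<noteq> 0"
  proof
    assume "P = 0"
    then have "mod_form a k (cis (x 0)) = 0" using form[OF arc_pos[of "x 0"]] range mono[of 0 m] by simp
    then show False using sign[of 0] F0[of "x 0"] by simp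
  qed
  have zeroP: "?G \<theta> = 0 \<longleftrightarrow> poly P (j_q (nome (cis \<theta>))) = 0" if "\<theta> \<in> ?I" for \<theta>
    unfolding F0 using form[OF open_arc_facts(1)[OF that]] base[OF that] D[OF open_arc_facts(1)[OF that]] by simp
  define R where "R = (\<lambda>i. j_q (nome (cis (t i)))) ` {1..m}"
  have "inj_on t {1..m}" using smono by (rule strict_mono_on_imp_inj_on)
  then have "inj_on ((\<lambda>\<theta>. j_q (nome (cis \<theta>))) \<circ> t) {1..m}"
    by (rule comp_inj_on) (rule inj_on_subset[OF j_inj_on_arc], use tI in auto)
  then have cardR: "card R = m" unfolding R_def by (subst card_image) (auto simp: o_def)
  have sub: "R \<subseteq> {y. poly P y = 0}" using zeroP tI G0 by (auto simp: R_def)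
  have "card {y. poly P y = 0} \<le> card R" using card_poly_roots_bound[OF P0] P(1) cardR by simp
  then have roots: "R = {y. poly P y = 0}" using card_seteq[OF poly_roots_finite[OF P0] sub] by simp
  have simple: "poly (pderiv P) y \<noteq> 0" if "poly P y = 0" for y
    by (rule simple_roots_of_many_roots[OF P0 _ that]) (use P(1) cardR roots in simp)
  show ?thesis
  proof (rule that)
    show "x (i - 1) < t i \<and> t i < x i" if "i \<in> {1..m}" for i using t[OF that] by simp
    show "strict_mono_on {1..m} t" by (rule smono)
    show "t ` {1..m} = {\<theta> \<in> ?I. ?G \<theta> = 0}"
    proof (intro equalityI subsetI)
      fix \<theta> assume "\<theta> \<in> t ` {1..m}"
      then show "\<theta> \<in> {\<theta> \<in> ?I. ?G \<theta> = 0}" using tI G0 by auto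
    next
      fix \<theta> assume th: "\<theta> \<in> {\<theta> \<in> ?I. ?G \<theta> = 0}"
      then have "j_q (nome (cis \<theta>)) \<in> R" using zeroP roots by auto
      then obtain i where "i \<in> {1..m}" "j_q (nome (cis \<theta>)) = j_q (nome (cis (t i)))" by (auto simp: R_def)
      then have "\<theta> = t i" using inj_onD[OF j_inj_on_arc] tI th by auto
      then show "\<theta> \<in> t ` {1..m}" using \<open>i \<in> {1..m}\<close> by auto
    qed
    show "simple_zeros_on ?G ?I" unfolding simple_zeros_on_def
    proof (intro ballI impI)
      fix \<theta> assume th: "\<theta> \<in> ?I" "?G \<theta> = 0"
      define z where "z = cis \<theta>"
      have z: "Im z > 0" using open_arc_facts(1)[OF th(1)] by (simp add: z_def)
      obtain J where J: "((\<lambda>z. j_q (nome z)) has_field_derivative J) (at z)" "J \<noteq> 0"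
        using j_derivative_nonzero_arc[OF th(1)] unfolding z_def by blast
      let ?u = "\<lambda>z. base_form (wt_s k) (nome z) * delta_q (nome z) ^ m"
      have "mform (wt_s k + 12 * m) (\<lambda>q. base_form (wt_s k) q * delta_q q ^ m)"
        by (intro mform_mult mform_power delta_form base_form_mform(1)[OF wf(1)])
      from mform_has_derivative[OF this z] obtain u' where u: "(?u has_field_derivative u') (at z)" by blast
      have v: "((\<lambda>z. poly P (j_q (nome z))) has_field_derivative poly (pderiv P) (j_q (nome z)) * J) (at z)"
        by (rule DERIV_chain2[OF poly_DERIV J(1)])
      have v0: "poly P (j_q (nome z)) = 0" using zeroP[OF th(1)] th(2) by (simp add: z_def)
      have "((\<lambda>z. ?u z * poly P (j_q (nome z))) has_field_derivative ?u z * (poly (pderiv P) (j_q (nome z)) * J)) (at z)"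
        using DERIV_mult[OF u v] v0 by (simp add: mult_ac)
      then have F': "(mod_form a k has_field_derivative ?u z * (poly (pderiv P) (j_q (nome z)) * J)) (at z)"
        by (rule has_field_derivative_transform_within_open[OF _ open_upper]) (use z form in auto)
      let ?d = "?u z * (poly (pderiv P) (j_q (nome z)) * J) * (\<i> * z)"
      have d: "?d \<noteq> 0" using base[OF th(1)] D[OF z] simple[OF v0] J(2) by (auto simp: z_def)
      have "((\<lambda>\<theta>. mod_form a k (cis \<theta>)) has_vector_derivative ?d) (at \<theta>)"
        using arc_vector_derivative[of \<theta> "mod_form a k"] F' z unfolding z_def by blast
      moreover have "((\<lambda>\<theta>. cis (real k * \<theta> / 2)) has_vector_derivative (of_real (real k / 2) * \<i> * cis (real k * \<theta> / 2))) (at \<theta>)"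
      proof -
        have "((\<lambda>w. exp (\<i> * (of_nat k * w / 2))) has_field_derivative (of_real (real k / 2) * \<i> * cis (real k * \<theta> / 2))) (at (of_real \<theta>))"
          by (auto intro!: derivative_eq_intros simp: cis_conv_exp)
        from has_vector_derivative_real_field[OF this] show ?thesis by (simp add: cis_conv_exp)
      qed
      ultimately have "(?G has_vector_derivative (cis (real k * \<theta> / 2) * ?d +
          (of_real (real k / 2) * \<i> * cis (real k * \<theta> / 2)) * mod_form a k (cis \<theta>))) (at \<theta>)"
        unfolding arc_fun_def[abs_def] by (intro has_vector_derivative_mult)
      moreover have "mod_form a k (cis \<theta>) = 0" using F0 th(2) by simp
      ultimately show "\<exists>D. (?G has_vector_derivative D) (at \<theta>) \<and> D \<noteq> 0" using d by auto
    qed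
    fix z assume z: "z \<in> fund_domain" "mod_form a k z = 0"
    note fd = fund_domain_cases[OF z(1)]
    show "z \<in> unit_arc"
    proof (rule ccontr)
      assume "z \<notin> unit_arc"
      then have large: "1 < cmod z" using fd(3) by simp
      have "base_form (wt_s k) (nome z) \<noteq> 0"
        using base_forms_nonzero_fund[OF fd(2) large fd(1)] by (simp add: base_form_def)
      then have "poly P (j_q (nome z)) = 0" using form[OF fd(1)] z(2) D[OF fd(1)] by simp
      then have "j_q (nome z) \<in> R" using roots by simp
      then obtain i where i: "i \<in> {1..m}" "j_q (nome z) = j_q (nome (cis (t i)))" by (auto simp: R_def)
      then show False using j_separates[OF fd(2) large fd(1) tI[OF i(1)]] by simp
    qed
  qed
qed

text \<open>At this angle the cosine is \<open>(- 1) ^ n\<close>, and the other terms together stay below 2.\<close>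

lemma sign_at_multiple:
  assumes "even k" "k \<ge> 12" "coeff_size a k \<le> 20 * (1 / 2) ^ (k div 2)" "k = 2 * l" "l \<le> 2 * n" "3 * n \<le> 2 * l"
  shows "real n * pi / real l \<in> closed_arc"
    "(- 1) ^ n * Re (arc_fun k (mod_form a k) (real n * pi / real l)) > 0"
proof -
  define \<theta> where "\<theta> = real n * pi / real l"
  have l: "l \<ge> 6" "real l > 0" using assms by auto
  have "real l \<le> real (2 * n)" "real (3 * n) \<le> real (2 * l)" using assms(5,6) by (simp_all only: of_nat_le_iff)
  then have "real l * pi \<le> 2 * real n * pi" "3 * real n * pi \<le> 2 * real l * pi" by (auto intro!: mult_right_mono)
  then show th: "real n * pi / real l \<in> closed_arc" using l(2) by (simp add: field_simps)
  have "real l * \<theta> = real n * pi" using l by (simp add: \<theta>_def)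
  then have c: "cos (real l * \<theta>) = (- 1) ^ n" by simp
  have "2 + 2 * cos \<theta> \<ge> 1" using arc_cos_bounds[OF th] by (simp add: \<theta>_def)
  then have B: "0 \<le> 1 / (2 + 2 * cos \<theta>) ^ l" "1 / (2 + 2 * cos \<theta>) ^ l \<le> 1"
    by (simp_all add: divide_le_eq)
  have "(1 / 2 :: real) ^ l \<le> (1 / 2) ^ 6" using l by (intro power_decreasing) auto
  moreover have "(1 / 2 :: real) ^ 6 = 1 / 64" by (simp add: power_divide)
  ultimately have "\<bar>Re (arc_fun k (mod_form a k) \<theta>) - (2 * (- 1) ^ n + 1 / (2 + 2 * cos \<theta>) ^ l)\<bar> \<le> 22 / 64"
    using mod_form_on_arc[OF assms(1,2) th assms(3,4)] unfolding c[symmetric] \<theta>_def[symmetric] by linarith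
  note close = this
  show "(- 1) ^ n * Re (arc_fun k (mod_form a k) (real n * pi / real l)) > 0"
  proof (cases "even n")
    case True
    then have e: "(- 1 :: real) ^ n = 1" by simp
    show ?thesis using close B unfolding \<theta>_def[symmetric] e by linarith
  next
    case False
    then have e: "(- 1 :: real) ^ n = - 1" by simp
    show ?thesis using close B unfolding \<theta>_def[symmetric] e by linarith
  qed
qed

theorem theorem2:
  fixes a :: "nat \<Rightarrow> nat \<Rightarrow> real"
  assumes "\<And>k. even k \<Longrightarrow> k \<ge> 12 \<Longrightarrow> coeff_size (a k) k \<le> 20 * (1 / 2) ^ (k div 2)"
  shows "\<forall>k. even k \<and> k \<ge> 12 \<longrightarrow>
           (\<forall>z\<in>fund_domain. mod_form (a k) k z = 0 \<longrightarrow> z \<in> unit_arc) \<and>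
           interlace_on_arc k (mod_form (a k) k) (mod_form (a (k + 12)) (k + 12))"
proof (intro allI impI)
  fix k :: nat assume "even k \<and> k \<ge> 12"
  then have k: "even k" "k \<ge> 12" and k': "even (k + 12)" "k + 12 \<ge> 12" by auto
  note wf = weight_facts[OF k]
  define m s l c where "m = wt_m k" and "s = wt_s k" and "l = k div 2" and "c = 3 * wt_m k + wt_s k div 3"
  have kl: "k = 2 * l" "k + 12 = 2 * (l + 6)" using k by (auto simp: l_def)
  have l: "l \<ge> 6" "real l > 0" using k kl by auto
  have c: "l \<le> 2 * c" "3 * (c + m) \<le> 2 * l"
    using wf(1) wf(2) kl(1) unfolding c_def m_def wt_residues_def by auto
  \<comment> \<open>The angles \<open>n * pi / l\<close> in the closed arc are those with \<open>c \<le> n \<le> c + m\<close>.\<close>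
  define f f' where "f = mod_form (a k) k" and "f' = mod_form (a (k + 12)) (k + 12)"
  have ck: "coeff_size (a k) k \<le> 20 * (1 / 2) ^ (k div 2)"
    "coeff_size (a (k + 12)) (k + 12) \<le> 20 * (1 / 2) ^ ((k + 12) div 2)" using assms k k' by blast+
  define x where "x = (\<lambda>i. real (c + i) * pi / real l)"
  have sx: "x i \<in> closed_arc" "(- 1) ^ (c + i) * Re (arc_fun k f (x i)) > 0" if "i \<le> m" for i
    using sign_at_multiple[OF k ck(1) kl(1), of "c + i"] c that unfolding x_def f_def by auto
  have x_incr: "x i < x (Suc i)" for i using l(2) by (simp add: x_def field_simps)
  have x_range: "pi / 2 \<le> x 0" "x m \<le> 2 * pi / 3" using sx(1)[of 0] sx(1)[of m] by auto
  note t_exists = zeros_from_sign_changes[where k = k and m = m and x = x and c = c and a = "a k",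
      OF k m_def x_incr x_range sx(2)[unfolded f_def], folded f_def]
  obtain t where t: "\<And>i. i \<in> {1..m} \<Longrightarrow> x (i - 1) < t i \<and> t i < x i" "strict_mono_on {1..m} t"
    "t ` {1..m} = {\<theta> \<in> open_arc. arc_fun k f \<theta> = 0}"
    "simple_zeros_on (arc_fun k f) open_arc"
    "\<And>z. z \<in> fund_domain \<Longrightarrow> f z = 0 \<Longrightarrow> z \<in> unit_arc"
    by (rule t_exists, assumption) (rule that)
  \<comment> \<open>For the weight \<open>k + 12\<close> the range of \<open>n\<close> starts at \<open>c + 3\<close> and ends at \<open>c + m + 4\<close>.\<close>
  define y where "y = (\<lambda>i. real (c + 3 + i) * pi / real (l + 6))"
  have sy: "y i \<in> closed_arc" "(- 1) ^ (c + 3 + i) * Re (arc_fun (k + 12) f' (y i)) > 0" if "i \<le> m + 1" for i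
    using sign_at_multiple[OF k' ck(2) kl(2), of "c + 3 + i"] c that unfolding y_def f'_def by auto
  \<comment> \<open>The zeros of the first form, completed by the two extreme angles of the second, serve as test points
    for the second form.\<close>
  define w where "w = (\<lambda>i. if i = 0 then y 0 else if i \<le> m then t i else y (m + 1))"
  have y0: "y 0 \<le> x 0"
  proof -
    have "(c + 3) * l \<le> c * (l + 6)" using c(1) by (simp add: algebra_simps)
    then have "real ((c + 3) * l) * pi \<le> real (c * (l + 6)) * pi" by (intro mult_right_mono) (simp_all only: of_nat_le_iff, simp)
    then show ?thesis using l(2) by (simp add: x_def y_def field_simps)
  qed
  have ym: "x m \<le> y (m + 1)"
  proof -
    have "(c + m) * (l + 6) \<le> (c + 3 + (m + 1)) * l" using c(2) by (simp add: algebra_simps)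
    then have "real ((c + m) * (l + 6)) * pi \<le> real ((c + 3 + (m + 1)) * l) * pi"
      by (intro mult_right_mono) (simp_all only: of_nat_le_iff, simp)
    then show ?thesis using l(2) by (simp add: x_def y_def field_simps)
  qed
  have w_incr: "w i < w (Suc i)" if i: "i < m + 1" for i
  proof -
    consider "i = 0" "m = 0" | "i = 0" "m > 0" | "0 < i" "i < m" | "0 < i" "i = m" using i by linarith
    then show ?thesis
    proof cases
      case 1
      then show ?thesis using l(2) by (simp add: w_def y_def divide_strict_right_mono)
    next
      case 2
      then show ?thesis using t(1)[of 1] y0 by (simp add: w_def)
    next
      case 3
      then show ?thesis using strict_mono_onD[OF t(2), of i "Suc i"] by (simp add: w_def)
    next
      case 4
      then show ?thesis using t(1)[of m] ym by (simp add: w_def)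
    qed
  qed
  have w_sign: "(- 1) ^ (c + 3 + i) * Re (arc_fun (k + 12) f' (w i)) > 0" if i: "i \<le> m + 1" for i
  proof -
    consider "i = 0" | "i = m + 1" | "i \<in> {1..m}" using i by fastforce
    then show ?thesis
    proof cases
      case 3
      define n \<theta> where "n = c + (i - 1)" and "\<theta> = t i"
      have n1: "n + 1 = c + i" using 3 by (auto simp: n_def)
      have th: "\<theta> \<in> open_arc" "arc_fun k f \<theta> = 0" using t(3) 3 by (auto simp: \<theta>_def)
      have thc: "\<theta> \<in> closed_arc" using th by auto
      have lo: "real n * pi < real l * \<theta>" "real l * \<theta> < (real n + 1) * pi"
        using t(1)[OF 3] l(2) n1[symmetric] unfolding x_def n_def[symmetric] \<theta>_def[symmetric]
        by (simp_all add: field_simps)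
      have "(- 1) ^ n * Re (arc_fun (k + 12) f' \<theta>) > 0"
      proof (rule interlacing_sign[OF l(1) lo])
        show "l \<le> 2 * n" using c(1) by (simp add: n_def)
        show "3 * (n + 1) \<le> 2 * l" using c(2) 3 unfolding n1 by auto
        show "\<bar>2 * cos (real l * \<theta>) + 1 / (2 + 2 * cos \<theta>) ^ l\<bar> \<le> 22 * (1 / 2) ^ l"
          using mod_form_on_arc[OF k thc ck(1) kl(1)] th(2) unfolding f_def by simp
        show "\<bar>Re (arc_fun (k + 12) f' \<theta>) - (2 * cos (real (l + 6) * \<theta>) + 1 / (2 + 2 * cos \<theta>) ^ (l + 6))\<bar> \<le> 22 * (1 / 2) ^ (l + 6)"
          unfolding f'_def by (rule mod_form_on_arc[OF k' thc ck(2) kl(2)])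
      qed
      moreover have "(- 1 :: real) ^ (c + 3 + i) = (- 1) ^ n"
      proof -
        have "c + 3 + i = n + 4" using n1 by simp
        then show ?thesis by (simp only: power_add) simp
      qed
      moreover have "w i = \<theta>" using 3 by (simp add: w_def \<theta>_def)
      ultimately show ?thesis by (simp only:)
    next
      case 1
      then have "w i = y i" by (simp add: w_def)
      then show ?thesis using sy(2)[OF i] by (simp only:)
    next
      case 2
      then have "w i = y i" by (simp add: w_def)
      then show ?thesis using sy(2)[OF i] by (simp only:)
    qed
  qed
  have w_range: "pi / 2 \<le> w 0" "w (m + 1) \<le> 2 * pi / 3" using sy(1)[of 0] sy(1)[of "m + 1"] by (auto simp: w_def)
  have m': "m + 1 = wt_m (k + 12)" using wf(4) by (simp add: m_def)
  note u_exists = zeros_from_sign_changes[where k = "k + 12" and m = "m + 1" and x = w and c = "c + 3"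
      and a = "a (k + 12)", OF k' m' w_incr w_range w_sign[unfolded f'_def], folded f'_def]
  obtain u where u: "\<And>i. i \<in> {1..m + 1} \<Longrightarrow> w (i - 1) < u i \<and> u i < w i" "strict_mono_on {1..m + 1} u"
    "u ` {1..m + 1} = {\<theta> \<in> open_arc. arc_fun (k + 12) f' \<theta> = 0}"
    "simple_zeros_on (arc_fun (k + 12) f') open_arc"
    "\<And>z. z \<in> fund_domain \<Longrightarrow> f' z = 0 \<Longrightarrow> z \<in> unit_arc"
    by (rule u_exists, assumption, assumption) (rule that)
  have between: "u j < t j \<and> t j < u (j + 1)" if j: "j \<in> {1..m}" for j
    using u(1)[of j] u(1)[of "j + 1"] j by (auto simp: w_def)
  have "interlace_on_arc k f f'"
    unfolding interlace_on_arc_def zeros_interlace_def m_def[symmetric]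
    using t(2-4) u(2-4) between by blast
  then show "(\<forall>z\<in>fund_domain. mod_form (a k) k z = 0 \<longrightarrow> z \<in> unit_arc) \<and>
      interlace_on_arc k (mod_form (a k) k) (mod_form (a (k + 12)) (k + 12))"
    using t(5) by (auto simp: f_def f'_def)
qed

end
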